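(* Let $t,s,u$ be complex parameters with $|t|,|s|,|u|<1$ and $|pq|<|t^2s^2u|$. Whenever two functions $\alpha(z,t)$ and $\beta(z,t)$ form an integral elliptic Bailey pair with respect to the parameter $t$, the new functions defined for $w\in\mathbb{T}$ by $$\alpha'(w,st)=\frac{\Gamma(tuw^\pm)}{\Gamma(ts^2uw^\pm)}\,\alpha(w,t)$$ and $$\beta'(w,st)=\kappa\,\frac{\Gamma(t^2s^2,\,t^2suw^\pm)}{\Gamma(s^2,\,t^2,\,suw^\pm)}\int_{\mathbb{T}}\frac{\Gamma(sw^\pm x^\pm,\,ux^\pm)}{\Gamma(x^{\pm 2},\,t^2s^2ux^\pm)}\,\beta(x,t)\,\frac{dx}{x}$$ form an integral elliptic Bailey pair with respect to the parameter $st$, that is, $$\beta'(w,st)=\kappa\int_{\mathbb{T}}\Gamma(stw^\pm z^\pm)\,\alpha'(z,st)\,\frac{dz}{z},\qquad w\in\mathbb{T}.$$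
   Context: $\mathbb{T}$ is the positively oriented unit circle in $\mathbb{C}$; $q,p$ are fixed complex numbers with $|q|,|p|<1$. The elliptic gamma function is $$\Gamma(z)=\Gamma(z;q,p)=\prod_{j,k=0}^\infty\frac{1-z^{-1}q^{j+1}p^{k+1}}{1-zq^jp^k}.$$ Conventions: $\Gamma(a_1,\ldots,a_m)=\prod_{r=1}^m\Gamma(a_r;q,p)$; $\Gamma(az^\pm)=\Gamma(az,az^{-1})$; $\Gamma(z^{\pm2})=\Gamma(z^2,z^{-2})$; $\Gamma(az^\pm x^\pm)=\Gamma(azx,azx^{-1},az^{-1}x,az^{-1}x^{-1})$. An entry carrying $\pm$ signs inside a list of arguments is expanded in this way (e.g. $\Gamma(a,bw^\pm)=\Gamma(a)\Gamma(bw)\Gamma(bw^{-1})$). Also $(q;q)_\infty=\prod_{n=1}^\infty(1-q^n)$, $(p;p)_\infty=\prod_{n=1}^\infty(1-p^n)$ and $$\kappa=\frac{(p;p)_\infty(q;q)_\infty}{4\pi i}.$$ Definition. Two functions $\alpha(z,\tau)$ and $\beta(z,\tau)$ form an integral elliptic Bailey pair with respect to the parameter (value) $\tau$ if $$\beta(w,\tau)=\kappa\int_{\mathbb{T}}\Gamma(\tau w^\pm z^\pm)\,\alpha(z,\tau)\,\frac{dz}{z}$$ for $w\in\mathbb{T}$, where the integral is required to exist (as a Lebesgue integral). *)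

theory Defs
  imports "HOL-Complex_Analysis.Complex_Analysis"
begin

text \<open>
  For \<open>norm q < 1\<close>, \<open>norm p < 1\<close> and \<open>z \<noteq> 0\<close> the double product converges absolutely away from the
  poles of the elliptic gamma function, so iterating it is no restriction. At a pole one factor is
  a division by zero; the definition then gives the value \<open>0\<close>, and \<open>1 / ell_gamma q p z\<close> is also
  \<open>0\<close>, which is the correct value of the reciprocal.
\<close>
definition ell_gamma :: "complex \<Rightarrow> complex \<Rightarrow> complex \<Rightarrow> complex" where
  "ell_gamma q p z =
     (\<Prod>j. \<Prod>k. (1 - inverse z * q ^ (j + 1) * p ^ (k + 1)) / (1 - z * q ^ j * p ^ k))"

definition ell_gammas :: "complex \<Rightarrow> complex \<Rightarrow> complex list \<Rightarrow> complex" where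
  "ell_gammas q p as = prod_list (map (ell_gamma q p) as)"

text \<open>
  \<open>pm a z\<close> and \<open>pm2 a z x\<close> are the argument lists abbreviated \<open>a z\<^sup>\<plusminus>\<close> and \<open>a z\<^sup>\<plusminus> x\<^sup>\<plusminus>\<close>; the entry
  \<open>z\<^sup>\<plusminus>\<^sup>2\<close> is \<open>pm 1 (z\<^sup>2)\<close>.
\<close>
definition pm :: "complex \<Rightarrow> complex \<Rightarrow> complex list" where
  "pm a z = [a * z, a * inverse z]"

definition pm2 :: "complex \<Rightarrow> complex \<Rightarrow> complex \<Rightarrow> complex list" where
  "pm2 a z x = [a * z * x, a * z * inverse x, a * inverse z * x, a * inverse z * inverse x]"

definition euler_poch :: "complex \<Rightarrow> complex" where
  "euler_poch q = (\<Prod>n. 1 - q ^ (n + 1))"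

definition bailey_kappa :: "complex \<Rightarrow> complex \<Rightarrow> complex" where
  "bailey_kappa q p = euler_poch p * euler_poch q / (4 * complex_of_real pi * \<i>)"

text \<open>
  Lebesgue integral of \<open>f(z) dz\<close> over the positively oriented unit circle, with \<open>z = cis \<theta>\<close> and
  \<open>dz = \<i> cis \<theta> d\<theta>\<close>. The measure is the complete one, so that integrands need only be Lebesgue
  measurable. The contour integral of the library is a gauge integral, hence the separate notion
  of integrability; the two integrals agree on integrable functions.
\<close>
definition circle_integrable :: "(complex \<Rightarrow> complex) \<Rightarrow> bool" where
  "circle_integrable f \<longleftrightarrow>
     set_integrable lebesgue {0..2 * pi} (\<lambda>\<theta>. f (cis \<theta>) * (\<i> * cis \<theta>))"

definition circle_integral :: "(complex \<Rightarrow> complex) \<Rightarrow> complex" where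
  "circle_integral f = (LINT \<theta>:{0..2 * pi}|lebesgue. f (cis \<theta>) * (\<i> * cis \<theta>))"

lemma has_contour_integral_circle_integral:
  assumes "circle_integrable f"
  shows "(f has_contour_integral circle_integral f) (circlepath 0 1)"
proof -
  have "((\<lambda>\<theta>. f (cis \<theta>) * (\<i> * cis \<theta>)) has_integral circle_integral f) {0..2 * pi}"
    using has_integral_set_lebesgue[OF assms[unfolded circle_integrable_def]]
    unfolding circle_integral_def .
  then show ?thesis
    unfolding circlepath_def
    by (subst has_contour_integral_part_circlepath_iff) (simp_all add: mult.assoc)
qed

definition elliptic_bailey_pair ::
  "complex \<Rightarrow> complex \<Rightarrow> complex \<Rightarrow> (complex \<Rightarrow> complex) \<Rightarrow> (complex \<Rightarrow> complex) \<Rightarrow> bool" where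
  "elliptic_bailey_pair q p \<tau> \<alpha> \<beta> \<longleftrightarrow>
     (\<forall>w\<in>sphere 0 1.
        circle_integrable (\<lambda>z. ell_gammas q p (pm2 \<tau> w z) * \<alpha> z / z) \<and>
        \<beta> w = bailey_kappa q p *
          circle_integral (\<lambda>z. ell_gammas q p (pm2 \<tau> w z) * \<alpha> z / z))"

text \<open>The integrand, with respect to \<open>dx\<close>, in the definition of the transformed \<open>\<beta>\<close>.\<close>
definition bailey_beta_integrand ::
  "complex \<Rightarrow> complex \<Rightarrow> complex \<Rightarrow> complex \<Rightarrow> complex \<Rightarrow> (complex \<Rightarrow> complex) \<Rightarrow>
   complex \<Rightarrow> complex \<Rightarrow> complex" where
  "bailey_beta_integrand q p t s u \<beta> w x =
     ell_gammas q p (pm2 s w x @ pm u x) /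
     ell_gammas q p (pm 1 (x\<^sup>2) @ pm (t\<^sup>2 * s\<^sup>2 * u) x) * \<beta> x / x"

end

theory Submission
  imports Defs
begin

text \<open>
  Inserting the definition of \<open>\<beta>\<close> into that of \<open>\<beta>'\<close> and interchanging the two integrals reduces
  the claim to Spiridonov's elliptic beta integral with the parameters
  \<open>s w, s / w, u, t z, t / z\<close>, whose product is \<open>t\<^sup>2 s\<^sup>2 u\<close>.

  The elliptic beta integral is proved as follows. Let \<open>I\<close> be the quotient of the integral by its
  conjectured value, as a function of the parameters \<open>t\<^sub>1, \<dots>, t\<^sub>5\<close> with product \<open>A\<close>. A theta function
  identity shows that the difference of the suitably normalised integrands with parameters
  \<open>q t\<^sub>1\<close> and \<open>t\<^sub>1\<close> has the form \<open>H (z / q) - H z\<close>, where \<open>H\<close> is holomorphic near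
  \<open>1 \<le> |z| \<le> 1 / |q|\<close> if \<open>|p| < |A|\<close>; hence \<open>I\<close> is invariant under \<open>t\<^sub>1 \<mapsto> q t\<^sub>1\<close>. If
  \<open>|p| < |t\<^sub>2 t\<^sub>3 t\<^sub>4 t\<^sub>5|\<close>, then \<open>I\<close> is holomorphic in \<open>t\<^sub>1\<close> on an annulus wider than a fundamental one,
  so it attains its maximum modulus in the interior and does not depend on \<open>t\<^sub>1\<close>. Moving \<open>t\<^sub>1, t\<^sub>2\<close>
  to \<open>\<i> r, - \<i> r\<close> and letting \<open>r \<rightarrow> 1\<close>, the poles pinch the contour at \<open>\<plusminus> \<i>\<close>, the integrand becomes
  a Poisson kernel, and the limit gives the constant. The remaining parameters are reached by
  analytic continuation in one parameter at a time, and \<open>q = 0\<close> by continuity in \<open>q\<close>.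
\<close>

section \<open>Infinite products along a geometric progression\<close>

text \<open>The obstacle is that the q-shift costs a factor |q| in |A|. If B is the product of t2,
  ..., t5, the admissible t1 fill the annulus |pq| / |B| < |t1| < 1, and the ratio of its radii
  exceeds 1 / |q| only when |p| < |B|; for smaller B only continuation from larger parameters is
  left. The points \<i> r and - \<i> r are chosen because the pole pairs \<i> r, \<i> / r and - \<i>
  r, - \<i> / r pinch the circle where z^2 = -1. There the factor 1 / \<Gamma>(z^2, z^(-2)) is
  nonzero, whereas at z = 1 and z = -1 it has a double zero. Moreover t1 t2 = r^2, so the evaluation
  contains \<Gamma>(r^2), whose pole at r = 1 balances the growth of the integral. In the final
  reduction, a Bailey pair only provides integrability of \<alpha> times a kernel; since the kernel
  for w = 1 is continuous without zeros on the circle, \<alpha> itself is integrable there, and this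
  is what permits the interchange of the integrals.\<close>

definition geo_prod :: "(complex \<Rightarrow> complex) \<Rightarrow> complex \<Rightarrow> complex \<Rightarrow> complex" where
  "geo_prod f q x = (\<Prod>j. f (x * q ^ j))"

lemma holomorphic_on_entire_compose:
  assumes "f holomorphic_on UNIV" "g holomorphic_on S"
  shows "(\<lambda>x. f (g x)) holomorphic_on S"
  using holomorphic_on_compose_gen[OF assms(2,1)] by (simp add: o_def)

text \<open>The derivative is bounded on the compact disc, and the mean value inequality applies.
  With y = x q^j the factors of a product along a geometric progression differ from 1 by a
  geometrically decaying amount.\<close>

lemma entire_minus_one_bound:
  fixes f :: "complex \<Rightarrow> complex"
  assumes f: "f holomorphic_on UNIV" "f 0 = 1"
  obtains C where "C \<ge> 0" "\<And>y. norm y \<le> R \<Longrightarrow> norm (f y - 1) \<le> C * norm y"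
proof -
  have "compact (deriv f ` cball 0 R)"
    by (intro compact_continuous_image holomorphic_on_imp_continuous_on
          holomorphic_on_subset[OF holomorphic_deriv[OF f(1)]]) auto
  then obtain B where B: "\<And>y. y \<in> cball 0 R \<Longrightarrow> norm (deriv f y) \<le> B"
    by (meson bounded_iff compact_imp_bounded image_eqI)
  show thesis
  proof
    show "norm (f y - 1) \<le> max B 0 * norm y" if "norm y \<le> R" for y
    proof -
      have "norm (f y - f 0) \<le> max B 0 * norm (y - 0)"
      proof (rule field_differentiable_bound[of "cball 0 R"])
        show "(f has_field_derivative deriv f z) (at z within cball 0 R)" for z
          using f(1) by (meson UNIV_I has_field_derivative_at_within holomorphic_derivI open_UNIV)
        have "0 \<le> R" using that norm_ge_zero order_trans by blast
        then show "0 \<in> cball 0 R" by simp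
      qed (use B that in \<open>auto intro: max.coboundedI1\<close>)
      then show ?thesis using f(2) by simp
    qed
  qed auto
qed

lemma convergent_geo_prod:
  assumes "f holomorphic_on UNIV" "f 0 = 1" "norm q < 1"
  shows "convergent_prod (\<lambda>j. f (x * q ^ j))"
proof -
  obtain C where C: "C \<ge> 0" "\<And>y. norm y \<le> norm x \<Longrightarrow> norm (f y - 1) \<le> C * norm y"
    using entire_minus_one_bound[OF assms(1,2), of "norm x"] by metis
  have "norm (f (x * q ^ j) - 1) \<le> C * norm x * norm q ^ j" for j
  proof -
    have "norm (x * q ^ j) \<le> norm x"
      using assms(3) by (simp add: norm_mult norm_power mult_left_le power_le_one)
    from C(2)[OF this] show ?thesis by (simp add: norm_mult norm_power mult.assoc)
  qed
  then have "\<forall>\<^sub>F j in sequentially. norm (norm (f (x * q ^ j) - 1)) \<le> C * norm x * norm q ^ j"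
    by (simp only: real_norm_def abs_norm_cancel eventually_True)
  moreover have "summable (\<lambda>j. C * norm x * norm q ^ j)"
    using assms(3) by (intro summable_mult summable_geometric) auto
  ultimately have "summable (\<lambda>j. norm (f (x * q ^ j) - 1))"
    by (rule summable_comparison_test_ev)
  then have "abs_convergent_prod (\<lambda>j. f (x * q ^ j))"
    by (simp only: abs_convergent_prod_conv_summable)
  then show ?thesis by (rule abs_convergent_prod_imp_convergent_prod)
qed

lemma geo_prod_0 [simp]: "f 0 = 1 \<Longrightarrow> geo_prod f q 0 = 1"
  by (simp add: geo_prod_def)

lemma geo_prod_rec:
  assumes "f holomorphic_on UNIV" "f 0 = 1" "norm q < 1"
  shows "geo_prod f q x = f x * geo_prod f q (q * x)"
proof -
  note conv = convergent_geo_prod[OF assms]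
  have "geo_prod f q x = f (x * q ^ 0) * (\<Prod>j. f (x * q ^ Suc j))"
  proof -
    have "(\<lambda>j. f (x * q ^ Suc j)) has_prod (\<Prod>j. f (x * q ^ Suc j))"
      using convergent_geo_prod[OF assms, of "q * x"]
      by (intro convergent_prod_has_prod) (simp add: mult_ac)
    then have "(\<lambda>j. f (x * q ^ j)) has_prod ((\<Prod>j. f (x * q ^ Suc j)) * f (x * q ^ 0))"
      by (rule has_prod_Suc_imp)
    then show ?thesis
      unfolding geo_prod_def by (metis has_prod_unique mult.commute)
  qed
  then show ?thesis by (simp add: geo_prod_def mult_ac)
qed

lemma geo_prod_nonzero:
  assumes "f holomorphic_on UNIV" "f 0 = 1" "norm q < 1" "\<And>j. f (x * q ^ j) \<noteq> 0"
  shows "geo_prod f q x \<noteq> 0"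
  unfolding geo_prod_def using assms by (intro prodinf_nonzero convergent_geo_prod) auto

lemma geo_prod_mult:
  assumes "f holomorphic_on UNIV" "f 0 = 1" "g holomorphic_on UNIV" "g 0 = 1" "norm q < 1"
  shows "geo_prod (\<lambda>x. f x * g x) q x = geo_prod f q x * geo_prod g q x"
  unfolding geo_prod_def using assms by (intro prodinf_mult[symmetric] convergent_geo_prod) auto

text \<open>The bound C R r^n on the n-th deviation from 1 does not depend on the point, so the
  M-test applies. Uniformity in the base as well as in the argument is what later yields continuity
  in q at q = 0.\<close>

lemma uniform_limit_geo_prod:
  assumes f: "f holomorphic_on UNIV" "f 0 = 1" and r: "r < 1"
  shows "uniform_limit (cball 0 r \<times> cball 0 R) (\<lambda>n (q, x). \<Prod>j<n. f (x * q ^ j))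
           (\<lambda>(q, x). geo_prod f q x) sequentially"
proof (cases "r \<ge> 0")
  case False
  then have "cball (0::complex) r = {}" by auto
  then show ?thesis by (simp add: uniform_limit_iff)
next
  case True
  let ?K = "cball (0::complex) r \<times> cball (0::complex) R"
  obtain C where C: "C \<ge> 0" "\<And>y. norm y \<le> R \<Longrightarrow> norm (f y - 1) \<le> C * norm y"
    using entire_minus_one_bound[OF f, of R] by metis
  have contf: "continuous_on S f" for S
    using f(1) holomorphic_on_imp_continuous_on continuous_on_subset by blast
  have "uniformly_convergent_on ?K (\<lambda>n v. \<Prod>j<n. case v of (q, x) \<Rightarrow> f (x * q ^ j))"
  proof (rule Infinite_Products.uniformly_convergent_on_prod')
    show "continuous_on ?K (\<lambda>v. case v of (q, x) \<Rightarrow> f (x * q ^ n))" for n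
      unfolding case_prod_unfold
      by (intro continuous_on_compose2[OF contf[of UNIV]] continuous_intros) auto
    show "uniformly_convergent_on ?K (\<lambda>N v. \<Sum>n<N. norm ((case v of (q, x) \<Rightarrow> f (x * q ^ n)) - 1))"
    proof (rule Weierstrass_m_test')
      fix n and v assume v: "v \<in> ?K"
      obtain q x where [simp]: "v = (q, x)" by (cases v)
      have q: "norm q \<le> r" "norm x \<le> R" using v by auto
      then have R: "0 \<le> R" using norm_ge_zero order_trans by blast
      have *: "norm (x * q ^ n) \<le> R * r ^ n"
        unfolding norm_mult norm_power using q R by (intro mult_mono power_mono) auto
      also have "R * r ^ n \<le> R"
        using R r True by (simp add: mult_left_le power_le_one)
      finally have "norm (f (x * q ^ n) - 1) \<le> C * norm (x * q ^ n)" by (rule C(2))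
      also have "\<dots> \<le> C * (R * r ^ n)" using C(1) * by (rule mult_left_mono[rotated])
      finally show "norm (norm ((case v of (q, x) \<Rightarrow> f (x * q ^ n)) - 1)) \<le> C * (R * r ^ n)" by simp
    next
      show "summable (\<lambda>n. C * (R * r ^ n))"
        using r True by (intro summable_mult summable_geometric) auto
    qed
  qed (auto intro: compact_Times)
  then have "uniform_limit ?K (\<lambda>n v. \<Prod>j<n. case v of (q, x) \<Rightarrow> f (x * q ^ j))
      (\<lambda>v. \<Prod>j. case v of (q, x) \<Rightarrow> f (x * q ^ j)) sequentially"
  proof (subst (asm) uniformly_convergent_uniform_limit_iff, elim uniform_limit_cong'[THEN iffD1, rotated 2])
    fix v assume v: "v \<in> ?K"
    obtain q x where [simp]: "v = (q, x)" by (cases v)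
    have "(\<lambda>n. \<Prod>j\<le>n. f (x * q ^ j)) \<longlonglongrightarrow> (\<Prod>j. f (x * q ^ j))"
      using v r by (intro convergent_prod_LIMSEQ convergent_geo_prod f) auto
    then have "(\<lambda>n. \<Prod>j<n. f (x * q ^ j)) \<longlonglongrightarrow> (\<Prod>j. f (x * q ^ j))"
      by (subst filterlim_sequentially_Suc[symmetric]) (simp add: lessThan_Suc_atMost)
    then show "lim (\<lambda>n. \<Prod>j<n. case v of (q, x) \<Rightarrow> f (x * q ^ j)) =
       (\<Prod>j. case v of (q, x) \<Rightarrow> f (x * q ^ j))"
      by (simp add: limI)
  qed simp
  then show ?thesis
    by (simp add: geo_prod_def case_prod_unfold)
qed

lemma continuous_on_geo_prod:
  assumes f: "f holomorphic_on UNIV" "f 0 = 1"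
  shows "continuous_on (ball 0 1 \<times> UNIV) (\<lambda>(q, x). geo_prod f q x)"
proof -
  have contf: "continuous_on S f" for S
    using f(1) holomorphic_on_imp_continuous_on continuous_on_subset by blast
  have *: "continuous_on (ball 0 r \<times> ball 0 R) (\<lambda>(q, x). geo_prod f q x)" if "r < 1" for r R
  proof -
    have "continuous_on (cball 0 r \<times> cball 0 R) (\<lambda>(q, x). geo_prod f q x)"
    proof (rule uniform_limit_theorem[OF _ uniform_limit_geo_prod[OF f that]])
      show "\<forall>\<^sub>F n in sequentially. continuous_on (cball 0 r \<times> cball 0 R)
         (\<lambda>(q, x). \<Prod>j<n. f (x * q ^ j))"
        unfolding case_prod_unfold
        by (intro always_eventually allI continuous_on_prod continuous_on_compose2[OF contf[of UNIV]]
             continuous_intros) auto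
    qed simp
    then show ?thesis by (rule continuous_on_subset) (intro Sigma_mono ball_subset_cball)
  qed
  have "continuous (at (q, x)) (\<lambda>(q, x). geo_prod f q x)" if q: "norm q < 1" for q x
  proof -
    obtain r where r: "norm q < r" "r < 1" using dense[OF q] by auto
    have "(q, x) \<in> ball 0 r \<times> ball 0 (norm x + 1)" using r by auto
    moreover have "open (ball (0::complex) r \<times> ball (0::complex) (norm x + 1))"
      by (intro open_Times) auto
    ultimately show ?thesis
      using *[OF r(2), of "norm x + 1"] continuous_on_eq_continuous_at by blast
  qed
  then show ?thesis
    by (intro continuous_at_imp_continuous_on) auto
qed

lemma holomorphic_geo_prod:
  assumes f: "f holomorphic_on UNIV" "f 0 = 1" and q: "norm q < 1"
  shows "geo_prod f q holomorphic_on UNIV"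
proof (rule holomorphic_uniform_sequence[where f = "\<lambda>n x. \<Prod>j<n. f (x * q ^ j)"])
  show "(\<lambda>x. \<Prod>j<n. f (x * q ^ j)) holomorphic_on UNIV" for n
    by (intro holomorphic_on_prod holomorphic_on_entire_compose[OF f(1)] holomorphic_intros)
  show "\<exists>d>0. cball x d \<subseteq> UNIV \<and>
      uniform_limit (cball x d) (\<lambda>n x. \<Prod>j<n. f (x * q ^ j)) (geo_prod f q) sequentially" for x
  proof (intro exI[of _ 1] conjI)
    have sub: "cball x 1 \<subseteq> cball 0 (norm x + 1)"
    proof
      fix y assume "y \<in> cball x 1"
      then show "y \<in> cball 0 (norm x + 1)"
        using norm_triangle_ineq2[of y x] by (simp add: dist_norm norm_minus_commute)
    qed
    have "uniform_limit ((\<lambda>y. (q, y)) ` cball x 1) (\<lambda>n (q, x). \<Prod>j<n. f (x * q ^ j))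
           (\<lambda>(q, x). geo_prod f q x) sequentially"
      by (rule uniform_limit_on_subset[OF uniform_limit_geo_prod[OF f q, of "norm x + 1"]])
         (use sub in auto)
    then show "uniform_limit (cball x 1) (\<lambda>n x. \<Prod>j<n. f (x * q ^ j)) (geo_prod f q) sequentially"
      by (simp add: uniform_limit_iff)
  qed auto
qed auto

section \<open>Theta functions and the elliptic gamma function\<close>

definition qpoch :: "complex \<Rightarrow> complex \<Rightarrow> complex" where
  "qpoch p = geo_prod (\<lambda>y. 1 - y) p"

text \<open>The double shifted factorial (x; q, p)_infinity as a nested \<open>geo_prod\<close>:
  since \<open>qpoch p\<close> is again entire with value 1 at 0, convergence, holomorphy and
  recursion carry over from the single product.\<close>

definition dpoch :: "complex \<Rightarrow> complex \<Rightarrow> complex \<Rightarrow> complex" where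
  "dpoch q p = geo_prod (qpoch p) q"

text \<open>The multiplicative theta function, holomorphic off 0, whose zeros for p \<noteq> 0 are
  the integer powers of p. It is the factor that \<Gamma> acquires under x -> q x.\<close>

definition theta :: "complex \<Rightarrow> complex \<Rightarrow> complex" where
  "theta p x = qpoch p x * qpoch p (p / x)"

lemma holomorphic_qpoch_UNIV: "norm p < 1 \<Longrightarrow> qpoch p holomorphic_on UNIV"
  unfolding qpoch_def by (intro holomorphic_geo_prod holomorphic_intros) auto

lemma qpoch_0 [simp]: "qpoch p 0 = 1"
  by (simp add: qpoch_def)

lemma qpoch_rec: "norm p < 1 \<Longrightarrow> qpoch p x = (1 - x) * qpoch p (p * x)"
  unfolding qpoch_def by (intro geo_prod_rec holomorphic_intros) auto

lemma qpoch_1 [simp]: "norm p < 1 \<Longrightarrow> qpoch p 1 = 0"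
  using qpoch_rec[of p 1] by simp

lemma qpoch_nonzero_gen:
  assumes "norm p < 1" "\<And>k. x * p ^ k \<noteq> 1"
  shows "qpoch p x \<noteq> 0"
  unfolding qpoch_def using assms by (intro geo_prod_nonzero holomorphic_intros) auto

lemma norm_mult_power_less_1:
  fixes x q :: complex
  assumes "norm x < 1" "norm q < 1"
  shows "norm (x * q ^ j) < 1"
proof -
  have "norm (x * q ^ j) \<le> norm x"
    using assms(2) by (simp add: norm_mult norm_power mult_left_le power_le_one)
  with assms(1) show ?thesis by simp
qed

lemma qpoch_nonzero:
  assumes "norm p < 1" "norm x < 1"
  shows "qpoch p x \<noteq> 0"
proof (rule qpoch_nonzero_gen)
  show "x * p ^ k \<noteq> 1" for k
    using norm_mult_power_less_1[OF assms(2,1), of k] by auto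
qed fact

lemma holomorphic_dpoch_UNIV:
  "norm q < 1 \<Longrightarrow> norm p < 1 \<Longrightarrow> dpoch q p holomorphic_on UNIV"
  unfolding dpoch_def by (intro holomorphic_geo_prod holomorphic_qpoch_UNIV) auto

lemma dpoch_rec_q:
  "norm q < 1 \<Longrightarrow> norm p < 1 \<Longrightarrow> dpoch q p x = qpoch p x * dpoch q p (q * x)"
  unfolding dpoch_def by (intro geo_prod_rec holomorphic_qpoch_UNIV) auto

text \<open>The definition nests the p-product inside the q-product. The first factor of every inner
  product is split off, and these factors collect to \<open>qpoch q x\<close>.\<close>

lemma dpoch_rec_p:
  assumes "norm q < 1" "norm p < 1"
  shows "dpoch q p x = qpoch q x * dpoch q p (p * x)"
proof -
  have "dpoch q p x = geo_prod (\<lambda>x. (1 - x) * qpoch p (p * x)) q x"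
    unfolding dpoch_def geo_prod_def using assms(2) by (simp add: qpoch_rec[symmetric])
  also have "\<dots> = geo_prod (\<lambda>x. 1 - x) q x * geo_prod (\<lambda>x. qpoch p (p * x)) q x"
    using assms(1)
    by (intro geo_prod_mult holomorphic_on_entire_compose[OF holomorphic_qpoch_UNIV[OF assms(2)]]
          holomorphic_intros) auto
  also have "geo_prod (\<lambda>x. qpoch p (p * x)) q x = dpoch q p (p * x)"
    unfolding dpoch_def geo_prod_def by (simp add: mult.assoc)
  finally show ?thesis by (simp add: qpoch_def)
qed

lemma dpoch_nonzero:
  assumes "norm q < 1" "norm p < 1" "norm x < 1"
  shows "dpoch q p x \<noteq> 0"
  unfolding dpoch_def using assms
  by (intro geo_prod_nonzero holomorphic_qpoch_UNIV qpoch_nonzero norm_mult_power_less_1) auto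

text \<open>Valid for every z: at a pole both sides are 0 through division by zero, and at z = 0
  both are 1.\<close>

lemma ell_gamma_eq:
  assumes "norm q < 1" "norm p < 1"
  shows "ell_gamma q p z = dpoch q p (p * q / z) / dpoch q p z"
proof -
  have eq: "(\<Prod>k. (1 - inverse z * q ^ (j + 1) * p ^ (k + 1)) / (1 - z * q ^ j * p ^ k)) =
      qpoch p (p * q / z * q ^ j) / qpoch p (z * q ^ j)" for j
  proof -
    have "qpoch p (p * q / z * q ^ j) / qpoch p (z * q ^ j) =
       (\<Prod>k. (1 - p * q / z * q ^ j * p ^ k) / (1 - z * q ^ j * p ^ k))"
      unfolding qpoch_def geo_prod_def
      by (intro prodinf_divide convergent_geo_prod[of "\<lambda>y. 1 - y"] holomorphic_intros assms) auto
    then show ?thesis by (simp add: field_simps)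
  qed
  show ?thesis
    unfolding ell_gamma_def eq dpoch_def geo_prod_def
    by (intro prodinf_divide[symmetric] convergent_geo_prod holomorphic_qpoch_UNIV assms) auto
qed

lemma euler_poch_eq: "euler_poch q = qpoch q q"
  by (simp add: euler_poch_def qpoch_def geo_prod_def)

lemma holomorphic_qpoch [holomorphic_intros]:
  "norm p < 1 \<Longrightarrow> g holomorphic_on S \<Longrightarrow> (\<lambda>x. qpoch p (g x)) holomorphic_on S"
  by (rule holomorphic_on_entire_compose[OF holomorphic_qpoch_UNIV])

lemma holomorphic_dpoch [holomorphic_intros]:
  "norm q < 1 \<Longrightarrow> norm p < 1 \<Longrightarrow> g holomorphic_on S \<Longrightarrow> (\<lambda>x. dpoch q p (g x)) holomorphic_on S"
  by (rule holomorphic_on_entire_compose[OF holomorphic_dpoch_UNIV])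

lemma holomorphic_theta [holomorphic_intros]:
  "norm p < 1 \<Longrightarrow> g holomorphic_on S \<Longrightarrow> (\<And>x. x \<in> S \<Longrightarrow> g x \<noteq> 0) \<Longrightarrow>
     (\<lambda>x. theta p (g x)) holomorphic_on S"
  unfolding theta_def by (intro holomorphic_intros) auto

lemma theta_1 [simp]: "norm p < 1 \<Longrightarrow> theta p 1 = 0"
  by (simp add: theta_def)

lemma theta_inverse:
  assumes "norm p < 1" "x \<noteq> 0"
  shows "theta p (1 / x) = - theta p x / x"
proof -
  have 1: "theta p (1 / x) = (1 - 1 / x) * qpoch p (p / x) * qpoch p (p * x)"
    unfolding theta_def using qpoch_rec[OF assms(1), of "1 / x"] by simp
  have 2: "theta p x = (1 - x) * qpoch p (p * x) * qpoch p (p / x)"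
    unfolding theta_def using qpoch_rec[OF assms(1), of x] by simp
  show ?thesis unfolding 1 2 using assms(2) by (simp add: field_simps)
qed

lemma theta_shift:
  assumes "norm p < 1" "p \<noteq> 0" "x \<noteq> 0"
  shows "theta p (p * x) = - theta p x / x"
proof -
  have "theta p (p * x) = theta p (1 / x)"
    using assms(2,3) by (simp add: theta_def field_simps)
  then show ?thesis using assms theta_inverse by simp
qed

lemma theta_unshift:
  assumes "norm p < 1" "p \<noteq> 0" "x \<noteq> 0"
  shows "theta p (x / p) = - (x / p) * theta p x"
  using theta_shift[OF assms(1,2), of "x / p"] assms(2,3) by (simp add: field_simps)

lemma theta_nonzero:
  assumes "norm p < norm x" "norm x < 1"
  shows "theta p x \<noteq> 0"
proof -
  have "norm p < 1" using assms by simp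
  moreover have "norm (p / x) < 1"
    using assms by (auto simp: norm_divide divide_less_eq)
  ultimately show ?thesis
    unfolding theta_def using assms qpoch_nonzero by simp
qed

lemma theta_square_nonzero:
  assumes "norm p < 1" "norm z = 1" "z\<^sup>2 \<noteq> 1"
  shows "theta p (z\<^sup>2) \<noteq> 0"
proof -
  have n: "norm (p * z\<^sup>2) < 1" "norm (p / z\<^sup>2) < 1"
    using assms by (simp_all add: norm_mult norm_divide norm_power)
  have "theta p (z\<^sup>2) = (1 - z\<^sup>2) * qpoch p (p * z\<^sup>2) * qpoch p (p / z\<^sup>2)"
    unfolding theta_def using qpoch_rec[OF assms(1), of "z\<^sup>2"] by simp
  then show ?thesis using assms qpoch_nonzero[OF assms(1) n(1)] qpoch_nonzero[OF assms(1) n(2)] by auto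
qed

lemma theta_eq_0D:
  assumes "norm p < 1" "p \<noteq> 0" "y \<noteq> 0" "theta p y = 0"
  obtains n :: int where "y = p powi n"
proof -
  consider "qpoch p y = 0" | "qpoch p (p / y) = 0"
    using assms(4) by (auto simp: theta_def)
  then show thesis
  proof cases
    case 1
    then obtain k where "y * p ^ k = 1" using qpoch_nonzero_gen[OF assms(1)] by blast
    then have "y = p powi (- int k)"
      using assms(2) by (simp add: power_int_minus field_simps)
    then show thesis by (rule that)
  next
    case 2
    then obtain k where "p / y * p ^ k = 1" using qpoch_nonzero_gen[OF assms(1)] by blast
    then have "y = p powi (int (Suc k))"
      using assms(3) by (simp add: field_simps del: of_nat_Suc flip: power_Suc)
    then show thesis by (rule that)
  qed
qed

text \<open>Reduces statements about the infinitely many zeros \<open>p powi n * x\<close> to a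
  single one of them.\<close>

lemma powi_invariant:
  fixes p x :: "'a :: field"
  assumes "p \<noteq> 0" "x \<noteq> 0" and inv: "\<And>x. x \<noteq> 0 \<Longrightarrow> P (p * x) \<longleftrightarrow> P x"
  shows "P (p powi n * x) \<longleftrightarrow> P x"
proof -
  have pow: "P (p ^ k * y) \<longleftrightarrow> P y" if "y \<noteq> 0" for k y
    using that by (induction k) (simp_all add: inv assms(1) mult.assoc)
  show ?thesis
  proof (cases "n \<ge> 0")
    case True
    then show ?thesis using pow[OF assms(2), of "nat n"] by (simp add: power_int_def)
  next
    case False
    then show ?thesis
      using pow[of "p powi n * x" "nat (- n)"] assms(1,2) by (simp add: power_int_def field_simps)
  qed
qed

lemma theta_powi:
  assumes "norm p < 1" "p \<noteq> 0"
  shows "theta p (p powi n) = 0"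
proof -
  have "theta p (p powi n * 1) = 0 \<longleftrightarrow> theta p 1 = 0"
    by (rule powi_invariant) (simp_all add: theta_shift assms)
  then show ?thesis using assms(1) by simp
qed

text \<open>Differentiate the dilation equation: the term with the derivative of k carries the
  factor f y = 0.\<close>

lemma deriv_dilation_at_zero:
  assumes f: "f holomorphic_on - {0}" and k: "k holomorphic_on - {0}" and p: "p \<noteq> 0"
    and y: "y \<noteq> 0" "f y = 0" and dil: "\<And>x. x \<noteq> 0 \<Longrightarrow> f (p * x) = k x * f x"
  shows "deriv f (p * y) * p = k y * deriv f y"
proof -
  have der: "(g has_field_derivative deriv g x) (at x)" if "g holomorphic_on - {0}" "x \<noteq> 0" for g x
    using holomorphic_derivI[OF that(1), of x] that(2) by auto
  have "((\<lambda>x. f (p * x)) has_field_derivative deriv f (p * y) * p) (at y)"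
    using y p by (intro DERIV_chain2[OF der[OF f]]) (auto intro!: derivative_eq_intros)
  moreover have "((\<lambda>x. k x * f x) has_field_derivative k y * deriv f y) (at y)"
    using DERIV_mult[OF der[OF k y(1)] der[OF f y(1)]] y(2) by (simp add: mult.commute)
  then have "((\<lambda>x. f (p * x)) has_field_derivative k y * deriv f y) (at y)"
  proof (rule DERIV_cong_ev[OF refl _ refl, THEN iffD1, rotated])
    show "\<forall>\<^sub>F x in nhds y. k x * f x = f (p * x)"
      using t1_space_nhds[OF y(1)] by eventually_elim (simp add: dil)
  qed
  ultimately show ?thesis by (rule DERIV_unique)
qed

text \<open>Being a simple zero is preserved by the dilation x -> p x, so only the zero at 1 has to
  be examined. There 1 - x splits off, and the derivative is minus the square of (p;
  p)_infinity.\<close>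

lemma deriv_theta_nonzero:
  assumes p: "norm p < 1" "p \<noteq> 0" and y: "y \<noteq> 0" "theta p y = 0"
  shows "deriv (theta p) y \<noteq> 0"
proof -
  have hol: "theta p holomorphic_on - {0}"
    by (intro holomorphic_theta[of _ "\<lambda>x. x", simplified] p) auto
  define P where "P x \<longleftrightarrow> theta p x = 0 \<and> deriv (theta p) x \<noteq> 0" for x
  have "P (p * x) \<longleftrightarrow> P x" if x: "x \<noteq> 0" for x
  proof (cases "theta p x = 0")
    case True
    have "deriv (theta p) (p * x) * p = - 1 / x * deriv (theta p) x"
      by (rule deriv_dilation_at_zero[OF hol _ p(2) x True])
         (auto intro!: holomorphic_intros simp: theta_shift p)
    then show ?thesis
      using x p(2) True by (auto simp: P_def theta_shift p field_simps)
  next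
    case False
    then show ?thesis using x by (simp add: P_def theta_shift p)
  qed
  then have inv: "P (p powi n * 1) \<longleftrightarrow> P 1" for n
    by (intro powi_invariant p) auto
  have "((\<lambda>x. (1 - x) * (qpoch p (p * x) * qpoch p (p / x))) has_field_derivative
          - (qpoch p p * qpoch p p)) (at 1)"
  proof -
    have "(\<lambda>x. qpoch p (p * x) * qpoch p (p / x)) holomorphic_on - {0}"
      by (intro holomorphic_intros p) auto
    from holomorphic_derivI[OF this, of 1]
    have "((\<lambda>x. qpoch p (p * x) * qpoch p (p / x)) has_field_derivative
       deriv (\<lambda>x. qpoch p (p * x) * qpoch p (p / x)) 1) (at 1)" by auto
    then show ?thesis
      by (rule DERIV_cong[OF DERIV_mult[OF DERIV_diff[OF DERIV_const DERIV_ident]]]) simp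
  qed
  moreover have "theta p = (\<lambda>x. (1 - x) * (qpoch p (p * x) * qpoch p (p / x)))"
    unfolding theta_def using qpoch_rec[OF p(1)] by (intro ext) (metis mult.assoc)
  ultimately have "deriv (theta p) 1 = - (qpoch p p * qpoch p p)"
    using DERIV_imp_deriv by simp
  then have "P 1" using qpoch_nonzero[OF p(1) p(1)] p(1) by (simp add: P_def)
  moreover obtain n where "y = p powi n" using theta_eq_0D[OF p y] .
  ultimately show ?thesis using inv[of n] by (simp add: P_def)
qed

section \<open>Holomorphic functions invariant under a dilation\<close>

lemma open_annulus: "open {x::complex. a < norm x \<and> norm x < b}"
  by (intro open_Collect_conj open_Collect_less continuous_intros)

lemma connected_annulus_0: "connected {x::complex. a < norm x \<and> norm x < b}"
  using connected_annulus(1)[of a "0::complex" b] by simp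

text \<open>Some closed annulus |p| r \<le> |x| \<le> r fits inside S because a < |p| b. Its maximum
  of |F| is, by invariance, a maximum over a full neighbourhood, so a boundary maximum is an
  interior one as well.\<close>

lemma dilation_invariant_imp_constant:
  fixes F :: "complex \<Rightarrow> complex" and a b :: real
  defines "S \<equiv> {x. a < norm x \<and> norm x < b}"
  assumes hol: "F holomorphic_on S" and p: "p \<noteq> 0" "norm p < 1"
    and ab: "0 \<le> a" "a < norm p * b"
    and inv: "\<And>x. x \<in> S \<Longrightarrow> p * x \<in> S \<Longrightarrow> F (p * x) = F x"
  shows "F constant_on S"
proof -
  have "a / norm p < b" using p ab by (simp add: field_simps)
  then obtain r where r: "a / norm p < r" "r < b" using dense by blast
  have np: "norm p > 0" using p by simp
  have "0 \<le> a / norm p" using ab np by simp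
  with r have r0: "r > 0" by linarith
  have ar: "a < norm p * r" using r(1) np by (simp add: field_simps)
  have prr: "norm p * r < r" using r0 p by simp
  define K where "K = {x::complex. norm p * r \<le> norm x \<and> norm x \<le> r}"
  have "K = cball 0 r - ball 0 (norm p * r)" by (auto simp: K_def)
  then have "compact K" by (simp add: compact_diff)
  moreover have "complex_of_real r \<in> K" using r0 prr by (simp add: K_def)
  moreover have "K \<subseteq> S" using ar r by (auto simp: K_def S_def)
  ultimately obtain x0 where x0: "x0 \<in> K" "\<And>x. x \<in> K \<Longrightarrow> norm (F x) \<le> norm (F x0)"
    using continuous_attains_sup[of K "\<lambda>x. norm (F x)"]
      holomorphic_on_imp_continuous_on[OF hol] continuous_on_subset continuous_on_norm
    by (metis empty_iff)
  \<comment> \<open>Wide enough to contain all maximum points in its interior, narrow enough that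
    one multiplication or division by p brings each of its points back into K.\<close>
  define U where "U = {x::complex. max a (norm p * norm p * r) < norm x \<and> norm x < min b (r / norm p)}"
  show ?thesis
  proof (rule maximum_modulus_principle[OF hol])
    show "open S" unfolding S_def by (rule open_annulus)
    show "connected S" unfolding S_def by (rule connected_annulus_0)
    show "open U" unfolding U_def by (rule open_annulus)
    show "U \<subseteq> S" by (auto simp: U_def S_def)
    have "norm p * norm p * r < norm p * r" using prr np by (simp add: mult.assoc)
    moreover have "r < r / norm p" using r0 p np by (simp add: field_simps)
    ultimately show "x0 \<in> U"
      using x0(1) ar r by (auto simp: K_def U_def)
    show "norm (F x) \<le> norm (F x0)" if x: "x \<in> U" for x
    proof -
      consider "x \<in> K" | "norm x > r" | "norm x < norm p * r" unfolding K_def by fastforce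
      then show ?thesis
      proof cases
        case 2
        then have "p * x \<in> K" using x np by (auto simp: U_def K_def norm_mult field_simps)
        then show ?thesis
          using inv[of x] x0(2)[of "p * x"] \<open>K \<subseteq> S\<close> \<open>U \<subseteq> S\<close> x by (metis subsetD)
      next
        case 3
        then have "x / p \<in> K" using x np by (auto simp: U_def K_def norm_divide field_simps)
        then show ?thesis
          using inv[of "x / p"] x0(2)[of "x / p"] \<open>K \<subseteq> S\<close> \<open>U \<subseteq> S\<close> x p(1)
            by (metis nonzero_mult_div_cancel_left subsetD times_divide_eq_right)
      qed (use x0 in auto)
    qed
  qed
qed

text \<open>At a zero of g the chosen value is the l'Hopital limit, so the isolated singularity is
  removable. The explicit formula allows invariance under a dilation to be checked at the zeros
  too.\<close>

lemma holomorphic_quotient_simple_zeros: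
  assumes f: "f holomorphic_on S" and g: "g holomorphic_on S" and S: "open S"
    and zeros: "\<And>x. x \<in> S \<Longrightarrow> g x = 0 \<Longrightarrow> f x = 0 \<and> deriv g x \<noteq> 0"
  shows "(\<lambda>x. if g x = 0 then deriv f x / deriv g x else f x / g x) holomorphic_on S"
    (is "?F holomorphic_on S")
proof -
  have diff: "?F field_differentiable (at x)" if x: "x \<in> S" for x
  proof (cases "g x = 0")
    case False
    have "\<forall>\<^sub>F y in nhds x. g y \<noteq> 0"
    proof -
      have "isCont g x"
        using holomorphic_on_imp_continuous_on[OF g] S x continuous_on_eq_continuous_at by blast
      then have "\<forall>\<^sub>F y in at x. g y \<noteq> 0"
        using False unfolding continuous_at by (rule tendsto_imp_eventually_ne)
      with False show ?thesis by (simp add: eventually_nhds_conv_at)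
    qed
    then have "\<forall>\<^sub>F y in nhds x. ?F y = f y / g y" by eventually_elim simp
    moreover have "(\<lambda>y. f y / g y) field_differentiable (at x)"
      using f g S x False
      by (intro field_differentiable_divide) (auto simp: holomorphic_on_open field_differentiable_def)
    ultimately show ?thesis
      unfolding field_differentiable_def using DERIV_cong_ev[of x x ?F "\<lambda>y. f y / g y"] by auto
  next
    case True
    note der = holomorphic_derivI[OF f S x] holomorphic_derivI[OF g S x]
    have nz: "deriv g x \<noteq> 0" using zeros x True by blast
    have lim: "((\<lambda>y. f y / g y) \<longlongrightarrow> ?F x) (at x)"
      using zeros[OF x True] True by (intro lhopital_complex_simple[OF der]) auto
    have "\<forall>\<^sub>F y in at x. g y \<noteq> 0"
    proof -
      have "((\<lambda>y. (g y - g x) / (y - x)) \<longlongrightarrow> deriv g x) (at x)"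
        using der(2) by (simp add: has_field_derivative_iff)
      from tendsto_imp_eventually_ne[OF this nz] show ?thesis
        by eventually_elim (use True in auto)
    qed
    then obtain e where e: "e > 0" "ball x e \<subseteq> S" "\<And>y. y \<in> ball x e \<Longrightarrow> y \<noteq> x \<Longrightarrow> g y \<noteq> 0"
    proof -
      assume *: "\<forall>\<^sub>F y in at x. g y \<noteq> 0"
        "\<And>e. e > 0 \<Longrightarrow> ball x e \<subseteq> S \<Longrightarrow> (\<And>y. y \<in> ball x e \<Longrightarrow> y \<noteq> x \<Longrightarrow> g y \<noteq> 0) \<Longrightarrow> thesis"
      obtain d where d: "d > 0" "\<And>y. y \<noteq> x \<Longrightarrow> dist y x < d \<Longrightarrow> g y \<noteq> 0"
        using *(1) unfolding eventually_at by blast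
      obtain d' where "d' > 0" "ball x d' \<subseteq> S" using S x open_contains_ball by blast
      with d show thesis by (intro *(2)[of "min d d'"]) (auto simp: dist_commute)
    qed
    have "?F holomorphic_on ball x e"
    proof (rule no_isolated_singularity'[where K = "{x}"])
      have "(\<lambda>y. f y / g y) holomorphic_on ball x e - {x}"
        using e by (intro holomorphic_on_divide holomorphic_on_subset[OF f] holomorphic_on_subset[OF g]) auto
      then show "?F holomorphic_on ball x e - {x}"
        by (rule holomorphic_transform) (use e in auto)
      have "(?F \<longlongrightarrow> ?F x) (at x)"
      proof (rule Lim_transform_eventually[OF lim])
        show "\<forall>\<^sub>F y in at x. f y / g y = ?F y"
          using \<open>\<forall>\<^sub>F y in at x. g y \<noteq> 0\<close> by eventually_elim simp
      qed
      then show "(?F \<longlongrightarrow> ?F z) (at z within ball x e)" if "z \<in> {x}" for z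
        using that tendsto_within_subset by blast
    qed auto
    then show ?thesis
      using e(1) by (intro holomorphic_on_imp_differentiable_at[of _ "ball x e"]) auto
  qed
  then show ?thesis by (auto simp: holomorphic_on_def intro: field_differentiable_at_within)
qed

section \<open>Theta function identities\<close>

text \<open>
  Both sides are theta functions of degree two in \<open>x\<close> that agree at the zeros \<open>1 / z\<close>, \<open>z * c\<close> of
  \<open>theta p (z * x) * theta p (z * c / x)\<close>; their difference is therefore a constant multiple of the
  latter, and it vanishes at \<open>x = z\<close>.
\<close>
lemma theta_addition:
  assumes p: "norm p < 1" and nz: "z \<noteq> 0" "c \<noteq> 0" "a \<noteq> 0" "x \<noteq> 0"
    and th: "theta p (z\<^sup>2) \<noteq> 0" "theta p c \<noteq> 0" "theta p (z\<^sup>2 * c) \<noteq> 0"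
  shows "theta p (z\<^sup>2) * theta p c * (theta p (a * x) * theta p (a * c / x)) =
     theta p (a * z) * theta p (a * c / z) * (theta p (z * x) * theta p (z * c / x)) -
     z\<^sup>2 * theta p (a / z) * theta p (a * c * z) * (theta p (x / z) * theta p (c / (x * z)))"
proof (cases "p = 0")
  \<comment> \<open>For p = 0 there is no dilation to exploit; theta degenerates to 1 - y, and the
    claim is an identity of rational functions.\<close>
  case True
  have "theta 0 y = 1 - y" for y
    using qpoch_rec[of 0 y] by (simp add: theta_def)
  then show ?thesis
    using nz unfolding True by (simp add: divide_simps) (simp add: algebra_simps power2_eq_square)
next
  case False
  define X where "X b x = theta p (b * x) * theta p (b * c / x)" for b x
  \<comment> \<open>The multiplier does not depend on b, so the three terms of f below and the
    divisor \<open>X z\<close> all share it, and the quotient is invariant.\<close>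
  have Xshift: "X b (p * x) = c / (p * x\<^sup>2) * X b x" if "b \<noteq> 0" "x \<noteq> 0" for b x
  proof -
    have 1: "theta p (b * (p * x)) = - theta p (b * x) / (b * x)"
      using theta_shift[OF p False, of "b * x"] that by (simp add: mult_ac)
    have 2: "theta p (b * c / (p * x)) = - (b * c / x / p) * theta p (b * c / x)"
      using theta_unshift[OF p False, of "b * c / x"] that nz by (simp add: field_simps)
    show ?thesis
      unfolding X_def 1 2 using that nz False by (simp add: field_simps power2_eq_square)
  qed
  have Xhol: "X b holomorphic_on - {0}" if "b \<noteq> 0" for b
    unfolding X_def using p that nz by (intro holomorphic_intros) auto
  define f where "f x = theta p (z\<^sup>2) * theta p c * X a x - theta p (a * z) * theta p (a * c / z) * X z x
      + z\<^sup>2 * theta p (a / z) * theta p (a * c * z) * X (1 / z) x" for x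
  have fhol: "f holomorphic_on - {0}"
    unfolding f_def using nz by (intro holomorphic_intros Xhol) auto
  have fshift: "f (p * x) = c / (p * x\<^sup>2) * f x" if "x \<noteq> 0" for x
    using that nz by (simp add: f_def Xshift algebra_simps)
  have f0_shift: "f (p powi n * x) = 0 \<longleftrightarrow> f x = 0" if "x \<noteq> 0" for n x
    using that nz False by (intro powi_invariant) (simp_all add: fshift)
  have inv2: "theta p (1 / z / z) = - theta p (z\<^sup>2) / z\<^sup>2"
    using theta_inverse[OF p, of "z\<^sup>2"] nz by (simp add: power2_eq_square)
  have "f (1 / z) = 0"
  proof -
    have "X a (1 / z) = theta p (a / z) * theta p (a * c * z)" by (simp add: X_def)
    moreover have "X z (1 / z) = 0" using p nz by (simp add: X_def)
    moreover have "X (1 / z) (1 / z) = - theta p (z\<^sup>2) / z\<^sup>2 * theta p c"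
      using nz inv2 by (simp add: X_def)
    ultimately show ?thesis using nz by (simp add: f_def)
  qed
  moreover have "f (z * c) = 0"
  proof -
    have "X a (z * c) = theta p (a / z) * theta p (a * c * z)"
      using nz by (simp add: X_def mult_ac)
    moreover have "X z (z * c) = 0" using p nz by (simp add: X_def)
    moreover have "X (1 / z) (z * c) = - theta p (z\<^sup>2) / z\<^sup>2 * theta p c"
      using nz inv2 by (simp add: X_def)
    ultimately show ?thesis using nz by (simp add: f_def)
  qed
  ultimately have f0: "f (p powi n * (1 / z)) = 0" "f (p powi n * (z * c)) = 0" for n
    using f0_shift[of "1 / z" n] f0_shift[of "z * c" n] nz by auto
  \<comment> \<open>A common zero of the two factors would be a double zero of \<open>X z\<close>.
    It would make z^2 c a power of p, against the third assumption in \<open>th\<close>.\<close>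
  have not_both: "\<not> (theta p (z * y) = 0 \<and> theta p (z * c / y) = 0)" if y0: "y \<noteq> 0" for y
  proof
    assume y: "theta p (z * y) = 0 \<and> theta p (z * c / y) = 0"
    obtain m where m: "z * y = p powi m" using theta_eq_0D[OF p False, of "z * y"] y nz y0 by auto
    obtain n where n: "z * c / y = p powi n" using theta_eq_0D[OF p False, of "z * c / y"] y nz y0 by auto
    have "z\<^sup>2 * c = p powi (m + n)"
      using False y0 by (simp add: power_int_add m[symmetric] n[symmetric] power2_eq_square)
    then show False using th(3) theta_powi[OF p False] by simp
  qed
  have dertheta: "(theta p has_field_derivative deriv (theta p) y) (at y)" if "y \<noteq> 0" for y
    using holomorphic_derivI[of "theta p" "- {0}" y] holomorphic_theta[of p "\<lambda>x. x" "- {0}"] that p by auto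
  define F where "F y = (if X z y = 0 then deriv f y / deriv (X z) y else f y / X z y)" for y
  have zeros: "f y = 0 \<and> deriv (X z) y \<noteq> 0" if y: "y \<noteq> 0" and X0: "X z y = 0" for y
  proof -
    have "((\<lambda>y. theta p (z * y) * theta p (z * c / y)) has_field_derivative
       deriv (theta p) (z * y) * z * theta p (z * c / y) +
       deriv (theta p) (z * c / y) * (- (z * c / y\<^sup>2)) * theta p (z * y)) (at y)"
      using y nz by (intro DERIV_mult DERIV_chain2[OF dertheta])
        (auto intro!: derivative_eq_intros simp: power2_eq_square)
    then have dX: "deriv (X z) y = deriv (theta p) (z * y) * z * theta p (z * c / y) +
       deriv (theta p) (z * c / y) * (- (z * c / y\<^sup>2)) * theta p (z * y)"
      using DERIV_imp_deriv unfolding X_def by blast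
    consider "theta p (z * y) = 0" | "theta p (z * c / y) = 0" using X0 by (auto simp: X_def)
    then show ?thesis
    proof cases
      case 1
      then obtain n where n: "z * y = p powi n" using theta_eq_0D[OF p False, of "z * y"] nz y by auto
      then have "y = p powi n * (1 / z)" using nz by (simp add: field_simps)
      moreover have "theta p (z * c / y) \<noteq> 0" using not_both[OF y] 1 by blast
      ultimately show ?thesis
        using dX 1 nz y deriv_theta_nonzero[OF p False, of "z * y"] f0(1)[of n] by auto
    next
      case 2
      then obtain n where n: "z * c / y = p powi n" using theta_eq_0D[OF p False, of "z * c / y"] nz y by auto
      then have "y = p powi (- n) * (z * c)" using y False by (simp add: power_int_minus field_simps)
      moreover have "theta p (z * y) \<noteq> 0" using not_both[OF y] 2 by blast
      ultimately show ?thesis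
        using dX 2 nz y deriv_theta_nonzero[OF p False, of "z * c / y"] f0(2)[of "- n"] by auto
    qed
  qed
  have Fhol: "F holomorphic_on - {0}"
    unfolding F_def using zeros
    by (intro holomorphic_quotient_simple_zeros[OF fhol Xhol[OF nz(1)]]) auto
  have Fshift: "F (p * y) = F y" if y: "y \<noteq> 0" for y
  proof -
    define k where "k x = c / (p * x\<^sup>2)" for x
    have k: "k holomorphic_on - {0}" unfolding k_def using False by (intro holomorphic_intros) auto
    have ky: "k y \<noteq> 0" using nz y False by (simp add: k_def)
    note Xz = Xhol[OF nz(1)]
    have X: "X z (p * y) = k y * X z y" and f: "f (p * y) = k y * f y"
      using y nz by (simp_all add: Xshift fshift k_def)
    show ?thesis
    proof (cases "X z y = 0")
      case True
      have "deriv (X z) (p * y) * p = k y * deriv (X z) y"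
        using nz by (intro deriv_dilation_at_zero[OF Xz k False y True]) (simp add: Xshift k_def)
      moreover have "deriv f (p * y) * p = k y * deriv f y"
        using nz zeros[OF y True] by (intro deriv_dilation_at_zero[OF fhol k False y]) (simp_all add: fshift k_def)
      ultimately have "deriv f (p * y) / deriv (X z) (p * y) = deriv f y / deriv (X z) y"
        using ky False by (metis mult_divide_mult_cancel_left mult_divide_mult_cancel_right)
      then show ?thesis using True X by (simp add: F_def)
    qed (use X f ky in \<open>simp add: F_def\<close>)
  qed
  have "f z = 0"
    using p nz by (simp add: f_def X_def power2_eq_square)
  moreover have Xzz: "X z z \<noteq> 0"
    using th nz by (simp add: X_def power2_eq_square)
  ultimately have Fz: "F z = 0" by (simp add: F_def)
  \<comment> \<open>With inner radius 0 the annulus is wide enough for every p; the outer radius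
    only has to enclose x and z.\<close>
  have "F constant_on {y. 0 < norm y \<and> norm y < max (norm x) (norm z) + 1}"
    using False p nz Fshift
    by (intro dilation_invariant_imp_constant holomorphic_on_subset[OF Fhol])
       (auto intro!: mult_pos_pos simp: max_def add_nonneg_pos)
  then have "F x = F z"
    using nz unfolding constant_on_def by (smt (verit) mem_Collect_eq zero_less_norm_iff)
  then have "f x = 0" using Fz zeros[OF nz(4)] by (auto simp: F_def split: if_splits)
  then show ?thesis using nz by (simp add: f_def X_def algebra_simps)
qed

text \<open>
  With \<open>c = t2 t5\<close>, \<open>d = t3 t4\<close>, the addition formula expands all products over \<open>t2, t5\<close> and over
  \<open>t3, t4\<close> in terms of those at \<open>z\<close> and \<open>1 / z\<close>. The mixed terms cancel, and the coefficients of the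
  other two agree by a third instance of the formula.
\<close>
lemma theta_beta_identity:
  fixes t1 t2 t3 t4 t5 z p :: complex
  defines "A \<equiv> t1 * t2 * t3 * t4 * t5"
  assumes t: "norm t1 < 1" "norm t2 < 1" "norm t3 < 1" "norm t4 < 1" "norm t5 < 1"
    and A: "norm p < norm A" and z: "norm z = 1"
  shows "theta p (z\<^sup>2) *
      (theta p (t1 * z) * theta p (t1 / z) *
         (theta p (A / t2) * theta p (A / t3) * theta p (A / t4) * theta p (A / t5)) -
       theta p (A * z) * theta p (A / z) *
         (theta p (t1 * t2) * theta p (t1 * t3) * theta p (t1 * t4) * theta p (t1 * t5))) =
     t1 * theta p (t1 * A) *
      (z ^ 3 * theta p (A * z) *
         (theta p (t1 / z) * theta p (t2 / z) * theta p (t3 / z) * theta p (t4 / z) * theta p (t5 / z)) -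
       theta p (A / z) / z *
         (theta p (t1 * z) * theta p (t2 * z) * theta p (t3 * z) * theta p (t4 * z) * theta p (t5 * z)))"
proof -
  have nz: "t1 \<noteq> 0" "t2 \<noteq> 0" "t3 \<noteq> 0" "t4 \<noteq> 0" "t5 \<noteq> 0"
    using A by (auto simp: A_def)
  have z0: "z \<noteq> 0" using z by auto
  have le: "norm A \<le> norm (x * y)" if "A = w * (x * y)" "norm w \<le> 1" for w x y
    unfolding that(1) norm_mult[of w] using that(2) by (simp add: mult_left_le_one_le)
  have le1: "norm (x * y) < 1" if "norm x < 1" "norm y < 1" for x y :: complex
    using mult_strict_mono[of "norm x" 1 "norm y" 1] that by (simp add: norm_mult)
  have p1: "norm p < 1"
  proof -
    have "norm A < 1" unfolding A_def by (intro le1 t)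
    with A show ?thesis by simp
  qed
  define c d where "c = t2 * t5" and "d = t3 * t4"
  have c1: "norm c < 1" "norm d < 1" unfolding c_def d_def by (intro le1 t)+
  have "norm (t1 * d) \<le> 1" "norm (t1 * c) \<le> 1"
    using le1[OF t(1) c1(1)] le1[OF t(1) c1(2)] by auto
  then have "norm A \<le> norm c" "norm A \<le> norm d"
    using le[of "t1 * d" t2 t5] le[of "t1 * c" t3 t4] by (simp_all add: A_def c_def d_def mult_ac)
  \<comment> \<open>A = t1 c d with all factors in the unit disc, so |A| bounds |c| and |d| from
    below. This puts c, d and their products with z^2 in the region where theta has no
    zeros.\<close>
  with A have cp: "norm p < norm c" "norm p < norm d" by auto
  have th: "theta p c \<noteq> 0" "theta p d \<noteq> 0"
    using theta_nonzero c1 cp by auto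
  have thz: "theta p (z\<^sup>2 * c) \<noteq> 0" "theta p (z\<^sup>2 * d) \<noteq> 0"
    by (rule theta_nonzero; use c1 cp z in \<open>simp add: norm_mult norm_power\<close>)+
  have cd0: "c \<noteq> 0" "d \<noteq> 0" using nz by (auto simp: c_def d_def)
  have A_cd: "A = t1 * c * d" by (simp add: A_def c_def d_def)
  show ?thesis
  proof (cases "z\<^sup>2 = 1")
    \<comment> \<open>Here z = 1 / z: the left side is 0 because theta vanishes at 1, the right side
      because its two terms coincide.\<close>
    case True
    then have "x / z = x * z" "z ^ 3 = z" for x
      using z0 by (simp_all add: field_simps power2_eq_square power3_eq_cube)
    then show ?thesis using True p1 by simp
  next
    case False
    define s where "s = theta p (z\<^sup>2)"
    have s0: "s \<noteq> 0" using theta_square_nonzero[OF p1 z False] by (simp add: s_def)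
    note add_c = theta_addition[OF p1 z0 cd0(1) _ _ s0[unfolded s_def] th(1) thz(1), folded s_def]
    note add_d = theta_addition[OF p1 z0 cd0(2) _ _ s0[unfolded s_def] th(2) thz(2), folded s_def]
    define X where "X a = theta p (a * t2) * theta p (a * t5)" for a
    define Y where "Y a = theta p (a * t3) * theta p (a * t4)" for a
    have 1: "s * theta p c * X a = theta p (a * z) * theta p (a * c / z) * X z -
        z\<^sup>2 * theta p (a / z) * theta p (a * c * z) * X (1 / z)" if "a \<noteq> 0" for a
      using add_c[OF that nz(2)] nz by (simp add: X_def c_def mult_ac)
    have 2: "s * theta p d * Y a = theta p (a * z) * theta p (a * d / z) * Y z -
        z\<^sup>2 * theta p (a / z) * theta p (a * d * z) * Y (1 / z)" if "a \<noteq> 0" for a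
      using add_d[OF that nz(3)] nz by (simp add: Y_def d_def mult_ac)
    \<comment> \<open>The instance a = t1 d, x = 1 / t1 of the addition formula for c, so that a x =
      d and a c / x = t1 A.\<close>
    have 3: "theta p (t1 / z) * theta p (t1 * c * z) * theta p (t1 * d * z) * theta p (A / z) -
       theta p (A * z) * theta p (t1 * z) * theta p (t1 * c / z) * theta p (t1 * d / z) =
       - (t1 / z) * (theta p (t1 * A) * s * theta p c * theta p d)"
    proof -
      have i: "theta p (1 / t1 / z) = - theta p (t1 * z) / (t1 * z)" "theta p (z / t1) = - theta p (t1 / z) / (t1 / z)"
        using theta_inverse[OF p1, of "t1 * z"] theta_inverse[OF p1, of "t1 / z"] nz z0 by simp_all
      have "s * theta p c * (theta p d * theta p (t1 * A)) =
         theta p (t1 * d * z) * theta p (A / z) * (theta p (z / t1) * theta p (t1 * c * z)) -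
         z\<^sup>2 * theta p (t1 * d / z) * theta p (A * z) * (theta p (1 / t1 / z) * theta p (t1 * c / z))"
        using add_c[of "t1 * d" "1 / t1"] nz cd0 by (simp add: A_cd mult_ac)
      then show ?thesis unfolding i using nz z0 by (simp add: field_simps power2_eq_square)
    qed
    have tX: "A / t2 = t1 * d * t5" "A / t5 = t1 * d * t2" "A / t3 = t1 * c * t4" "A / t4 = t1 * c * t3"
      using nz by (simp_all add: A_def c_def d_def field_simps)
    have 1: "s * theta p c * X (t1 * d) = theta p (t1 * d * z) * theta p (A / z) * X z -
        z\<^sup>2 * theta p (t1 * d / z) * theta p (A * z) * X (1 / z)"
      and 2: "s * theta p c * X t1 = theta p (t1 * z) * theta p (t1 * c / z) * X z -
        z\<^sup>2 * theta p (t1 / z) * theta p (t1 * c * z) * X (1 / z)"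
      and 4: "s * theta p d * Y (t1 * c) = theta p (t1 * c * z) * theta p (A / z) * Y z -
        z\<^sup>2 * theta p (t1 * c / z) * theta p (A * z) * Y (1 / z)"
      and 5: "s * theta p d * Y t1 = theta p (t1 * z) * theta p (t1 * d / z) * Y z -
        z\<^sup>2 * theta p (t1 / z) * theta p (t1 * d * z) * Y (1 / z)"
      using 1[of "t1 * d"] 1[of t1] 2[of "t1 * c"] 2[of t1] nz cd0 by (simp_all add: A_cd mult_ac)
    \<comment> \<open>The nonzero factor s theta(c) theta(d), together with the s already present,
      supplies the normalisations of the four expansions; it is cancelled at the end.\<close>
    have "(s * theta p c * theta p d) * (s * (theta p (t1 * z) * theta p (t1 / z) * (X (t1 * d) * Y (t1 * c)) -
         theta p (A * z) * theta p (A / z) * (X t1 * Y t1))) =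
       theta p (t1 * z) * theta p (t1 / z) * ((s * theta p c * X (t1 * d)) * (s * theta p d * Y (t1 * c))) -
         theta p (A * z) * theta p (A / z) * ((s * theta p c * X t1) * (s * theta p d * Y t1))"
      by (simp add: algebra_simps)
    also have "\<dots> = (theta p (t1 / z) * theta p (t1 * c * z) * theta p (t1 * d * z) * theta p (A / z) -
       theta p (A * z) * theta p (t1 * z) * theta p (t1 * c / z) * theta p (t1 * d / z)) *
       (theta p (t1 * z) * theta p (A / z) * (X z * Y z) -
         z ^ 4 * theta p (t1 / z) * theta p (A * z) * (X (1 / z) * Y (1 / z)))"
      unfolding 1 2 4 5 by algebra
    also have "\<dots> = (s * theta p c * theta p d) * (t1 * theta p (t1 * A) *
       (z ^ 3 * theta p (A * z) * (theta p (t1 / z) * (X (1 / z) * Y (1 / z))) -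
         theta p (A / z) / z * (theta p (t1 * z) * (X z * Y z))))"
      unfolding 3 using z0 by (simp add: field_simps power2_eq_square eval_nat_numeral)
    finally have "s * (theta p (t1 * z) * theta p (t1 / z) * (X (t1 * d) * Y (t1 * c)) -
         theta p (A * z) * theta p (A / z) * (X t1 * Y t1)) =
       t1 * theta p (t1 * A) *
       (z ^ 3 * theta p (A * z) * (theta p (t1 / z) * (X (1 / z) * Y (1 / z))) -
         theta p (A / z) / z * (theta p (t1 * z) * (X z * Y z)))"
      using s0 th by (simp only: mult_cancel_left mult_eq_0_iff) simp
    then show ?thesis
      unfolding tX s_def X_def Y_def by (simp add: mult_ac)
  qed
qed

section \<open>Integrals over circles\<close>

lemma has_field_derivative_integral_param:
  fixes f f' :: "complex \<Rightarrow> real \<Rightarrow> complex"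
  assumes "open S" "c \<in> S"
    and der: "\<And>c x. c \<in> S \<Longrightarrow> x \<in> {a..b} \<Longrightarrow> ((\<lambda>c. f c x) has_field_derivative f' c x) (at c)"
    and int: "\<And>c. c \<in> S \<Longrightarrow> f c integrable_on {a..b}"
    and cont: "continuous_on (S \<times> {a..b}) (\<lambda>(c, x). f' c x)"
  shows "((\<lambda>c. integral {a..b} (f c)) has_field_derivative integral {a..b} (f' c)) (at c)"
proof -
  obtain e where e: "e > 0" "ball c e \<subseteq> S" using assms open_contains_ball by blast
  have "((\<lambda>c. integral (cbox a b) (f c)) has_field_derivative integral (cbox a b) (f' c)) (at c within ball c e)"
  proof (rule leibniz_rule_field_derivative)
    show "((\<lambda>c. f c x) has_field_derivative f' y x) (at y within ball c e)"
      if "y \<in> ball c e" "x \<in> cbox a b" for x y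
    proof -
      have "y \<in> S" "x \<in> {a..b}" using that e(2) by auto
      from der[OF this] show ?thesis by (rule has_field_derivative_at_within)
    qed
    show "continuous_on (ball c e \<times> cbox a b) (\<lambda>(x, t). f' x t)"
      using cont by (rule continuous_on_subset) (use e in auto)
  qed (use e int in auto)
  then show ?thesis using e(1) by (simp add: at_within_open[of c "ball c e"])
qed

lemma continuous_on_compose_circle:
  assumes "continuous_on S h" "\<And>x \<theta>. x \<in> S \<Longrightarrow> x * cis \<theta> \<in> S"
  shows "continuous_on (S \<times> T) (\<lambda>(c, \<theta>). h (c * cis \<theta>))"
    and "continuous_on (S \<times> T) (\<lambda>(c, \<theta>). h (c * cis (- \<theta>)))"
  unfolding case_prod_unfold using assms(2)
  by (auto intro!: continuous_on_compose2[OF assms(1)] continuous_intros)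

lemma continuous_on_circle:
  assumes "continuous_on S h" "\<And>x \<theta>. x \<in> S \<Longrightarrow> x * cis \<theta> \<in> S" "c \<in> S"
  shows "continuous_on T (\<lambda>\<theta>. h (c * cis \<theta>))" "continuous_on T (\<lambda>\<theta>. h (c * cis (- \<theta>)))"
  using assms(2,3) by (auto intro!: continuous_on_compose2[OF assms(1)] continuous_intros)

text \<open>The derivative of the mean in c is the mean of h'(c e^(\<i> \<theta>)) e^(\<i>
  \<theta>). For c \<noteq> 0 this integrand is, up to the factor 1 / (\<i> c), the
  \<theta>-derivative of a periodic function, so the derivative vanishes. The lemma plays the role
  of Cauchy's theorem: it compares the circles of radius 1 and 1 / |q|, and it gives the mean value
  property.\<close>

lemma circle_mean_eq:
  assumes h: "h holomorphic_on S" and S: "open S" "connected S"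
    and rot: "\<And>x \<theta>. x \<in> S \<Longrightarrow> x * cis \<theta> \<in> S"
    and c: "c \<in> S" "d \<in> S"
  shows "integral {0..2 * pi} (\<lambda>\<theta>. h (c * cis \<theta>)) = integral {0..2 * pi} (\<lambda>\<theta>. h (d * cis \<theta>))"
proof -
  have hc: "continuous_on S h" by (rule holomorphic_on_imp_continuous_on[OF h])
  have h': "continuous_on S (deriv h)"
    by (rule holomorphic_on_imp_continuous_on[OF holomorphic_deriv[OF h S(1)]])
  have der: "((\<lambda>x. integral {0..2 * pi} (\<lambda>\<theta>. h (x * cis \<theta>))) has_field_derivative 0) (at c)"
    if c: "c \<in> S" for c
  proof -
    have cont': "continuous_on {0..2 * pi} (\<lambda>\<theta>. deriv h (c * cis \<theta>) * cis \<theta>)"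
      by (intro continuous_intros continuous_on_circle[OF h' rot c])
    have "((\<lambda>x. integral {0..2 * pi} (\<lambda>\<theta>. h (x * cis \<theta>))) has_field_derivative
       integral {0..2 * pi} (\<lambda>\<theta>. deriv h (c * cis \<theta>) * cis \<theta>)) (at c)"
    proof (rule has_field_derivative_integral_param[OF S(1) c])
      show "((\<lambda>c. h (c * cis x)) has_field_derivative deriv h (c * cis x) * cis x) (at c)"
        if "c \<in> S" for c x
        using that rot h S by (intro DERIV_chain2[OF holomorphic_derivI[OF h S(1)]])
          (auto intro!: derivative_eq_intros)
      show "(\<lambda>\<theta>. h (c * cis \<theta>)) integrable_on {0..2 * pi}" if "c \<in> S" for c
        by (intro integrable_continuous_interval continuous_on_circle[OF hc rot that])
      show "continuous_on (S \<times> {0..2 * pi}) (\<lambda>(c, x). deriv h (c * cis x) * cis x)"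
        using continuous_on_compose_circle(1)[OF h' rot, of "{0..2 * pi}"] unfolding case_prod_unfold
        by (intro continuous_intros) auto
    qed
    moreover have "integral {0..2 * pi} (\<lambda>\<theta>. deriv h (c * cis \<theta>) * cis \<theta>) = 0"
    proof (cases "c = 0")
      \<comment> \<open>Occurs for domains containing the centre, such as the disc used for the
        Poisson kernel.\<close>
      case True
      have "((\<lambda>\<theta>. cis \<theta>) has_integral (cis (2 * pi) / \<i> - cis 0 / \<i>)) {0..2 * pi}"
      proof (rule fundamental_theorem_of_calculus)
        have "(cis has_vector_derivative \<i> * cis \<theta>) (at \<theta> within {0..2 * pi})" for \<theta>
          unfolding has_vector_derivative_def
          by (auto intro!: derivative_eq_intros has_derivative_cis simp: scaleR_conv_of_real)
        from has_vector_derivative_divide[OF this, of \<i>]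
        show "((\<lambda>\<theta>. cis \<theta> / \<i>) has_vector_derivative cis \<theta>) (at \<theta> within {0..2 * pi})" for \<theta>
          by simp
      qed simp
      then have "integral {0..2 * pi} cis = 0" by (simp add: integral_unique)
      then show ?thesis using True by simp
    next
      case False
      have "((\<lambda>\<theta>. deriv h (c * cis \<theta>) * (c * (\<i> * cis \<theta>))) has_integral
          (h (c * cis (2 * pi)) - h (c * cis 0))) {0..2 * pi}"
      proof (rule fundamental_theorem_of_calculus)
        fix \<theta> :: real
        have 1: "(h has_field_derivative deriv h (c * cis \<theta>)) (at (c * cis \<theta>))"
          using holomorphic_derivI[OF h S(1)] rot[OF c] by blast
        have 2: "((\<lambda>\<theta>. c * cis \<theta>) has_vector_derivative c * (\<i> * cis \<theta>)) (at \<theta> within {0..2 * pi})"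
          unfolding has_vector_derivative_def
          by (auto intro!: derivative_eq_intros has_derivative_cis simp: scaleR_conv_of_real)
        show "((\<lambda>\<theta>. h (c * cis \<theta>)) has_vector_derivative
            deriv h (c * cis \<theta>) * (c * (\<i> * cis \<theta>))) (at \<theta> within {0..2 * pi})"
          using field_vector_diff_chain_within[OF 2 has_field_derivative_at_within[OF 1]]
          unfolding o_def by (subst mult.commute)
      qed simp
      then have "((\<lambda>\<theta>. (c * \<i>) * (deriv h (c * cis \<theta>) * cis \<theta>)) has_integral 0) {0..2 * pi}"
        by (simp add: mult_ac cis_2pi[unfolded mult.commute[of 2 pi]])
      from integral_unique[OF this]
      have "c * \<i> * integral {0..2 * pi} (\<lambda>\<theta>. deriv h (c * cis \<theta>) * cis \<theta>) = 0"
        by (simp only: integral_mult_right)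
      then show ?thesis using False by simp
    qed
    ultimately show ?thesis by simp
  qed
  have "(\<lambda>x. integral {0..2 * pi} (\<lambda>\<theta>. h (x * cis \<theta>))) constant_on S"
    using S der by (intro has_field_derivative_0_imp_constant_on) auto
  then show ?thesis using c unfolding constant_on_def by auto
qed

text \<open>On the unit circle 1 / z is \<open>cis (- \<theta>)\<close>, so this is the form in
  which a single parameter enters the beta integral. Holomorphy follows by differentiation under the
  integral.\<close>

lemma holomorphic_integral_reflected:
  assumes \<Phi>: "\<Phi> holomorphic_on S" and S: "open S"
    and rot: "\<And>x \<theta>. x \<in> S \<Longrightarrow> x * cis \<theta> \<in> S" and k: "continuous_on {0..2 * pi} k"
  shows "(\<lambda>a. integral {0..2 * pi} (\<lambda>\<theta>. \<Phi> (a * cis \<theta>) * \<Phi> (a * cis (- \<theta>)) * k \<theta>)) holomorphic_on S"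
proof -
  have \<Phi>c: "continuous_on S \<Phi>" by (rule holomorphic_on_imp_continuous_on[OF \<Phi>])
  have \<Phi>': "continuous_on S (deriv \<Phi>)"
    by (rule holomorphic_on_imp_continuous_on[OF holomorphic_deriv[OF \<Phi> S]])
  note cc = continuous_on_compose_circle[OF \<Phi>c rot, of "{0..2 * pi}", unfolded case_prod_unfold]
    continuous_on_compose_circle[OF \<Phi>' rot, of "{0..2 * pi}", unfolded case_prod_unfold]
  have "((\<lambda>a. integral {0..2 * pi} (\<lambda>\<theta>. \<Phi> (a * cis \<theta>) * \<Phi> (a * cis (- \<theta>)) * k \<theta>))
     has_field_derivative integral {0..2 * pi} (\<lambda>\<theta>. (deriv \<Phi> (a * cis \<theta>) * cis \<theta> * \<Phi> (a * cis (- \<theta>)) +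
       deriv \<Phi> (a * cis (- \<theta>)) * cis (- \<theta>) * \<Phi> (a * cis \<theta>)) * k \<theta>)) (at a)" if a: "a \<in> S" for a
  proof (rule has_field_derivative_integral_param[OF S a])
    show "((\<lambda>c. \<Phi> (c * cis x) * \<Phi> (c * cis (- x)) * k x) has_field_derivative
        (deriv \<Phi> (c * cis x) * cis x * \<Phi> (c * cis (- x)) +
         deriv \<Phi> (c * cis (- x)) * cis (- x) * \<Phi> (c * cis x)) * k x) (at c)" if c: "c \<in> S" for c x
    proof -
      have "((\<lambda>c. \<Phi> (c * cis y)) has_field_derivative deriv \<Phi> (c * cis y) * cis y) (at c)" for y
        using c rot by (intro DERIV_chain2[OF holomorphic_derivI[OF \<Phi> S]])
          (auto intro!: derivative_eq_intros)
      then show ?thesis by (intro DERIV_cmult_right DERIV_mult)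
    qed
    show "(\<lambda>x. \<Phi> (c * cis x) * \<Phi> (c * cis (- x)) * k x) integrable_on {0..2 * pi}" if "c \<in> S" for c
      by (intro integrable_continuous_interval continuous_intros continuous_on_circle[OF \<Phi>c rot that] k)
    have k2: "continuous_on (S \<times> {0..2 * pi}) (\<lambda>x. k (snd x))"
      by (rule continuous_on_compose2[OF k]) (auto intro: continuous_intros)
    show "continuous_on (S \<times> {0..2 * pi}) (\<lambda>(c, x). (deriv \<Phi> (c * cis x) * cis x * \<Phi> (c * cis (- x)) +
         deriv \<Phi> (c * cis (- x)) * cis (- x) * \<Phi> (c * cis x)) * k x)"
      unfolding case_prod_unfold by (intro continuous_intros cc k2)
  qed
  then show ?thesis
    by (subst holomorphic_on_open[OF S]) blast
qed

section \<open>The elliptic beta integral\<close>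

text \<open>A locale, because the case q = 0 instantiates the whole theory at neighbouring values of
  q.\<close>

locale nomes =
  fixes q p :: complex
  assumes q: "norm q < 1" and p: "norm p < 1"
begin

abbreviation \<Gamma> :: "complex \<Rightarrow> complex" where "\<Gamma> \<equiv> ell_gamma q p"

lemmas \<Gamma>_eq = ell_gamma_eq[OF q p]

lemma norm_pq: "norm (p * q) < 1"
  using norm_mult_power_less_1[OF p q, of 1] by simp

text \<open>Numerator and denominator each release one p-product, and together these form theta. The
  bound |x| < 1 keeps \<open>qpoch p x\<close> nonzero, so that it can be divided out.\<close>

lemma \<Gamma>_shift:
  assumes "q \<noteq> 0" "x \<noteq> 0" "norm x < 1"
  shows "\<Gamma> (q * x) = theta p x * \<Gamma> x"
proof -
  have "\<Gamma> (q * x) = dpoch q p (p / x) / dpoch q p (q * x)"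
    using assms by (simp add: \<Gamma>_eq)
  also have "dpoch q p (p / x) = qpoch p (p / x) * dpoch q p (p * q / x)"
    using dpoch_rec_q[OF q p, of "p / x"] by (simp add: mult_ac)
  also have "dpoch q p (q * x) = dpoch q p x / qpoch p x"
    using dpoch_rec_q[OF q p, of x] qpoch_nonzero[OF p assms(3)] by simp
  finally show ?thesis by (simp add: \<Gamma>_eq theta_def)
qed

lemma norm_pq_divide: "norm (p * q) < norm x \<Longrightarrow> norm (p * q / x) < 1"
  by (auto simp: norm_divide divide_less_eq)

lemma \<Gamma>_nonzero:
  assumes "norm (p * q) < norm x" "norm x < 1"
  shows "\<Gamma> x \<noteq> 0"
  using dpoch_nonzero[OF q p assms(2)] dpoch_nonzero[OF q p norm_pq_divide[OF assms(1)]]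
  by (simp add: \<Gamma>_eq)

lemma holomorphic_\<Gamma>:
  assumes "g holomorphic_on S" "\<And>x. x \<in> S \<Longrightarrow> g x \<noteq> 0" "\<And>x. x \<in> S \<Longrightarrow> norm (g x) < 1"
  shows "(\<lambda>x. \<Gamma> (g x)) holomorphic_on S"
  unfolding \<Gamma>_eq using assms dpoch_nonzero[OF q p]
  by (intro holomorphic_intros q p) auto

text \<open>Zeros of \<Gamma> satisfy |x| \<le> |pq|, so the reciprocal has no poles outside that
  disc. At the poles of \<Gamma> the default value 0 of the reciprocal is the correct one.\<close>

lemma holomorphic_recip_\<Gamma>:
  assumes "g holomorphic_on S" "\<And>x. x \<in> S \<Longrightarrow> norm (p * q) < norm (g x)"
  shows "(\<lambda>x. 1 / \<Gamma> (g x)) holomorphic_on S"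
proof -
  have "g x \<noteq> 0" if "x \<in> S" for x using assms(2)[OF that] norm_ge_zero[of "p * q"] by auto
  then show ?thesis
    unfolding \<Gamma>_eq using assms dpoch_nonzero[OF q p norm_pq_divide]
    by (simp, intro holomorphic_intros q p) auto
qed

lemma continuous_on_\<Gamma>:
  assumes "continuous_on S g" "\<And>x. x \<in> S \<Longrightarrow> g x \<noteq> 0" "\<And>x. x \<in> S \<Longrightarrow> norm (g x) < 1"
  shows "continuous_on S (\<lambda>x. \<Gamma> (g x))"
proof -
  have "continuous_on {x. x \<noteq> 0 \<and> norm x < 1} \<Gamma>"
    by (intro holomorphic_on_imp_continuous_on holomorphic_\<Gamma>[of "\<lambda>x. x", simplified]) auto
  then show ?thesis
    by (rule continuous_on_compose2[OF _ assms(1)]) (use assms(2,3) in auto)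
qed

lemma continuous_on_recip_\<Gamma>:
  assumes "continuous_on S g" "\<And>x. x \<in> S \<Longrightarrow> norm (p * q) < norm (g x)"
  shows "continuous_on S (\<lambda>x. 1 / \<Gamma> (g x))"
proof -
  have "continuous_on {x. norm (p * q) < norm x} (\<lambda>x. 1 / \<Gamma> x)"
    by (intro holomorphic_on_imp_continuous_on holomorphic_recip_\<Gamma>) auto
  then show ?thesis
    by (rule continuous_on_compose2[OF _ assms(1)]) (use assms(2) in auto)
qed

definition gpm :: "complex \<Rightarrow> complex \<Rightarrow> complex" where
  "gpm a z = \<Gamma> (a * z) * \<Gamma> (a / z)"

text \<open>Everything beyond the first row and column of the two double products cancels. At z^2 =
  1 both sides are 0, the left one through division by zero.\<close>

lemma \<Gamma>_square_recip:
  assumes "norm z = 1"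
  shows "1 / gpm 1 (z\<^sup>2) = theta p (z\<^sup>2) * theta q (1 / z\<^sup>2)"
proof -
  define y where "y = z\<^sup>2"
  have y: "norm y = 1" "y \<noteq> 0" using assms by (auto simp: y_def norm_power)
  have n: "norm (p * q * y) < 1" "norm (p * q / y) < 1"
    using norm_pq y(1) by (simp_all add: norm_mult norm_divide)
  have 1: "dpoch q p y = qpoch p y * (qpoch q (q * y) * dpoch q p (p * q * y))"
    using dpoch_rec_q[OF q p, of y] dpoch_rec_p[OF q p, of "q * y"] by (simp add: mult_ac)
  have 2: "dpoch q p (1 / y) = qpoch q (1 / y) * (qpoch p (p / y) * dpoch q p (p * q / y))"
    using dpoch_rec_p[OF q p, of "1 / y"] dpoch_rec_q[OF q p, of "p / y"] by (simp add: mult_ac)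
  have "1 / gpm 1 y = dpoch q p y * dpoch q p (1 / y) / (dpoch q p (p * q / y) * dpoch q p (p * q * y))"
    by (simp add: gpm_def \<Gamma>_eq)
  also have "\<dots> = theta p y * theta q (1 / y)"
    unfolding 1 2 using dpoch_nonzero[OF q p n(1)] dpoch_nonzero[OF q p n(2)]
    by (simp add: theta_def)
  finally show ?thesis by (simp add: y_def)
qed

text \<open>The factor 1 / \<Gamma>(z^2, z^(-2)) of the integrand, written so that its continuity at
  z = 1 and z = -1 is evident.\<close>

definition wgt :: "complex \<Rightarrow> complex" where
  "wgt z = theta p (z\<^sup>2) * theta q (1 / z\<^sup>2)"

lemma continuous_on_wgt: "continuous_on (sphere 0 1) wgt"
  unfolding wgt_def by (intro holomorphic_on_imp_continuous_on holomorphic_intros p q) auto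

lemma continuous_on_gpm:
  "a \<noteq> 0 \<Longrightarrow> norm a < 1 \<Longrightarrow> continuous_on (sphere 0 1) (gpm a)"
  unfolding gpm_def
  by (intro continuous_intros continuous_on_\<Gamma>) (auto simp: norm_mult norm_divide)

lemma continuous_on_recip_gpm:
  assumes "norm (p * q) < norm a"
  shows "continuous_on (sphere 0 1) (\<lambda>z. 1 / gpm a z)"
proof -
  have "continuous_on (sphere 0 1) (\<lambda>z. (1 / \<Gamma> (a * z)) * (1 / \<Gamma> (a / z)))"
    using assms by (intro continuous_on_mult continuous_on_recip_\<Gamma> continuous_intros) (auto simp: norm_mult norm_divide)
  then show ?thesis by (simp add: gpm_def)
qed

text \<open>The integrand of the elliptic beta integral with respect to d\<theta>. The quotient in
  front collects all that depends on t1.\<close>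

definition beta_integrand :: "complex \<Rightarrow> complex \<Rightarrow> complex \<Rightarrow> complex \<Rightarrow> complex \<Rightarrow> complex \<Rightarrow> complex" where
  "beta_integrand t1 t2 t3 t4 t5 z =
     gpm t1 z / gpm (t1 * t2 * t3 * t4 * t5) z * (gpm t2 z * gpm t3 z * gpm t4 z * gpm t5 z * wgt z)"

definition beta_integral :: "complex \<Rightarrow> complex \<Rightarrow> complex \<Rightarrow> complex \<Rightarrow> complex \<Rightarrow> complex" where
  "beta_integral t1 t2 t3 t4 t5 = integral {0..2 * pi} (\<lambda>\<theta>. beta_integrand t1 t2 t3 t4 t5 (cis \<theta>))"

text \<open>With t6 = p q / (t1 t2 t3 t4 t5) and the reflection \<Gamma>(x) \<Gamma>(p q / x) = 1
  this is the product of \<Gamma>(ti tj) over all pairs from six parameters; the denominator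
  represents the pairs with t6.\<close>

definition beta_value :: "complex \<Rightarrow> complex \<Rightarrow> complex \<Rightarrow> complex \<Rightarrow> complex \<Rightarrow> complex" where
  "beta_value t1 t2 t3 t4 t5 =
     \<Gamma> (t1 * t2) * \<Gamma> (t1 * t3) * \<Gamma> (t1 * t4) * \<Gamma> (t1 * t5) *
     (\<Gamma> (t2 * t3) * \<Gamma> (t2 * t4) * \<Gamma> (t2 * t5) * \<Gamma> (t3 * t4) * \<Gamma> (t3 * t5) * \<Gamma> (t4 * t5)) /
     (\<Gamma> (t1 * t2 * t3 * t4) * \<Gamma> (t1 * t2 * t3 * t5) * \<Gamma> (t1 * t2 * t4 * t5) * \<Gamma> (t1 * t3 * t4 * t5) *
      \<Gamma> (t2 * t3 * t4 * t5))"

definition beta_ratio :: "complex \<Rightarrow> complex \<Rightarrow> complex \<Rightarrow> complex \<Rightarrow> complex \<Rightarrow> complex" where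
  "beta_ratio t1 t2 t3 t4 t5 = beta_integral t1 t2 t3 t4 t5 / beta_value t1 t2 t3 t4 t5"

text \<open>The last condition says that the eliminated sixth parameter p q / (t1 t2 t3 t4 t5) also
  lies in the open unit disc.\<close>

definition beta_dom :: "complex \<Rightarrow> complex \<Rightarrow> complex \<Rightarrow> complex \<Rightarrow> complex \<Rightarrow> bool" where
  "beta_dom t1 t2 t3 t4 t5 \<longleftrightarrow> norm t1 < 1 \<and> norm t2 < 1 \<and> norm t3 < 1 \<and> norm t4 < 1 \<and> norm t5 < 1 \<and>
     norm (p * q) < norm (t1 * t2 * t3 * t4 * t5)"

lemma beta_domD:
  assumes "beta_dom t1 t2 t3 t4 t5"
  shows "norm t1 < 1" "norm t2 < 1" "norm t3 < 1" "norm t4 < 1" "norm t5 < 1"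
    "norm (p * q) < norm (t1 * t2 * t3 * t4 * t5)"
    "t1 \<noteq> 0" "t2 \<noteq> 0" "t3 \<noteq> 0" "t4 \<noteq> 0" "t5 \<noteq> 0"
  using assms norm_ge_zero[of "p * q"] unfolding beta_dom_def by fastforce+

lemma continuous_on_beta_integrand:
  assumes "beta_dom t1 t2 t3 t4 t5"
  shows "continuous_on (sphere 0 1) (beta_integrand t1 t2 t3 t4 t5)"
proof -
  note t = beta_domD[OF assms]
  have "continuous_on (sphere 0 1) (\<lambda>z. gpm t1 z * (1 / gpm (t1 * t2 * t3 * t4 * t5) z) *
     (gpm t2 z * gpm t3 z * gpm t4 z * gpm t5 z * wgt z))"
    by (intro continuous_on_mult continuous_on_gpm continuous_on_recip_gpm continuous_on_wgt t)
  then show ?thesis by (simp add: beta_integrand_def)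
qed

lemma continuous_on_cis_compose:
  "continuous_on (sphere 0 1) f \<Longrightarrow> continuous_on T (\<lambda>\<theta>. f (cis \<theta>))"
  by (rule continuous_on_compose2) (auto intro!: continuous_intros)

text \<open>Adjacent transpositions generate all permutations, so any parameter can be moved to the
  first place, where shift invariance and holomorphy are proved.\<close>

lemma beta_ratio_swap:
  "beta_ratio t2 t1 t3 t4 t5 = beta_ratio t1 t2 t3 t4 t5"
  "beta_ratio t1 t3 t2 t4 t5 = beta_ratio t1 t2 t3 t4 t5"
  "beta_ratio t1 t2 t4 t3 t5 = beta_ratio t1 t2 t3 t4 t5"
  "beta_ratio t1 t2 t3 t5 t4 = beta_ratio t1 t2 t3 t4 t5"
  by (simp_all add: beta_ratio_def beta_integral_def beta_integrand_def beta_value_def mult_ac)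

lemma beta_dom_swap:
  "beta_dom t2 t1 t3 t4 t5 = beta_dom t1 t2 t3 t4 t5"
  "beta_dom t1 t3 t2 t4 t5 = beta_dom t1 t2 t3 t4 t5"
  "beta_dom t1 t2 t4 t3 t5 = beta_dom t1 t2 t3 t4 t5"
  "beta_dom t1 t2 t3 t5 t4 = beta_dom t1 t2 t3 t4 t5"
  by (auto simp: beta_dom_def mult_ac)

lemma norm_mult_less_1: "norm x < 1 \<Longrightarrow> norm y < 1 \<Longrightarrow> norm (x * y) < 1" for x y :: complex
  using mult_strict_mono[of "norm x" 1 "norm y" 1] by (simp add: norm_mult)

lemma norm_factor_bound:
  fixes A x y :: complex
  assumes "c < norm A" "A = y * x" "norm y < 1"
  shows "c < norm x"
  using assms by (simp add: norm_mult mult_left_le_one_le order_less_le_trans)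

text \<open>Every argument x is completed to the full product A by a product y of the other
  parameters, so |pq| < |A| \<le> |x| < 1, a region without zeros of \<Gamma>.\<close>

lemma beta_value_nonzero:
  assumes "beta_dom t1 t2 t3 t4 t5"
  shows "beta_value t1 t2 t3 t4 t5 \<noteq> 0"
proof -
  let ?A = "t1 * t2 * t3 * t4 * t5"
  have t: "norm t1 < 1" "norm t2 < 1" "norm t3 < 1" "norm t4 < 1" "norm t5 < 1"
    and A: "norm (p * q) < norm ?A" using assms by (auto simp: beta_dom_def)
  have *: "\<Gamma> x \<noteq> 0" if "?A = y * x" "norm y < 1" "norm x < 1" for x y
    using norm_factor_bound[OF A that(1,2)] that(3) by (rule \<Gamma>_nonzero)
  note n = norm_mult_less_1 t
  have "\<Gamma> (t1 * t2) \<noteq> 0" by (rule *[of "t3 * t4 * t5"]) (simp_all add: n)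
  moreover have "\<Gamma> (t1 * t3) \<noteq> 0" by (rule *[of "t2 * t4 * t5"]) (simp_all add: n)
  moreover have "\<Gamma> (t1 * t4) \<noteq> 0" by (rule *[of "t2 * t3 * t5"]) (simp_all add: n)
  moreover have "\<Gamma> (t1 * t5) \<noteq> 0" by (rule *[of "t2 * t3 * t4"]) (simp_all add: n)
  moreover have "\<Gamma> (t2 * t3) \<noteq> 0" by (rule *[of "t1 * t4 * t5"]) (simp_all add: n)
  moreover have "\<Gamma> (t2 * t4) \<noteq> 0" by (rule *[of "t1 * t3 * t5"]) (simp_all add: n)
  moreover have "\<Gamma> (t2 * t5) \<noteq> 0" by (rule *[of "t1 * t3 * t4"]) (simp_all add: n)
  moreover have "\<Gamma> (t3 * t4) \<noteq> 0" by (rule *[of "t1 * t2 * t5"]) (simp_all add: n)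
  moreover have "\<Gamma> (t3 * t5) \<noteq> 0" by (rule *[of "t1 * t2 * t4"]) (simp_all add: n)
  moreover have "\<Gamma> (t4 * t5) \<noteq> 0" by (rule *[of "t1 * t2 * t3"]) (simp_all add: n)
  moreover have "\<Gamma> (t1 * t2 * t3 * t4) \<noteq> 0" by (rule *[of t5]) (simp_all add: n)
  moreover have "\<Gamma> (t1 * t2 * t3 * t5) \<noteq> 0" by (rule *[of t4]) (simp_all add: n)
  moreover have "\<Gamma> (t1 * t2 * t4 * t5) \<noteq> 0" by (rule *[of t3]) (simp_all add: n)
  moreover have "\<Gamma> (t1 * t3 * t4 * t5) \<noteq> 0" by (rule *[of t2]) (simp_all add: n)
  moreover have "\<Gamma> (t2 * t3 * t4 * t5) \<noteq> 0" by (rule *[of t1]) (simp_all add: n)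
  ultimately show ?thesis by (simp add: beta_value_def)
qed

lemma beta_value_shift:
  assumes q0: "q \<noteq> 0" and dom: "beta_dom t1 t2 t3 t4 t5"
  defines "A \<equiv> t1 * t2 * t3 * t4 * t5"
  shows "beta_value (q * t1) t2 t3 t4 t5 = beta_value t1 t2 t3 t4 t5 *
     (theta p (t1 * t2) * theta p (t1 * t3) * theta p (t1 * t4) * theta p (t1 * t5)) /
     (theta p (A / t2) * theta p (A / t3) * theta p (A / t4) * theta p (A / t5))"
proof -
  note t = beta_domD[OF dom]
  have sh: "\<Gamma> (q * t1 * x) = theta p (t1 * x) * \<Gamma> (t1 * x)" if "x \<noteq> 0" "norm x < 1" for x
    using \<Gamma>_shift[OF q0, of "t1 * x"] that t(7) norm_mult_less_1[OF t(1) that(2)] by (simp add: mult.assoc)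
  note n = norm_mult_less_1 t
  have A: "A / t2 = t1 * (t3 * t4 * t5)" "A / t3 = t1 * (t2 * t4 * t5)" "A / t4 = t1 * (t2 * t3 * t5)"
    "A / t5 = t1 * (t2 * t3 * t4)"
    using t by (simp_all add: A_def field_simps)
  have e: "q * t1 * t2 * t3 * t4 = q * t1 * (t2 * t3 * t4)" "q * t1 * t2 * t3 * t5 = q * t1 * (t2 * t3 * t5)"
    "q * t1 * t2 * t4 * t5 = q * t1 * (t2 * t4 * t5)" "q * t1 * t3 * t4 * t5 = q * t1 * (t3 * t4 * t5)"
    "t1 * t2 * t3 * t4 = t1 * (t2 * t3 * t4)" "t1 * t2 * t3 * t5 = t1 * (t2 * t3 * t5)"
    "t1 * t2 * t4 * t5 = t1 * (t2 * t4 * t5)" "t1 * t3 * t4 * t5 = t1 * (t3 * t4 * t5)"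
    by (simp_all add: mult.assoc)
  have s: "\<Gamma> (q * t1 * t2) = theta p (t1 * t2) * \<Gamma> (t1 * t2)"
     "\<Gamma> (q * t1 * t3) = theta p (t1 * t3) * \<Gamma> (t1 * t3)"
     "\<Gamma> (q * t1 * t4) = theta p (t1 * t4) * \<Gamma> (t1 * t4)"
     "\<Gamma> (q * t1 * t5) = theta p (t1 * t5) * \<Gamma> (t1 * t5)"
     "\<Gamma> (q * t1 * (t2 * t3 * t4)) = theta p (t1 * (t2 * t3 * t4)) * \<Gamma> (t1 * (t2 * t3 * t4))"
     "\<Gamma> (q * t1 * (t2 * t3 * t5)) = theta p (t1 * (t2 * t3 * t5)) * \<Gamma> (t1 * (t2 * t3 * t5))"
     "\<Gamma> (q * t1 * (t2 * t4 * t5)) = theta p (t1 * (t2 * t4 * t5)) * \<Gamma> (t1 * (t2 * t4 * t5))"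
     "\<Gamma> (q * t1 * (t3 * t4 * t5)) = theta p (t1 * (t3 * t4 * t5)) * \<Gamma> (t1 * (t3 * t4 * t5))"
    by (rule sh; use t in \<open>simp add: n\<close>)+
  show ?thesis
    unfolding beta_value_def A e s by (simp add: mult_ac)
qed

lemma beta_ratio_shift:
  assumes q0: "q \<noteq> 0" and dom: "beta_dom t1 t2 t3 t4 t5"
    and Ap: "norm p < norm (t1 * t2 * t3 * t4 * t5)"
  shows "beta_ratio (q * t1) t2 t3 t4 t5 = beta_ratio t1 t2 t3 t4 t5"
proof -
  define A where "A = t1 * t2 * t3 * t4 * t5"
  note t = beta_domD[OF dom]
  note n = norm_mult_less_1 t
  have A1: "norm A < 1" unfolding A_def by (intro n)
  have A0: "A \<noteq> 0" using t by (simp add: A_def)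
  have Ap': "norm p < norm A" using Ap by (simp add: A_def)
  define PT where "PT = theta p (t1 * t2) * theta p (t1 * t3) * theta p (t1 * t4) * theta p (t1 * t5)"
  define PA where "PA = theta p (A / t2) * theta p (A / t3) * theta p (A / t4) * theta p (A / t5)"
  \<comment> \<open>Only the first factor is shifted. At z it gives
    \<open>theta p (a * z) * gpm a z\<close>, at z / q it gives
    \<open>theta p (a / z) * gpm a z\<close>; so H z and H (z / q) have the same \<Gamma> factors
    and differ only in theta factors and powers of z.\<close>
  define h where "h a x = \<Gamma> (q * a * x) * \<Gamma> (a / x)" for a x
  define H where "H x = h t1 x * h t2 x * h t3 x * h t4 x * h t5 x *
     (1 / \<Gamma> (q * A * x)) * (1 / \<Gamma> (A / x)) * (theta q (1 / x\<^sup>2) / x)" for x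
  have dom': "beta_dom (q * t1) t2 t3 t4 t5"
  proof -
    have "norm (p * q) < norm (q * t1 * t2 * t3 * t4 * t5)"
      using Ap q0 by (simp add: norm_mult mult_ac)
    then show ?thesis using t norm_mult_less_1[OF q t(1)] by (simp add: beta_dom_def)
  qed
  have sh: "\<Gamma> (q * a * z) = theta p (a * z) * \<Gamma> (a * z)" "\<Gamma> (q * a / z) = theta p (a / z) * \<Gamma> (a / z)"
    if "a \<noteq> 0" "norm a < 1" "norm z = 1" for a z
  proof -
    have "z \<noteq> 0" using that(3) by auto
    then show "\<Gamma> (q * a * z) = theta p (a * z) * \<Gamma> (a * z)" "\<Gamma> (q * a / z) = theta p (a / z) * \<Gamma> (a / z)"
      using \<Gamma>_shift[OF q0, of "a * z"] \<Gamma>_shift[OF q0, of "a / z"] that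
      by (simp_all add: norm_mult norm_divide mult.assoc)
  qed
  have key: "beta_integrand (q * t1) t2 t3 t4 t5 z * PA - beta_integrand t1 t2 t3 t4 t5 z * PT =
     t1 * theta p (t1 * A) * (H (z / q) - H z)" if z: "norm z = 1" for z
  proof -
    have z0: "z \<noteq> 0" using z by auto
    define G where "G = gpm t1 z * gpm t2 z * gpm t3 z * gpm t4 z * gpm t5 z / gpm A z * theta q (1 / z\<^sup>2)"
    define T where "T = theta p (t1 * z) * theta p (t2 * z) * theta p (t3 * z) * theta p (t4 * z) * theta p (t5 * z)"
    define T' where "T' = theta p (t1 / z) * theta p (t2 / z) * theta p (t3 / z) * theta p (t4 / z) * theta p (t5 / z)"
    define b where "b = theta p (A * z)"
    define b' where "b' = theta p (A / z)"
    have b: "b \<noteq> 0" "b' \<noteq> 0"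
      unfolding b_def b'_def
      by (rule theta_nonzero; use z Ap' A1 in \<open>simp add: norm_mult norm_divide\<close>)+
    \<comment> \<open>Two shifts of theta with base q lead from 1 / z^2 to (q / z)^2.\<close>
    have th: "theta q ((q / z)\<^sup>2) * (q / z) = z ^ 3 * theta q (1 / z\<^sup>2)"
    proof -
      have "theta q (q * (q * (1 / z\<^sup>2))) = theta q (1 / z\<^sup>2) * z ^ 4 / q"
        using q0 z0 theta_shift[OF q q0, of "q * (1 / z\<^sup>2)"] theta_shift[OF q q0, of "1 / z\<^sup>2"]
        by (simp add: divide_simps eval_nat_numeral)
      moreover have "q * (q * (1 / z\<^sup>2)) = (q / z)\<^sup>2" by (simp add: power2_eq_square)
      ultimately have "theta q ((q / z)\<^sup>2) = theta q (1 / z\<^sup>2) * z ^ 4 / q" by simp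
      then show ?thesis using q0 z0 by (simp add: field_simps eval_nat_numeral)
    qed
    have 1: "beta_integrand t1 t2 t3 t4 t5 z = G * theta p (z\<^sup>2)"
      by (simp add: beta_integrand_def G_def wgt_def A_def)
    have g: "gpm (q * a) z = theta p (a * z) * theta p (a / z) * gpm a z"
      if "a \<noteq> 0" "norm a < 1" for a
      using sh[OF that z] by (simp add: gpm_def mult_ac)
    have 2: "beta_integrand (q * t1) t2 t3 t4 t5 z =
       G * theta p (z\<^sup>2) * (theta p (t1 * z) * theta p (t1 / z)) / (b * b')"
      using g[of t1] g[of A] t A0 A1
      by (simp add: beta_integrand_def G_def wgt_def A_def b_def b'_def mult_ac)
    have h1: "h a z = theta p (a * z) * gpm a z" if "a \<noteq> 0" "norm a < 1" for a
      using sh[OF that z] by (simp add: h_def gpm_def)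
    have h2: "h a (z / q) = theta p (a / z) * gpm a z" if "a \<noteq> 0" "norm a < 1" for a
      using sh[OF that z] q0 by (simp add: h_def gpm_def mult_ac)
    have 3: "H z = G * T / (b * z)"
      using sh[OF A0 A1 z]
      by (simp add: H_def h1 t T_def G_def b_def gpm_def[of A] mult_ac)
    have "H (z / q) = (theta p (t1 / z) * gpm t1 z) * (theta p (t2 / z) * gpm t2 z) * (theta p (t3 / z) * gpm t3 z) *
       (theta p (t4 / z) * gpm t4 z) * (theta p (t5 / z) * gpm t5 z) *
       (1 / \<Gamma> (A * z)) * (1 / (b' * \<Gamma> (A / z))) * (theta q ((q / z)\<^sup>2) * (q / z))"
      using sh[OF A0 A1 z] q0
      by (simp add: H_def h2 t b'_def power_divide) (simp add: mult_ac)
    then have 4: "H (z / q) = G * T' * z ^ 3 / b'"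
      unfolding th by (simp add: T'_def G_def gpm_def[of A] mult_ac)
    have E: "theta p (z\<^sup>2) * (theta p (t1 * z) * theta p (t1 / z) * PA - b * b' * PT) =
       t1 * theta p (t1 * A) * (z ^ 3 * b * T' - b' / z * T)"
      using theta_beta_identity[OF t(1-5) Ap z]
      unfolding PA_def PT_def T_def T'_def b_def b'_def A_def .
    have "beta_integrand (q * t1) t2 t3 t4 t5 z * PA - beta_integrand t1 t2 t3 t4 t5 z * PT =
       G / (b * b') * (theta p (z\<^sup>2) * (theta p (t1 * z) * theta p (t1 / z) * PA - b * b' * PT))"
      unfolding 1 2 using b by (simp add: field_simps)
    also have "\<dots> = t1 * theta p (t1 * A) * (H (z / q) - H z)"
      unfolding E 3 4 using b z0 by (simp add: field_simps)
    finally show ?thesis .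
  qed
  \<comment> \<open>A modulus M strictly between these numbers and 1 leaves room on both sides of 1
    \<le> |x| \<le> 1 / |q|, so that both circles to be compared lie in the open annulus S.\<close>
  define m where "m = Max {norm t1, norm t2, norm t3, norm t4, norm t5, norm p / norm A}"
  have m1: "m < 1" using t Ap' A0 by (auto simp: m_def)
  then obtain M where M: "m < M" "M < 1" using dense by blast
  have Mt: "norm t1 < M" "norm t2 < M" "norm t3 < M" "norm t4 < M" "norm t5 < M" "norm p / norm A < M"
    using M(1) by (auto simp: m_def)
  have M0: "M > 0" using Mt(1) norm_ge_zero[of t1] by linarith
  have pM: "norm p < M * norm A" using Mt(6) A0 by (simp add: divide_less_eq)
  define S where "S = {x::complex. M < norm x \<and> norm x < 1 / (M * norm q)}"
  have nq: "norm q > 0" using q0 by simp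
  have Sx: "x \<noteq> 0" "M < norm x" "norm x * (M * norm q) < 1" if "x \<in> S" for x
    using that M0 nq by (auto simp: S_def field_simps)
  have "h a holomorphic_on S" if a: "a \<noteq> 0" "norm a < M" for a
  proof -
    have "norm (q * a * x) < 1" if x: "x \<in> S" for x
    proof -
      have "norm (q * a * x) = norm a * (norm x * norm q)" by (simp add: norm_mult mult_ac)
      also have "\<dots> \<le> M * (norm x * norm q)" using a(2) by (intro mult_right_mono) auto
      finally show ?thesis using Sx(3)[OF x] by (simp add: mult_ac)
    qed
    moreover have "norm (a / x) < 1" if x: "x \<in> S" for x
      using a(2) Sx[OF x] by (simp add: norm_divide divide_less_eq)
    ultimately show ?thesis
      unfolding h_def using a q0 Sx(1)
      by (intro holomorphic_on_mult holomorphic_\<Gamma> holomorphic_intros) auto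
  qed
  moreover have "norm (p * q) < norm (q * A * x)" if x: "x \<in> S" for x
  proof -
    have "norm p < norm A * norm x"
      using pM mult_right_mono[of M "norm x" "norm A"] Sx(2)[OF x] by (simp add: mult_ac)
    then show ?thesis using nq by (simp add: norm_mult mult_ac)
  qed
  moreover have "norm (p * q) < norm (A / x)" if x: "x \<in> S" for x
  proof -
    have "norm p * norm q * norm x \<le> norm A * (norm x * (M * norm q))"
      using mult_right_mono[OF less_imp_le[OF pM], of "norm q * norm x"] by (simp add: mult_ac)
    also have "\<dots> < norm A" using Sx(3)[OF x] A0 by simp
    finally show ?thesis using Sx(1)[OF x] by (simp add: norm_mult norm_divide field_simps)
  qed
  ultimately have Hhol: "H holomorphic_on S"
    unfolding H_def using t Mt Sx(1) q
    by (intro holomorphic_on_mult holomorphic_recip_\<Gamma> holomorphic_on_divide holomorphic_theta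
          holomorphic_intros) auto
  have rot: "x * cis \<theta> \<in> S" if "x \<in> S" for x \<theta> using that by (simp add: S_def norm_mult)
  have qS: "1 \<in> S" "1 / q \<in> S"
  proof -
    have "M * norm q < 1" "M < 1 / norm q"
      using M(2) M0 q nq mult_strict_mono[of M 1 "norm q" 1] by (simp_all add: field_simps)
    then show "1 \<in> S" "1 / q \<in> S"
      using M M0 nq by (simp_all add: S_def norm_divide field_simps)
  qed
  have "open S" "connected S" unfolding S_def by (rule open_annulus connected_annulus_0)+
  then have Hint: "integral {0..2 * pi} (\<lambda>\<theta>. H (1 / q * cis \<theta>)) = integral {0..2 * pi} (\<lambda>\<theta>. H (1 * cis \<theta>))"
    using qS rot by (intro circle_mean_eq[OF Hhol]) auto
  have Hc: "(\<lambda>\<theta>. H (c * cis \<theta>)) integrable_on {0..2 * pi}" if "c \<in> S" for c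
    using rot that
    by (intro integrable_continuous_interval continuous_on_circle(1)[OF holomorphic_on_imp_continuous_on[OF Hhol]])
  have "beta_integral (q * t1) t2 t3 t4 t5 * PA - beta_integral t1 t2 t3 t4 t5 * PT =
    integral {0..2 * pi} (\<lambda>\<theta>. beta_integrand (q * t1) t2 t3 t4 t5 (cis \<theta>) * PA -
      beta_integrand t1 t2 t3 t4 t5 (cis \<theta>) * PT)"
    unfolding beta_integral_def
    by (subst integral_diff)
       (auto intro!: integrable_continuous_interval continuous_intros
         continuous_on_cis_compose continuous_on_beta_integrand dom dom')
  also have "\<dots> = integral {0..2 * pi} (\<lambda>\<theta>. t1 * theta p (t1 * A) * (H (1 / q * cis \<theta>) - H (1 * cis \<theta>)))"
    by (simp add: key[OF norm_cis])
  also have "\<dots> = 0"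
    using Hint by (simp only: integral_mult_right integral_diff[OF Hc[OF qS(2)] Hc[OF qS(1)]]) simp
  finally have I: "beta_integral (q * t1) t2 t3 t4 t5 * PA = beta_integral t1 t2 t3 t4 t5 * PT" by simp
  have V: "beta_value (q * t1) t2 t3 t4 t5 = beta_value t1 t2 t3 t4 t5 * PT / PA"
    using beta_value_shift[OF q0 dom] by (simp add: PT_def PA_def A_def)
  \<comment> \<open>If \<open>PA\<close> or \<open>PT\<close> were 0, the right side of V would be
    0, for \<open>PA\<close> through division by zero.\<close>
  with beta_value_nonzero[OF dom'] have nz: "PA \<noteq> 0" "PT \<noteq> 0" by auto
  have "beta_integral (q * t1) t2 t3 t4 t5 = beta_integral t1 t2 t3 t4 t5 * PT / PA"
    using I nz by (simp add: field_simps)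
  then show ?thesis using nz by (simp add: beta_ratio_def V)
qed

end

section \<open>A Poisson kernel concentrating at two points\<close>

text \<open>The Poisson kernel of radius r^2 in the variable - z^2. It peaks at z = \<i> and z = -
  \<i> as r tends to 1.\<close>

definition poisson2 :: "real \<Rightarrow> complex \<Rightarrow> real" where
  "poisson2 r z = (1 - r ^ 4) / (norm (1 + r\<^sup>2 * z\<^sup>2))\<^sup>2"

text \<open>The two numbers 1 + z^2 and 1 + r^2 z^2 differ by 1 - r^2 in modulus, which is at most
  |1 + r^2 z^2|. Thus the denominator of the kernel controls the distance from its peaks uniformly
  in r.\<close>

lemma norm_one_plus_square_le:
  fixes z :: complex and r :: real
  assumes "norm z = 1" "0 \<le> r" "r \<le> 1"
  shows "norm (1 + z\<^sup>2) \<le> 2 * norm (1 + r\<^sup>2 * z\<^sup>2)"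
proof -
  have r2: "r\<^sup>2 \<le> 1" using assms(2,3) by (simp add: power_le_one)
  have "1 - r\<^sup>2 \<le> norm (1 + r\<^sup>2 * z\<^sup>2)"
    using norm_diff_ineq[of 1 "r\<^sup>2 * z\<^sup>2"] assms(1) by (simp add: norm_mult norm_power)
  moreover have "norm (1 + z\<^sup>2) \<le> norm (1 + r\<^sup>2 * z\<^sup>2) + norm ((1 - r\<^sup>2) * z\<^sup>2)"
    using norm_triangle_ineq[of "1 + r\<^sup>2 * z\<^sup>2" "(1 - r\<^sup>2) * z\<^sup>2"] by (simp add: algebra_simps)
  moreover have "norm ((1 - r\<^sup>2) * z\<^sup>2) = 1 - r\<^sup>2"
  proof -
    have "norm (1 - (complex_of_real r)\<^sup>2) = norm (complex_of_real (1 - r\<^sup>2))" by simp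
    also have "\<dots> = 1 - r\<^sup>2" using r2 by (simp only: norm_of_real abs_of_nonneg diff_ge_0_iff_ge)
    finally show ?thesis using assms(1) by (simp add: norm_mult norm_power)
  qed
  ultimately show ?thesis by linarith
qed

lemma poisson2_denom_nonzero:
  assumes "norm z = 1" "0 \<le> r" "r < 1"
  shows "1 + complex_of_real (r\<^sup>2) * z\<^sup>2 \<noteq> 0"
proof
  assume "1 + complex_of_real (r\<^sup>2) * z\<^sup>2 = 0"
  then have "norm (complex_of_real (r\<^sup>2) * z\<^sup>2) = 1" by (metis add_eq_0_iff norm_minus_cancel norm_one)
  then have "r\<^sup>2 = 1" using assms(1) by (simp add: norm_mult norm_power)
  then show False using assms(2,3) by (simp add: power2_eq_1_iff)
qed

lemma poisson2_nonneg: "0 \<le> r \<Longrightarrow> r \<le> 1 \<Longrightarrow> 0 \<le> poisson2 r z"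
  by (simp add: poisson2_def power_le_one)

lemma continuous_on_poisson2:
  assumes "0 \<le> r" "r < 1"
  shows "continuous_on {0..2 * pi} (\<lambda>\<theta>. poisson2 r (cis \<theta>))"
  unfolding poisson2_def using poisson2_denom_nonzero[OF norm_cis assms]
  by (intro continuous_intros) auto

text \<open>On the circle the conjugate of z is 1 / z, which turns the squared modulus into the two
  denominators produced by the singular \<Gamma> factors.\<close>

lemma poisson2_eq:
  assumes "norm z = 1"
  shows "complex_of_real (poisson2 r z) = (1 - r ^ 4) / ((1 + r\<^sup>2 * z\<^sup>2) * (1 + r\<^sup>2 / z\<^sup>2))"
proof -
  have "cnj z = 1 / z" using assms complex_div_cnj[of 1 z] by simp
  then have "cnj (1 + r\<^sup>2 * z\<^sup>2) = 1 + r\<^sup>2 / z\<^sup>2" by (simp add: power_divide)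
  then have "complex_of_real ((norm (1 + r\<^sup>2 * z\<^sup>2))\<^sup>2) = (1 + r\<^sup>2 * z\<^sup>2) * (1 + r\<^sup>2 / z\<^sup>2)"
    by (simp only: complex_norm_square)
  then show ?thesis
    unfolding poisson2_def of_real_divide by simp
qed

text \<open>The kernel is the real part of (1 - y^2) / (1 + y^2) at y = r z, whose mean over the
  circle is its value 1 at the centre.\<close>

lemma integral_poisson2:
  assumes "0 \<le> r" "r < 1"
  shows "integral {0..2 * pi} (\<lambda>\<theta>. poisson2 r (cis \<theta>)) = 2 * pi"
proof -
  define h where "h y = (1 - y\<^sup>2) / (1 + y\<^sup>2)" for y :: complex
  have nz: "1 + y\<^sup>2 \<noteq> 0" if "norm y < 1" for y :: complex
  proof
    assume "1 + y\<^sup>2 = 0"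
    then have "norm (y\<^sup>2) = 1" by (metis add_eq_0_iff norm_minus_cancel norm_one)
    then have "norm y = 1 \<or> norm y = - 1" by (simp only: norm_power power2_eq_1_iff)
    with that norm_ge_zero[of y] show False by linarith
  qed
  have hol: "h holomorphic_on ball 0 1"
    unfolding h_def using nz by (intro holomorphic_intros) auto
  have hr: "Re (h (complex_of_real r * cis \<theta>)) = poisson2 r (cis \<theta>)" for \<theta>
  proof -
    define v where "v = complex_of_real (r\<^sup>2) * (cis \<theta>)\<^sup>2"
    have "h (complex_of_real r * cis \<theta>) = (1 - v) / (1 + v)"
      by (simp add: h_def v_def power_mult_distrib)
    also have "\<dots> = (1 - v) * cnj (1 + v) / complex_of_real ((norm (1 + v))\<^sup>2)"
      by (rule complex_div_cnj)
    finally have "Re (h (complex_of_real r * cis \<theta>)) = Re ((1 - v) * cnj (1 + v)) / (norm (1 + v))\<^sup>2"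
      by (simp only: Re_divide_of_real)
    moreover have "Re ((1 - v) * cnj (1 + v)) = 1 - (norm v)\<^sup>2"
      unfolding cmod_power2 by (simp add: algebra_simps power2_eq_square)
    moreover have "(norm v)\<^sup>2 = r ^ 4"
      by (simp add: v_def norm_mult norm_power)
    ultimately show ?thesis
      by (simp add: poisson2_def v_def)
  qed
  have "integral {0..2 * pi} (\<lambda>\<theta>. h (complex_of_real r * cis \<theta>)) = integral {0..2 * pi} (\<lambda>\<theta>. h (0 * cis \<theta>))"
    using assms by (intro circle_mean_eq[OF hol]) (auto simp: norm_mult)
  also have "\<dots> = 2 * pi" by (simp add: h_def scaleR_conv_of_real)
  finally have I: "integral {0..2 * pi} (\<lambda>\<theta>. h (complex_of_real r * cis \<theta>)) = 2 * pi" .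
  have "(\<lambda>\<theta>. h (complex_of_real r * cis \<theta>)) integrable_on {0..2 * pi}"
    using assms
    by (intro integrable_continuous_interval
         continuous_on_circle[OF holomorphic_on_imp_continuous_on[OF hol]]) (auto simp: norm_mult)
  from integral_linear[OF this bounded_linear_Re]
  show ?thesis unfolding I o_def hr by simp
qed

text \<open>Instead of splitting the circle near the peaks, one estimate |K - c| \<le> \<epsilon>' +
  C g is used on the whole compact set, with g vanishing on it only at (1, \<i>) and (1, - \<i>). It
  covers the dependence of K on r too. The integral of the kernel times g tends to 0, since the
  kernel's denominator absorbs |1 + z^2|^2.\<close>

lemma poisson2_limit:
  fixes K :: "real \<times> complex \<Rightarrow> complex" and c :: complex
  assumes r0: "0 \<le> r0" "r0 < 1"
    and K: "continuous_on ({r0..1} \<times> sphere 0 1) K"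
    and c: "K (1, \<i>) = c" "K (1, - \<i>) = c"
  shows "((\<lambda>r. integral {0..2 * pi} (\<lambda>\<theta>. complex_of_real (poisson2 r (cis \<theta>)) * K (r, cis \<theta>)))
           \<longlongrightarrow> 2 * pi * c) (at_left 1)"
proof (rule tendstoI)
  fix \<epsilon> :: real assume "\<epsilon> > 0"
  \<comment> \<open>The kernel has total mass 2 pi, so this part contributes \<epsilon> / 2.\<close>
  define \<epsilon>' where "\<epsilon>' = \<epsilon> / (4 * pi)"
  have \<epsilon>': "\<epsilon>' > 0" using \<open>\<epsilon> > 0\<close> by (simp add: \<epsilon>'_def)
  define D where "D = {r0..1} \<times> sphere (0::complex) 1"
  have D: "compact D" unfolding D_def by (intro compact_Times) auto
  define g where "g v = (norm (1 + (snd v)\<^sup>2))\<^sup>2 + (1 - fst v)" for v :: "real \<times> complex"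
  have cK: "continuous_on D (\<lambda>v. norm (K v - c))"
    using K unfolding D_def by (intro continuous_intros)
  have "\<exists>C\<ge>0. \<forall>v\<in>D. norm (K v - c) \<le> \<epsilon>' + C * g v"
  proof -
    define E where "E = D \<inter> (\<lambda>v. norm (K v - c)) -` {\<epsilon>'..}"
    have "closed E"
      unfolding E_def using cK D by (intro continuous_closed_preimage) (auto intro: compact_imp_closed)
    then have "compact (D \<inter> E)" using D by (rule compact_Int_closed[rotated])
    then have E: "compact E" by (simp add: E_def)
    have g0: "g v \<ge> 0" if "v \<in> D" for v using that by (auto simp: g_def D_def)
    have gpos: "g v > 0" if v: "v \<in> E" for v
    proof (rule ccontr)
      assume "\<not> g v > 0"
      moreover have "fst v \<le> 1" using v by (auto simp: E_def D_def)
      ultimately have "(norm (1 + (snd v)\<^sup>2))\<^sup>2 = 0" "fst v = 1"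
        using zero_le_power2[of "norm (1 + (snd v)\<^sup>2)"] unfolding g_def by linarith+
      then have "(snd v)\<^sup>2 = \<i>\<^sup>2" and "fst v = 1" by (auto simp: add_eq_0_iff)
      then have "v = (1, \<i>) \<or> v = (1, - \<i>)" unfolding power2_eq_iff by (auto simp: prod_eq_iff)
      then have "norm (K v - c) = 0" using c by auto
      then show False using v \<epsilon>' by (auto simp: E_def)
    qed
    have cont_quot: "continuous_on E (\<lambda>v. norm (K v - c) / g v)"
    proof (rule continuous_on_divide)
      show "continuous_on E (\<lambda>v. norm (K v - c))" using cK by (rule continuous_on_subset) (auto simp: E_def)
      show "continuous_on E g" unfolding g_def by (intro continuous_intros)
    qed (use gpos in fastforce)
    have "bounded ((\<lambda>v. norm (K v - c) / g v) ` E)"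
      by (intro compact_imp_bounded compact_continuous_image cont_quot E)
    then obtain C where C: "\<And>v. v \<in> E \<Longrightarrow> norm (norm (K v - c) / g v) \<le> C"
      by (auto simp: bounded_iff)
    have "norm (K v - c) \<le> \<epsilon>' + max C 0 * g v" if v: "v \<in> D" for v
    proof (cases "v \<in> E")
      case True
      then have "norm (K v - c) \<le> C * g v"
        using C[OF True] gpos[OF True] by (simp add: pos_divide_le_eq)
      also have "\<dots> \<le> max C 0 * g v" using g0[OF v] by (intro mult_right_mono) auto
      finally show ?thesis using \<epsilon>' by linarith
    next
      case False
      then have "norm (K v - c) \<le> \<epsilon>'" using v by (auto simp: E_def)
      moreover have "0 \<le> max C 0 * g v" using g0[OF v] by simp
      ultimately show ?thesis by linarith
    qed
    then show ?thesis by (intro exI[of _ "max C 0"]) auto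
  qed
  then obtain C where C: "C \<ge> 0" "\<And>v. v \<in> D \<Longrightarrow> norm (K v - c) \<le> \<epsilon>' + C * g v" by blast
  \<comment> \<open>8 pi is the length 2 pi times 4, the square of the constant in
    \<open>norm_one_plus_square_le\<close>.\<close>
  define err where "err r = 2 * pi * \<epsilon>' + C * (8 * pi * (1 - r ^ 4) + 2 * pi * (1 - r))" for r :: real
  have bound: "norm (integral {0..2 * pi} (\<lambda>\<theta>. complex_of_real (poisson2 r (cis \<theta>)) * K (r, cis \<theta>)) - 2 * pi * c) \<le> err r"
    if r: "r0 < r" "r < 1" for r
  proof -
    have rr: "0 \<le> r" using r r0 by simp
    note cp = continuous_on_poisson2[OF rr r(2)]
    have cK': "continuous_on {0..2 * pi} (\<lambda>\<theta>. K (r, cis \<theta>))"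
      by (rule continuous_on_compose2[OF K]) (use r in \<open>auto intro!: continuous_intros\<close>)
    have "integral {0..2 * pi} (\<lambda>\<theta>. complex_of_real (poisson2 r (cis \<theta>)) * K (r, cis \<theta>)) - 2 * pi * c =
       integral {0..2 * pi} (\<lambda>\<theta>. complex_of_real (poisson2 r (cis \<theta>)) * (K (r, cis \<theta>) - c))"
    proof -
      have "integral {0..2 * pi} (\<lambda>\<theta>. complex_of_real (poisson2 r (cis \<theta>)) * c) =
          complex_of_real (integral {0..2 * pi} (\<lambda>\<theta>. poisson2 r (cis \<theta>))) * c"
        using integral_linear[OF integrable_continuous_interval[OF cp] bounded_linear_of_real[where 'a = complex]]
        by (simp add: o_def)
      then show ?thesis
        unfolding integral_poisson2[OF rr r(2)] right_diff_distrib
        by (subst integral_diff) (auto intro!: integrable_continuous_interval continuous_intros cp cK')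
    qed
    also have "norm \<dots> \<le> integral {0..2 * pi} (\<lambda>\<theta>. \<epsilon>' * poisson2 r (cis \<theta>) + C * (4 * (1 - r ^ 4) + (1 - r) * poisson2 r (cis \<theta>)))"
    proof (rule integral_norm_bound_integral)
      fix \<theta> :: real
      let ?P = "poisson2 r (cis \<theta>)"
      have P0: "0 \<le> ?P" using rr r by (simp add: poisson2_nonneg)
      have "norm (K (r, cis \<theta>) - c) \<le> \<epsilon>' + C * g (r, cis \<theta>)"
        using r by (intro C(2)) (auto simp: D_def)
      then have "norm (complex_of_real ?P * (K (r, cis \<theta>) - c)) \<le> ?P * (\<epsilon>' + C * g (r, cis \<theta>))"
        using P0 by (simp add: norm_mult mult_left_mono)
      also have "\<dots> = \<epsilon>' * ?P + C * (?P * (norm (1 + (cis \<theta>)\<^sup>2))\<^sup>2 + (1 - r) * ?P)"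
        by (simp add: g_def algebra_simps)
      also have "\<dots> \<le> \<epsilon>' * ?P + C * (4 * (1 - r ^ 4) + (1 - r) * ?P)"
      proof -
        have nz: "norm (1 + complex_of_real (r\<^sup>2) * (cis \<theta>)\<^sup>2) > 0"
          using poisson2_denom_nonzero[OF norm_cis rr r(2), of \<theta>] by simp
        have "(norm (1 + (cis \<theta>)\<^sup>2))\<^sup>2 \<le> (2 * norm (1 + complex_of_real (r\<^sup>2) * (cis \<theta>)\<^sup>2))\<^sup>2"
          using norm_one_plus_square_le[OF norm_cis rr, of \<theta>] r by (intro power_mono) auto
        then have "(norm (1 + (cis \<theta>)\<^sup>2))\<^sup>2 \<le> 4 * (norm (1 + complex_of_real (r\<^sup>2) * (cis \<theta>)\<^sup>2))\<^sup>2"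
          by (simp add: power_mult_distrib)
        then have "?P * (norm (1 + (cis \<theta>)\<^sup>2))\<^sup>2 \<le> ?P * (4 * (norm (1 + complex_of_real (r\<^sup>2) * (cis \<theta>)\<^sup>2))\<^sup>2)"
          using P0 by (rule mult_left_mono)
        also have "\<dots> = 4 * (1 - r ^ 4)" using nz by (simp add: poisson2_def)
        finally show ?thesis using C(1) by (intro add_left_mono mult_left_mono) auto
      qed
      finally show "norm (complex_of_real ?P * (K (r, cis \<theta>) - c)) \<le> \<epsilon>' * ?P + C * (4 * (1 - r ^ 4) + (1 - r) * ?P)" .
    qed (auto intro!: integrable_continuous_interval continuous_intros cp cK')
    also have "\<dots> = err r"
    proof -
      have i: "(\<lambda>\<theta>. poisson2 r (cis \<theta>)) integrable_on {0..2 * pi}"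
        by (intro integrable_continuous_interval cp)
      have k: "((\<lambda>\<theta>. 4 * (1 - r ^ 4)) has_integral ((2 * pi) *\<^sub>R (4 * (1 - r ^ 4)))) {0..2 * pi}"
        using has_integral_const_real[of "4 * (1 - r ^ 4)" 0 "2 * pi"] by simp
      have "((\<lambda>\<theta>. \<epsilon>' * poisson2 r (cis \<theta>) + C * (4 * (1 - r ^ 4) + (1 - r) * poisson2 r (cis \<theta>))) has_integral
         (\<epsilon>' * (2 * pi) + C * ((2 * pi) *\<^sub>R (4 * (1 - r ^ 4)) + (1 - r) * (2 * pi)))) {0..2 * pi}"
        using integrable_integral[OF i, unfolded integral_poisson2[OF rr r(2)]]
        by (intro has_integral_add has_integral_mult_right k)
      then show ?thesis by (simp add: integral_unique err_def algebra_simps)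
    qed
    finally show ?thesis .
  qed
  have "(err \<longlongrightarrow> 2 * pi * \<epsilon>' + C * (8 * pi * (1 - 1 ^ 4) + 2 * pi * (1 - 1))) (at_left 1)"
    unfolding err_def by (intro tendsto_intros)
  moreover have "2 * pi * \<epsilon>' < \<epsilon>" using \<open>\<epsilon> > 0\<close> by (simp add: \<epsilon>'_def)
  ultimately have "\<forall>\<^sub>F r in at_left 1. err r < \<epsilon>"
    by (intro order_tendstoD) auto
  moreover have "\<forall>\<^sub>F r in at_left 1. r0 < r \<and> r < 1"
    using eventually_at_left_real[OF r0(2)] by eventually_elim auto
  ultimately show "\<forall>\<^sub>F r in at_left 1. dist (integral {0..2 * pi}
      (\<lambda>\<theta>. complex_of_real (poisson2 r (cis \<theta>)) * K (r, cis \<theta>))) (2 * pi * c) < \<epsilon>"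
    by eventually_elim (use bound in \<open>auto simp: dist_norm intro: order_le_less_trans\<close>)
qed

section \<open>Holomorphy and constancy in one parameter, and the limit at the pinched
  contour\<close>

context nomes
begin

lemma holomorphic_beta_ratio:
  assumes t: "norm t2 < 1" "norm t3 < 1" "norm t4 < 1" "norm t5 < 1"
  shows "(\<lambda>a. beta_ratio a t2 t3 t4 t5) holomorphic_on {a. beta_dom a t2 t3 t4 t5}"
proof -
  let ?S = "{a. beta_dom a t2 t3 t4 t5}"
  define B where "B = t2 * t3 * t4 * t5"
  have S_eq: "?S = {a. norm (p * q) < norm (a * B) \<and> norm a < 1}"
    using t by (auto simp: beta_dom_def B_def mult_ac)
  have S: "open ?S"
    unfolding S_eq by (intro open_Collect_conj open_Collect_less continuous_intros)
  \<comment> \<open>The full product is a B, so a enters the integrand exactly as \<Phi>(a z)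
    \<Phi>(a / z).\<close>
  define \<Phi> where "\<Phi> x = \<Gamma> x * (1 / \<Gamma> (x * B))" for x
  define k where "k z = gpm t2 z * gpm t3 z * gpm t4 z * gpm t5 z * wgt z" for z
  have a0: "a \<noteq> 0" if "a \<in> ?S" for a using that beta_domD(7) by auto
  have \<Phi>: "\<Phi> holomorphic_on ?S"
    unfolding \<Phi>_def
  proof (intro holomorphic_on_mult holomorphic_\<Gamma> holomorphic_recip_\<Gamma> holomorphic_intros)
  qed (use a0 in \<open>auto simp: S_eq\<close>)
  have int: "(\<lambda>a. beta_integral a t2 t3 t4 t5) holomorphic_on ?S"
  proof (cases "?S = {}")
    case True
    then show ?thesis unfolding True by (simp add: holomorphic_on_def)
  next
    case False
    then obtain a where "beta_dom a t2 t3 t4 t5" by blast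
    note nz = beta_domD(8-11)[OF this]
    have "continuous_on (sphere 0 1) k"
      unfolding k_def by (intro continuous_on_mult continuous_on_gpm continuous_on_wgt nz t)
    then have "(\<lambda>a. integral {0..2 * pi} (\<lambda>\<theta>. \<Phi> (a * cis \<theta>) * \<Phi> (a * cis (- \<theta>)) * k (cis \<theta>))) holomorphic_on ?S"
      by (intro holomorphic_integral_reflected[OF \<Phi> S] continuous_on_cis_compose)
         (auto simp: S_eq norm_mult mult_ac)
    moreover have "beta_integrand a t2 t3 t4 t5 (cis \<theta>) = \<Phi> (a * cis \<theta>) * \<Phi> (a * cis (- \<theta>)) * k (cis \<theta>)" for a \<theta>
    proof -
      have "x / cis \<theta> = x * cis (- \<theta>)" for x by (simp add: divide_inverse)
      then show ?thesis
        by (simp add: beta_integrand_def gpm_def \<Phi>_def k_def B_def mult_ac)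
    qed
    ultimately show ?thesis by (simp add: beta_integral_def)
  qed
  have val: "(\<lambda>a. beta_value a t2 t3 t4 t5) holomorphic_on ?S"
  proof -
    have n: "norm (a * x) < 1" if "a \<in> ?S" "norm x < 1" for a x
      using that by (intro norm_mult_less_1) (auto simp: beta_dom_def)
    have lin: "(\<lambda>a. \<Gamma> (a * x)) holomorphic_on ?S" if "x \<noteq> 0 \<or> ?S = {}" "norm x < 1" for x
      using that a0 n by (intro holomorphic_\<Gamma> holomorphic_intros) auto
    have rlin: "(\<lambda>a. 1 / \<Gamma> (a * x)) holomorphic_on ?S" if "B = y * x" "norm y < 1" for x y
      using that norm_factor_bound[of "norm (p * q)" _ y]
      by (intro holomorphic_recip_\<Gamma> holomorphic_intros) (auto simp: S_eq mult_ac)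
    \<comment> \<open>A vanishing factor of B would make the domain empty, and holomorphy on the
      empty set is trivial.\<close>
    have nz: "x \<noteq> 0 \<or> ?S = {}" if "B = y * x" for x y
      using that norm_ge_zero[of "p * q"] by (auto simp: S_eq)
    have "(\<lambda>a. \<Gamma> (a * t2) * \<Gamma> (a * t3) * \<Gamma> (a * t4) * \<Gamma> (a * t5) *
     (\<Gamma> (t2 * t3) * \<Gamma> (t2 * t4) * \<Gamma> (t2 * t5) * \<Gamma> (t3 * t4) * \<Gamma> (t3 * t5) * \<Gamma> (t4 * t5)) *
     ((1 / \<Gamma> (a * (t2 * t3 * t4))) * (1 / \<Gamma> (a * (t2 * t3 * t5))) * (1 / \<Gamma> (a * (t2 * t4 * t5))) *
      (1 / \<Gamma> (a * (t3 * t4 * t5))) * (1 / \<Gamma> (t2 * t3 * t4 * t5)))) holomorphic_on ?S"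
    proof (intro holomorphic_on_mult lin rlin holomorphic_on_const nz t)
      show "B = (t3 * t4 * t5) * t2" "B = (t2 * t4 * t5) * t3" "B = (t2 * t3 * t5) * t4" "B = (t2 * t3 * t4) * t5"
        "B = t5 * (t2 * t3 * t4)" "B = t4 * (t2 * t3 * t5)" "B = t3 * (t2 * t4 * t5)" "B = t2 * (t3 * t4 * t5)"
        by (simp_all add: B_def mult_ac)
    qed (use t in auto)
    then show ?thesis by (simp add: beta_value_def mult.assoc)
  qed
  show ?thesis
    unfolding beta_ratio_def using beta_value_nonzero by (intro holomorphic_on_divide int val) auto
qed

lemma beta_dom_annulus:
  assumes "norm t2 < 1" "norm t3 < 1" "norm t4 < 1" "norm t5 < 1" "t2 * t3 * t4 * t5 \<noteq> 0"
  shows "{a. beta_dom a t2 t3 t4 t5} = {a. norm (p * q) / norm (t2 * t3 * t4 * t5) < norm a \<and> norm a < 1}"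
  using assms by (auto simp: beta_dom_def norm_mult field_simps)

text \<open>The shift needs |p| < |A|, but this is automatic once both x and q x are admissible:
  |pq| < |q x B| gives |p| < |x B|.\<close>

lemma beta_ratio_const:
  assumes q0: "q \<noteq> 0" and dom: "beta_dom a t2 t3 t4 t5" "beta_dom b t2 t3 t4 t5"
    and B: "norm p < norm (t2 * t3 * t4 * t5)"
  shows "beta_ratio a t2 t3 t4 t5 = beta_ratio b t2 t3 t4 t5"
proof -
  note t = beta_domD[OF dom(1)]
  have B0: "t2 * t3 * t4 * t5 \<noteq> 0" using t by simp
  have "(\<lambda>a. beta_ratio a t2 t3 t4 t5) constant_on
      {a. norm (p * q) / norm (t2 * t3 * t4 * t5) < norm a \<and> norm a < 1}"
  proof (rule dilation_invariant_imp_constant[OF _ q0 q])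
    show "(\<lambda>a. beta_ratio a t2 t3 t4 t5) holomorphic_on
       {a. norm (p * q) / norm (t2 * t3 * t4 * t5) < norm a \<and> norm a < 1}"
      using holomorphic_beta_ratio[OF t(2-5)] unfolding beta_dom_annulus[OF t(2-5) B0] .
    show "norm (p * q) / norm (t2 * t3 * t4 * t5) < norm q * 1"
      using B q0 t by (simp add: norm_mult field_simps)
    fix x
    assume "x \<in> {a. norm (p * q) / norm (t2 * t3 * t4 * t5) < norm a \<and> norm a < 1}"
      and "q * x \<in> {a. norm (p * q) / norm (t2 * t3 * t4 * t5) < norm a \<and> norm a < 1}"
    then have x: "beta_dom x t2 t3 t4 t5" and qx: "beta_dom (q * x) t2 t3 t4 t5"
      unfolding beta_dom_annulus[OF t(2-5) B0, symmetric] by auto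
    have "norm p < norm (x * t2 * t3 * t4 * t5)"
      using beta_domD(6)[OF qx] q0 by (simp add: norm_mult mult_ac)
    then show "beta_ratio (q * x) t2 t3 t4 t5 = beta_ratio x t2 t3 t4 t5"
      by (rule beta_ratio_shift[OF q0 x])
  qed simp
  then show ?thesis
    using dom unfolding beta_dom_annulus[OF t(2-5) B0, symmetric] constant_on_def by auto
qed

text \<open>The function (1 - x) \<Gamma>(x) with the pole at x = 1 cancelled, so that it is usable
  on the closed unit disc without 0. Its value at 1 is the source of (p; p)_infinity (q; q)_infinity
  in the evaluation.\<close>

definition \<Gamma>_reg :: "complex \<Rightarrow> complex" where
  "\<Gamma>_reg x = dpoch q p (p * q / x) / (qpoch p (p * x) * dpoch q p (q * x))"

lemma \<Gamma>_eq_reg: "\<Gamma> x = \<Gamma>_reg x / (1 - x)"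
  unfolding \<Gamma>_eq \<Gamma>_reg_def using dpoch_rec_q[OF q p, of x] qpoch_rec[OF p, of x] by (simp add: mult_ac)

lemma \<Gamma>_reg_1: "\<Gamma>_reg 1 = 1 / (qpoch p p * qpoch q q)"
proof -
  have "dpoch q p q = qpoch q q * dpoch q p (p * q)" by (rule dpoch_rec_p[OF q p])
  then show ?thesis
    using dpoch_nonzero[OF q p norm_pq] by (simp add: \<Gamma>_reg_def)
qed

lemma \<Gamma>_reg_denom_nonzero:
  assumes "norm x \<le> 1"
  shows "qpoch p (p * x) \<noteq> 0" "dpoch q p (q * x) \<noteq> 0"
proof -
  have "norm (p * x) < 1" "norm (q * x) < 1"
    using assms p q mult_left_mono[OF assms, of "norm p"] mult_left_mono[OF assms, of "norm q"]
    by (simp_all add: norm_mult)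
  then show "qpoch p (p * x) \<noteq> 0" "dpoch q p (q * x) \<noteq> 0"
    using qpoch_nonzero[OF p] dpoch_nonzero[OF q p] by blast+
qed

lemma continuous_on_\<Gamma>_reg:
  assumes "continuous_on S g" "\<And>x. x \<in> S \<Longrightarrow> g x \<noteq> 0" "\<And>x. x \<in> S \<Longrightarrow> norm (g x) \<le> 1"
  shows "continuous_on S (\<lambda>x. \<Gamma>_reg (g x))"
proof -
  have "continuous_on {x. x \<noteq> 0 \<and> norm x \<le> 1} \<Gamma>_reg"
    unfolding \<Gamma>_reg_def
    by (intro holomorphic_on_imp_continuous_on holomorphic_intros p q) (auto simp: \<Gamma>_reg_denom_nonzero)
  then show ?thesis
    by (rule continuous_on_compose2[OF _ assms(1)]) (use assms(2,3) in auto)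
qed

lemma \<Gamma>_reg_nonzero:
  assumes "norm (p * q) < norm x" "norm x \<le> 1"
  shows "\<Gamma>_reg x \<noteq> 0"
  using \<Gamma>_reg_denom_nonzero[OF assms(2)] dpoch_nonzero[OF q p norm_pq_divide[OF assms(1)]]
  by (simp add: \<Gamma>_reg_def)

text \<open>
  The quotient of integrand and value at \<open>t1 = \<i> r\<close>, \<open>t2 = - \<i> r\<close>, with the factors that become
  singular as \<open>r \<rightarrow> 1\<close> split off as \<open>poisson2\<close>.
\<close>
definition special_kernel :: "complex \<Rightarrow> complex \<Rightarrow> complex \<Rightarrow> real \<times> complex \<Rightarrow> complex" where
  "special_kernel t3 t4 t5 = (\<lambda>(r, z). (let w = \<i> * complex_of_real r; r2 = (complex_of_real r)\<^sup>2 in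
     \<Gamma>_reg (w * z) * \<Gamma>_reg (w / z) * \<Gamma>_reg (- w * z) * \<Gamma>_reg (- w / z) / (\<Gamma>_reg r2 * (1 + r2)) *
     (gpm t3 z * gpm t4 z * gpm t5 z * wgt z) *
     ((1 / \<Gamma> (r2 * (t3 * t4 * t5) * z)) * (1 / \<Gamma> (r2 * (t3 * t4 * t5) / z))) *
     ((1 / \<Gamma> (w * t3)) * (1 / \<Gamma> (w * t4)) * (1 / \<Gamma> (w * t5)) *
      (1 / \<Gamma> (- w * t3)) * (1 / \<Gamma> (- w * t4)) * (1 / \<Gamma> (- w * t5)) *
      (1 / (\<Gamma> (t3 * t4) * \<Gamma> (t3 * t5) * \<Gamma> (t4 * t5)))) *
     (\<Gamma> (r2 * (t3 * t4)) * \<Gamma> (r2 * (t3 * t5)) * \<Gamma> (r2 * (t4 * t5)) *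
      \<Gamma> (w * (t3 * t4 * t5)) * \<Gamma> (- w * (t3 * t4 * t5)))))"

lemma beta_ratio_special:
  assumes r: "0 < r" "r < 1"
  shows "beta_ratio (\<i> * r) (- \<i> * r) t3 t4 t5 =
    integral {0..2 * pi} (\<lambda>\<theta>. complex_of_real (poisson2 r (cis \<theta>)) * special_kernel t3 t4 t5 (r, cis \<theta>))"
proof -
  have r2: "(complex_of_real r)\<^sup>2 \<noteq> 1" "1 + (complex_of_real r)\<^sup>2 \<noteq> 0"
  proof -
    have "norm ((complex_of_real r)\<^sup>2) < 1" using r by (simp add: norm_power power_less_one_iff)
    then show "(complex_of_real r)\<^sup>2 \<noteq> 1" "1 + (complex_of_real r)\<^sup>2 \<noteq> 0"
      by (auto simp: add_eq_0_iff)
  qed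
  have "beta_integrand (\<i> * r) (- \<i> * r) t3 t4 t5 z / beta_value (\<i> * r) (- \<i> * r) t3 t4 t5 =
     complex_of_real (poisson2 r z) * special_kernel t3 t4 t5 (r, z)" if z: "norm z = 1" for z
  proof -
    define w where "w = \<i> * complex_of_real r"
    define R where "R = (complex_of_real r)\<^sup>2"
    have z0: "z \<noteq> 0" using z by auto
    have "w\<^sup>2 = - R" by (simp add: w_def R_def power_mult_distrib)
    then have R: "w * - w = R" "- w * w = R" by (simp_all add: power2_eq_square)
    have R1: "R \<noteq> 1" "1 + R \<noteq> 0" using r2 by (simp_all add: R_def)
    have P: "complex_of_real (poisson2 r z) = (1 - R\<^sup>2) / ((1 + R * z\<^sup>2) * (1 + R / z\<^sup>2))"
      unfolding poisson2_eq[OF z] by (simp add: R_def)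
    have f: "(1 - w * z) * (1 - - w * z) = 1 + R * z\<^sup>2" "(1 - w / z) * (1 - - w / z) = 1 + R / z\<^sup>2"
      using z0 by (simp_all add: R(1)[symmetric] algebra_simps power2_eq_square)
    have g: "gpm w z * gpm (- w) z = \<Gamma>_reg (w * z) * \<Gamma>_reg (w / z) * \<Gamma>_reg (- w * z) * \<Gamma>_reg (- w / z) /
        ((1 + R * z\<^sup>2) * (1 + R / z\<^sup>2))"
      unfolding gpm_def f[symmetric] by (simp add: \<Gamma>_eq_reg mult_ac)
    have A: "w * - w * t3 * t4 * t5 = R * (t3 * t4 * t5)" unfolding R(1) by (simp only: mult.assoc)
    have V: "beta_value w (- w) t3 t4 t5 = \<Gamma>_reg R / (1 - R) *
       (\<Gamma> (w * t3) * \<Gamma> (w * t4) * \<Gamma> (w * t5) * \<Gamma> (- w * t3) * \<Gamma> (- w * t4) * \<Gamma> (- w * t5) *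
        (\<Gamma> (t3 * t4) * \<Gamma> (t3 * t5) * \<Gamma> (t4 * t5))) /
       (\<Gamma> (R * (t3 * t4)) * \<Gamma> (R * (t3 * t5)) * \<Gamma> (R * (t4 * t5)) *
      \<Gamma> (w * (t3 * t4 * t5)) * \<Gamma> (- w * (t3 * t4 * t5)))"
      unfolding beta_value_def R(1) \<Gamma>_eq_reg[of R] by (simp add: mult_ac)
    have "beta_integrand w (- w) t3 t4 t5 z =
       gpm w z * gpm (- w) z * (gpm t3 z * gpm t4 z * gpm t5 z * wgt z) / gpm (R * (t3 * t4 * t5)) z"
      unfolding beta_integrand_def A by (simp add: mult_ac)
    \<comment> \<open>The value contributes 1 / (1 - R) through \<Gamma>(t1 t2), while the Poisson
      kernel has the numerator 1 - R^2; this explains the factor 1 / (1 + r^2) in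
      \<open>special_kernel\<close>.\<close>
    moreover have "1 - R\<^sup>2 = (1 - R) * (1 + R)" by (simp add: algebra_simps power2_eq_square)
    ultimately have "beta_integrand w (- w) t3 t4 t5 z / beta_value w (- w) t3 t4 t5 =
     complex_of_real (poisson2 r z) * special_kernel t3 t4 t5 (r, z)"
      using R1
      unfolding V P g special_kernel_def Let_def prod.case w_def[symmetric] R_def[symmetric] gpm_def[of "R * _"]
      by (simp add: mult_ac)
    then show ?thesis by (simp add: w_def)
  qed
  then show ?thesis
    unfolding beta_ratio_def beta_integral_def
    by (simp add: integral_divide[symmetric])
qed

text \<open>The endpoint r = 1, where \<Gamma> itself has poles, is covered by
  \<open>\<Gamma>_reg\<close>. The lower bound on r0 keeps every reciprocal away from the zeros of
  \<Gamma> for all r from r0 on.\<close>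

lemma continuous_on_special_kernel:
  assumes t: "norm t3 < 1" "norm t4 < 1" "norm t5 < 1"
    and r0: "0 < r0" "r0 < 1" "norm (p * q) < r0\<^sup>2 * norm (t3 * t4 * t5)"
  shows "continuous_on ({r0..1} \<times> sphere 0 1) (special_kernel t3 t4 t5)"
proof -
  let ?D = "{r0..1} \<times> sphere (0::complex) 1"
  define W where "W v = \<i> * complex_of_real (fst v)" for v :: "real \<times> complex"
  define R where "R v = (complex_of_real (fst v))\<^sup>2" for v :: "real \<times> complex"
  note n = norm_mult_less_1 t
  have t0: "t3 \<noteq> 0" "t4 \<noteq> 0" "t5 \<noteq> 0" using r0 norm_ge_zero[of "p * q"] by auto
  have WR: "norm (W v) \<le> 1" "norm (- W v) \<le> 1" "norm (R v) \<le> 1" "W v \<noteq> 0" "- W v \<noteq> 0" "R v \<noteq> 0"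
     "norm (snd v) = 1" "snd v \<noteq> 0" "1 + R v \<noteq> 0"
    "r0\<^sup>2 \<le> norm (R v)" "r0\<^sup>2 \<le> norm (W v)" "r0\<^sup>2 \<le> norm (- W v)"
    if v: "v \<in> ?D" for v
  proof -
    have r: "r0 \<le> fst v" "fst v \<le> 1" "0 < fst v" and z: "norm (snd v) = 1" using v r0 by auto
    have "complex_of_real (1 + (fst v)\<^sup>2) \<noteq> 0"
      unfolding of_real_eq_0_iff using zero_le_power2[of "fst v"] by linarith
    then show "1 + R v \<noteq> 0" by (simp add: R_def)
    have "r0\<^sup>2 \<le> (fst v)\<^sup>2" using r r0 by (intro power_mono) auto
    \<comment> \<open>From r^2 \<le> r the single number r0^2 bounds |W| as well as |R| from
      below.\<close>
    moreover have "(fst v)\<^sup>2 \<le> fst v" using r by (simp add: power2_eq_square mult_left_le)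
    ultimately show "norm (W v) \<le> 1" "norm (- W v) \<le> 1" "norm (R v) \<le> 1" "W v \<noteq> 0" "- W v \<noteq> 0" "R v \<noteq> 0"
     "norm (snd v) = 1" "snd v \<noteq> 0"
     "r0\<^sup>2 \<le> norm (R v)" "r0\<^sup>2 \<le> norm (W v)" "r0\<^sup>2 \<le> norm (- W v)"
      using r z by (auto simp: W_def R_def norm_mult norm_power power_le_one)
  qed
  have cW: "continuous_on ?D W" "continuous_on ?D (\<lambda>v. - W v)" "continuous_on ?D R"
    unfolding W_def R_def by (intro continuous_intros)+
  have cz: "continuous_on ?D snd" by (intro continuous_intros)
  have cz': "continuous_on ?D (\<lambda>v. f (snd v))" if "continuous_on (sphere 0 1) f" for f :: "complex \<Rightarrow> complex"
    by (rule continuous_on_compose2[OF that cz]) auto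
  have less1: "norm (x * y) < 1" if "norm x \<le> 1" "norm y < 1" for x y :: complex
    using that mult_right_mono[of "norm x" 1 "norm y"] by (simp add: norm_mult)
  have low: "norm (p * q) < norm (x * y)" if "r0\<^sup>2 \<le> norm x" "t3 * t4 * t5 = c * y" "norm c \<le> 1" for x y c
  proof -
    have "norm (t3 * t4 * t5) \<le> norm y" unfolding that(2) norm_mult using that(3) by (simp add: mult_left_le_one_le)
    then have "r0\<^sup>2 * norm (t3 * t4 * t5) \<le> norm x * norm y"
      using that(1) by (intro mult_mono) auto
    with r0(3) show ?thesis by (simp add: norm_mult)
  qed
  have i1: "continuous_on ?D (\<lambda>v. \<Gamma>_reg (W v * snd v) * \<Gamma>_reg (W v / snd v) * \<Gamma>_reg (- W v * snd v) *
      \<Gamma>_reg (- W v / snd v) / (\<Gamma>_reg (R v) * (1 + R v)))"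
  proof (intro continuous_on_mult continuous_on_divide continuous_on_\<Gamma>_reg continuous_on_add continuous_on_const cW cz ballI)
    fix v assume v: "v \<in> ?D"
    have "norm (p * q) < norm (R v * 1)"
      using t by (intro low[OF WR(10)[OF v], of "t3 * t4 * t5"] less_imp_le[OF n(1)] n) auto
    then show "\<Gamma>_reg (R v) * (1 + R v) \<noteq> 0"
      using \<Gamma>_reg_nonzero[of "R v"] WR[OF v] by simp
  qed (use WR in \<open>auto simp: norm_mult norm_divide\<close>)
  have i2: "continuous_on ?D (\<lambda>v. gpm t3 (snd v) * gpm t4 (snd v) * gpm t5 (snd v) * wgt (snd v))"
    by (intro continuous_on_mult cz' continuous_on_gpm continuous_on_wgt t t0)
  have i3: "continuous_on ?D (\<lambda>v. (1 / \<Gamma> (R v * (t3 * t4 * t5) * snd v)) * (1 / \<Gamma> (R v * (t3 * t4 * t5) / snd v)))"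
  proof -
    have *: "norm (p * q) < norm (R v * (t3 * t4 * t5) * snd v)" "norm (p * q) < norm (R v * (t3 * t4 * t5) / snd v)"
      if v: "v \<in> ?D" for v
    proof -
      have "norm (p * q) < norm (R v * (t3 * t4 * t5))" by (rule low[OF WR(10)[OF v], of 1]) auto
      then show "norm (p * q) < norm (R v * (t3 * t4 * t5) * snd v)" "norm (p * q) < norm (R v * (t3 * t4 * t5) / snd v)"
        using WR(7)[OF v] by (simp_all add: norm_mult norm_divide)
    qed
    have "continuous_on ?D (\<lambda>v. R v * (t3 * t4 * t5) * snd v)" "continuous_on ?D (\<lambda>v. R v * (t3 * t4 * t5) / snd v)"
      using WR(8) by (intro continuous_on_mult continuous_on_divide continuous_on_const cW cz ballI; blast)+
    then show ?thesis
      by (intro continuous_on_mult[OF continuous_on_recip_\<Gamma> continuous_on_recip_\<Gamma>] *)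
  qed
  have rec: "continuous_on ?D (\<lambda>v. 1 / \<Gamma> (V v * x))"
    if "continuous_on ?D V" "\<And>v. v \<in> ?D \<Longrightarrow> r0\<^sup>2 \<le> norm (V v)" "t3 * t4 * t5 = c * x" "norm c \<le> 1" for V x c
    using that low by (intro continuous_on_recip_\<Gamma> continuous_on_mult continuous_on_const) blast+
  have i4: "continuous_on ?D (\<lambda>v. (1 / \<Gamma> (W v * t3)) * (1 / \<Gamma> (W v * t4)) * (1 / \<Gamma> (W v * t5)) *
      (1 / \<Gamma> (- W v * t3)) * (1 / \<Gamma> (- W v * t4)) * (1 / \<Gamma> (- W v * t5)) *
      (1 / (\<Gamma> (t3 * t4) * \<Gamma> (t3 * t5) * \<Gamma> (t4 * t5))))"
  proof (intro continuous_on_mult rec cW continuous_on_const WR(11,12))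
    show "t3 * t4 * t5 = (t4 * t5) * t3" "t3 * t4 * t5 = (t3 * t5) * t4" "t3 * t4 * t5 = (t3 * t4) * t5"
       "t3 * t4 * t5 = (t4 * t5) * t3" "t3 * t4 * t5 = (t3 * t5) * t4" "t3 * t4 * t5 = (t3 * t4) * t5"
      by (simp_all add: mult_ac)
  qed (auto intro: less_imp_le n)
  have \<Gamma>c: "continuous_on ?D (\<lambda>v. \<Gamma> (V v * x))"
    if "continuous_on ?D V" "\<And>v. v \<in> ?D \<Longrightarrow> norm (V v) \<le> 1" "\<And>v. v \<in> ?D \<Longrightarrow> V v \<noteq> 0" "x \<noteq> 0" "norm x < 1" for V x
    using that less1 by (intro continuous_on_\<Gamma> continuous_on_mult continuous_on_const) auto
  have i5: "continuous_on ?D (\<lambda>v. \<Gamma> (R v * (t3 * t4)) * \<Gamma> (R v * (t3 * t5)) * \<Gamma> (R v * (t4 * t5)) *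
      \<Gamma> (W v * (t3 * t4 * t5)) * \<Gamma> (- W v * (t3 * t4 * t5)))"
    by (intro continuous_on_mult \<Gamma>c cW WR(1-6) n) (simp_all add: t0)
  show ?thesis
    unfolding special_kernel_def case_prod_unfold Let_def W_def[symmetric] R_def[symmetric]
    by (rule continuous_on_mult[OF continuous_on_mult[OF continuous_on_mult[OF continuous_on_mult[OF i1 i2] i3] i4] i5])
qed

text \<open>All factors containing t3, t4, t5 cancel. What remains is (\<Gamma>_reg(1)
  \<Gamma>_reg(-1))^2 / (2 \<Gamma>_reg(1)) times the weight 1 / \<Gamma>(-1)^2, and
  \<Gamma>_reg(-1) = 2 \<Gamma>(-1), which leaves 2 \<Gamma>_reg(1).\<close>

lemma special_kernel_at_i:
  assumes t: "norm t3 < 1" "norm t4 < 1" "norm t5 < 1" "norm (p * q) < norm (t3 * t4 * t5)"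
    and z: "z = \<i> \<or> z = - \<i>"
  shows "special_kernel t3 t4 t5 (1, z) = 2 / (qpoch p p * qpoch q q)"
proof -
  note n = norm_mult_less_1 t
  have g: "gpm a z = \<Gamma> (\<i> * a) * \<Gamma> (- \<i> * a)" for a
    using z by (auto simp: gpm_def mult_ac)
  have nz: "\<Gamma> x \<noteq> 0" if "norm (t3 * t4 * t5) = norm y * norm x" "norm y \<le> 1" "norm x < 1" for x y
  proof (rule \<Gamma>_nonzero[OF _ that(3)])
    have "norm y * norm x \<le> norm x" using that(2) by (simp add: mult_left_le_one_le)
    then show "norm (p * q) < norm x" using t(4) that(1) by linarith
  qed
  have nzi: "\<Gamma> (\<i> * a) \<noteq> 0" "\<Gamma> (- (\<i> * a)) \<noteq> 0"
    if "t3 * t4 * t5 = y * a" "norm y \<le> 1" "norm a < 1" for a y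
  proof -
    have "norm (t3 * t4 * t5) = norm y * norm (\<i> * a)" "norm (t3 * t4 * t5) = norm y * norm (- (\<i> * a))"
      using that(1) by (simp_all add: norm_mult)
    then show "\<Gamma> (\<i> * a) \<noteq> 0" "\<Gamma> (- (\<i> * a)) \<noteq> 0"
      using that(2,3) nz[of y "\<i> * a"] nz[of y "- (\<i> * a)"] by (simp_all add: norm_mult)
  qed
  have a: "\<Gamma> (\<i> * t3) \<noteq> 0" "\<Gamma> (- (\<i> * t3)) \<noteq> 0" "\<Gamma> (\<i> * t4) \<noteq> 0" "\<Gamma> (- (\<i> * t4)) \<noteq> 0"
    "\<Gamma> (\<i> * t5) \<noteq> 0" "\<Gamma> (- (\<i> * t5)) \<noteq> 0"
    using nzi[of "t4 * t5" t3] nzi[of "t3 * t5" t4] nzi[of "t3 * t4" t5] less_imp_le[OF n(1)] t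
    by (auto simp: mult_ac)
  have b: "\<Gamma> (\<i> * (t3 * t4 * t5)) \<noteq> 0" "\<Gamma> (- (\<i> * (t3 * t4 * t5))) \<noteq> 0"
    using nzi[of 1 "t3 * t4 * t5"] n(1)[OF n(1)[OF t(1,2)] t(3)] by auto
  have c: "\<Gamma> (t3 * t4) \<noteq> 0" "\<Gamma> (t3 * t5) \<noteq> 0" "\<Gamma> (t4 * t5) \<noteq> 0"
    using nz[of t5 "t3 * t4"] nz[of t4 "t3 * t5"] nz[of t3 "t4 * t5"] n(1) t
    by (auto simp: norm_mult mult_ac)
  have m1: "\<Gamma>_reg (- 1) = 2 * \<Gamma> (- 1)" by (simp add: \<Gamma>_eq_reg)
  have m1': "\<Gamma> (- 1) \<noteq> 0"
    using \<Gamma>_reg_nonzero[of "- 1"] norm_pq by (auto simp: m1)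
  have z2: "z\<^sup>2 = - 1" and z1: "norm z = 1" using z by auto
  have w: "wgt z = 1 / (\<Gamma> (- 1) * \<Gamma> (- 1))"
    using \<Gamma>_square_recip[OF z1] unfolding z2 wgt_def gpm_def by simp
  have "\<Gamma>_reg (\<i> * z) * \<Gamma>_reg (\<i> / z) * \<Gamma>_reg (- \<i> * z) * \<Gamma>_reg (- \<i> / z) = (\<Gamma>_reg 1 * \<Gamma>_reg (- 1))\<^sup>2"
    using z by (auto simp: power2_eq_square)
  moreover have r1: "\<Gamma>_reg 1 \<noteq> 0" using \<Gamma>_reg_nonzero[of 1] norm_pq by simp
  ultimately have "special_kernel t3 t4 t5 (1, z) = 2 * \<Gamma>_reg 1"
    using a b c m1'
    by (simp add: special_kernel_def Let_def w m1 gpm_def[symmetric] g[unfolded gpm_def] g) (simp add: field_simps power2_eq_square)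
  then show ?thesis by (simp add: \<Gamma>_reg_1)
qed

lemma beta_ratio_special_limit:
  assumes t: "norm t3 < 1" "norm t4 < 1" "norm t5 < 1" "norm (p * q) < norm (t3 * t4 * t5)"
  shows "((\<lambda>r. beta_ratio (\<i> * complex_of_real r) (- \<i> * complex_of_real r) t3 t4 t5) \<longlongrightarrow>
     4 * pi / (qpoch p p * qpoch q q)) (at_left 1)"
proof -
  have "((\<lambda>r. r\<^sup>2 * norm (t3 * t4 * t5)) \<longlongrightarrow> 1\<^sup>2 * norm (t3 * t4 * t5)) (at_left 1)"
    by (intro tendsto_intros)
  then have "\<forall>\<^sub>F r in at_left 1. norm (p * q) < r\<^sup>2 * norm (t3 * t4 * t5)"
    using t(4) by (intro order_tendstoD(1)) auto
  moreover have "\<forall>\<^sub>F r in at_left 1. 0 < r \<and> r < (1::real)"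
    using eventually_at_left_real[of 0 1] by (auto elim: eventually_mono)
  ultimately have "\<forall>\<^sub>F r in at_left 1. norm (p * q) < r\<^sup>2 * norm (t3 * t4 * t5) \<and> 0 < r \<and> r < 1"
    by eventually_elim auto
  then obtain r0 where r0: "0 < r0" "r0 < 1" "norm (p * q) < r0\<^sup>2 * norm (t3 * t4 * t5)"
    using eventually_happens'[OF trivial_limit_at_left_real] by blast
  have "((\<lambda>r. integral {0..2 * pi} (\<lambda>\<theta>. complex_of_real (poisson2 r (cis \<theta>)) * special_kernel t3 t4 t5 (r, cis \<theta>)))
    \<longlongrightarrow> 2 * pi * (2 / (qpoch p p * qpoch q q))) (at_left 1)"
    using r0 by (intro poisson2_limit[of r0] continuous_on_special_kernel special_kernel_at_i t) auto
  moreover have "\<forall>\<^sub>F r in at_left 1. integral {0..2 * pi} (\<lambda>\<theta>. complex_of_real (poisson2 r (cis \<theta>)) * special_kernel t3 t4 t5 (r, cis \<theta>))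
      = beta_ratio (\<i> * complex_of_real r) (- \<i> * complex_of_real r) t3 t4 t5"
    using eventually_at_left_real[OF zero_less_one]
    by eventually_elim (rule beta_ratio_special[symmetric]; simp)
  ultimately show ?thesis
    by (rule Lim_transform_eventually[THEN tendsto_eq_rhs]) simp
qed

end

section \<open>Evaluation of the ratio for nonzero q\<close>

context nomes
begin

text \<open>Moving t1 to \<i> r uses |p| < |t2 t3 t4 t5|. Moving t2 to - \<i> r then uses |p| < r
  |t3 t4 t5|, which holds for r near 1 because |t2| < 1. The ratio thus equals its special values
  for all r close to 1, hence their limit.\<close>

lemma beta_ratio_eq_special_limit:
  assumes q0: "q \<noteq> 0" and dom: "beta_dom t1 t2 t3 t4 t5" and B: "norm p < norm (t2 * t3 * t4 * t5)"
  shows "beta_ratio t1 t2 t3 t4 t5 = 4 * pi / (qpoch p p * qpoch q q)"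
proof -
  note t = beta_domD[OF dom]
  define b where "b = norm (t3 * t4 * t5)"
  have Bb: "norm (t2 * t3 * t4 * t5) \<le> b"
    using t(2) by (simp add: b_def norm_mult mult.assoc mult_left_le_one_le)
  then have pb: "norm p < b" using B by linarith
  have pq_p: "norm (p * q) \<le> norm p" using q by (simp add: norm_mult mult_left_le)
  have "\<forall>\<^sub>F r in at_left 1. norm p < r * norm (t2 * t3 * t4 * t5)"
  proof (rule order_tendstoD(1))
    show "((\<lambda>r. r * norm (t2 * t3 * t4 * t5)) \<longlongrightarrow> 1 * norm (t2 * t3 * t4 * t5)) (at_left 1)"
      by (intro tendsto_intros)
  qed (use B in simp)
  moreover have "\<forall>\<^sub>F r in at_left 1. norm p < r\<^sup>2 * b"
  proof (rule order_tendstoD(1))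
    show "((\<lambda>r. r\<^sup>2 * b) \<longlongrightarrow> 1\<^sup>2 * b) (at_left 1)" by (intro tendsto_intros)
  qed (use pb in simp)
  moreover have "\<forall>\<^sub>F r in at_left 1. 0 < r \<and> r < (1::real)"
    using eventually_at_left_real[OF zero_less_one] by eventually_elim simp
  ultimately have "\<forall>\<^sub>F r in at_left 1.
     beta_ratio (\<i> * complex_of_real r) (- \<i> * complex_of_real r) t3 t4 t5 = beta_ratio t1 t2 t3 t4 t5"
  proof eventually_elim
    fix r :: real
    assume 1: "norm p < r * norm (t2 * t3 * t4 * t5)" and 2: "norm p < r\<^sup>2 * b" and r: "0 < r \<and> r < 1"
    define w where "w = \<i> * complex_of_real r"
    have w: "norm w = r" "norm w < 1" using r by (simp_all add: w_def norm_mult)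
    have d1: "beta_dom w t2 t3 t4 t5"
      using 1 pq_p t w by (simp add: beta_dom_def norm_mult mult_ac)
    have d2: "beta_dom (- w) w t3 t4 t5"
      using 2 pq_p t w by (simp add: beta_dom_def norm_mult b_def power2_eq_square mult_ac)
    have "r\<^sup>2 * b \<le> r * b" using r by (intro mult_right_mono) (simp_all add: b_def power2_eq_square mult_left_le)
    then have pw: "norm p < norm (w * t3 * t4 * t5)"
      using 2 w by (simp add: norm_mult b_def mult_ac)
    have "beta_ratio t1 t2 t3 t4 t5 = beta_ratio w t2 t3 t4 t5"
      by (rule beta_ratio_const[OF q0 dom d1 B])
    also have "\<dots> = beta_ratio t2 w t3 t4 t5" by (rule beta_ratio_swap)
    also have "\<dots> = beta_ratio (- w) w t3 t4 t5"
      using d1 d2 pw by (intro beta_ratio_const[OF q0]) (simp_all add: beta_dom_swap)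
    also have "\<dots> = beta_ratio w (- w) t3 t4 t5" by (rule beta_ratio_swap)
    finally show "beta_ratio (\<i> * complex_of_real r) (- \<i> * complex_of_real r) t3 t4 t5 = beta_ratio t1 t2 t3 t4 t5"
      by (simp add: w_def)
  qed
  then have "((\<lambda>r. beta_ratio (\<i> * complex_of_real r) (- \<i> * complex_of_real r) t3 t4 t5) \<longlongrightarrow>
     beta_ratio t1 t2 t3 t4 t5) (at_left 1)"
    by (rule tendsto_eventually)
  moreover have "norm (p * q) < norm (t3 * t4 * t5)" using pb pq_p by (simp add: b_def)
  note beta_ratio_special_limit[OF t(3-5) this]
  ultimately show ?thesis
    by (intro tendsto_unique[OF trivial_limit_at_left_real])
qed

text \<open>The admissible first parameters form a connected annulus, so equality near its outer rim
  propagates inward by the identity theorem.\<close>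

lemma beta_ratio_continuation:
  assumes dom: "beta_dom t1 t2 t3 t4 t5" and \<rho>: "\<rho> < 1"
    and eq: "\<And>a. beta_dom a t2 t3 t4 t5 \<Longrightarrow> \<rho> < norm a \<Longrightarrow> beta_ratio a t2 t3 t4 t5 = C"
  shows "beta_ratio t1 t2 t3 t4 t5 = C"
proof -
  note t = beta_domD[OF dom]
  have B0: "t2 * t3 * t4 * t5 \<noteq> 0" using t by simp
  define m where "m = norm (p * q) / norm (t2 * t3 * t4 * t5)"
  have S: "{a. beta_dom a t2 t3 t4 t5} = {a. m < norm a \<and> norm a < 1}"
    unfolding m_def by (rule beta_dom_annulus[OF t(2-5) B0])
  have m: "m < 1" using dom S by auto
  show ?thesis
  proof (rule analytic_continuation_open[of "{a. max m \<rho> < norm a \<and> norm a < 1}" "{a. m < norm a \<and> norm a < 1}"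
        "\<lambda>a. beta_ratio a t2 t3 t4 t5" "\<lambda>_. C" t1])
    obtain r where "max m \<rho> < r" "r < 1" using dense[of "max m \<rho>" 1] m \<rho> by auto
    moreover have "m \<ge> 0" by (simp add: m_def)
    ultimately have "complex_of_real r \<in> {a. max m \<rho> < norm a \<and> norm a < 1}" by simp
    then show "{a::complex. max m \<rho> < norm a \<and> norm a < 1} \<noteq> {}" by blast
    show "(\<lambda>a. beta_ratio a t2 t3 t4 t5) holomorphic_on {a. m < norm a \<and> norm a < 1}"
      using holomorphic_beta_ratio[OF t(2-5)] unfolding S .
    show "beta_ratio z t2 t3 t4 t5 = C" if "z \<in> {a. max m \<rho> < norm a \<and> norm a < 1}" for z
      using that S by (intro eq) auto
    show "open {a::complex. max m \<rho> < norm a \<and> norm a < 1}" by (rule open_annulus)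
  qed (use dom S in \<open>auto intro: open_annulus connected_annulus_0\<close>)
qed

theorem beta_ratio_eq:
  assumes q0: "q \<noteq> 0" and dom: "beta_dom t1 t2 t3 t4 t5"
  shows "beta_ratio t1 t2 t3 t4 t5 = 4 * pi / (qpoch p p * qpoch q q)" (is "_ = ?C")
proof -
  have less1: "norm p / norm x < 1 \<longleftrightarrow> norm p < norm x" if "x \<noteq> 0" for x :: complex
    using that by simp
  have less: "norm p < norm (a * x)" if "norm p / norm x < norm a" "x \<noteq> 0" for a x :: complex
    using that by (simp add: norm_mult pos_divide_less_eq mult.commute)
  \<comment> \<open>Each stage removes one factor from the condition |p| < |t2 t3 t4 t5|: when the
    released parameter is close to modulus 1 the previous condition holds, and continuation does the
    rest. After \<open>3\<close> and \<open>4\<close> the remaining condition is |p| < 1.\<close>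
  have 2: "beta_ratio t1 t2 t3 t4 t5 = ?C"
    if dom: "beta_dom t1 t2 t3 t4 t5" and B: "norm p < norm (t3 * t4 * t5)" for t1 t2 t3 t4 t5
  proof -
    note nz = beta_domD[OF dom]
    have "beta_ratio t2 t1 t3 t4 t5 = ?C"
    proof (rule beta_ratio_continuation)
      show "beta_dom t2 t1 t3 t4 t5" using dom by (simp add: beta_dom_swap)
      show "norm p / norm (t3 * t4 * t5) < 1" using B nz by (subst less1) auto
      fix a assume a: "beta_dom a t1 t3 t4 t5" "norm p / norm (t3 * t4 * t5) < norm a"
      have "beta_ratio t1 a t3 t4 t5 = ?C"
        using a less[OF a(2)] nz
        by (intro beta_ratio_eq_special_limit[OF q0]) (simp_all add: beta_dom_swap mult.assoc)
      then show "beta_ratio a t1 t3 t4 t5 = ?C" by (simp only: beta_ratio_swap(1)[of t1 a])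
    qed
    then show ?thesis by (simp only: beta_ratio_swap(1)[of t1 t2])
  qed
  have 3: "beta_ratio t1 t2 t3 t4 t5 = ?C"
    if dom: "beta_dom t1 t2 t3 t4 t5" and B: "norm p < norm (t4 * t5)" for t1 t2 t3 t4 t5
  proof -
    note nz = beta_domD[OF dom]
    have "beta_ratio t3 t2 t1 t4 t5 = ?C"
    proof (rule beta_ratio_continuation)
      show "beta_dom t3 t2 t1 t4 t5" using dom by (metis beta_dom_swap(1,2))
      show "norm p / norm (t4 * t5) < 1" using B nz by (subst less1) auto
      fix a assume a: "beta_dom a t2 t1 t4 t5" "norm p / norm (t4 * t5) < norm a"
      have "beta_dom t1 t2 a t4 t5" using a(1) by (metis beta_dom_swap(1,2))
      then have "beta_ratio t1 t2 a t4 t5 = ?C"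
        using less[OF a(2)] nz by (intro 2) (simp_all add: mult.assoc)
      then show "beta_ratio a t2 t1 t4 t5 = ?C" by (metis beta_ratio_swap(1,2))
    qed
    then show ?thesis by (metis beta_ratio_swap(1,2))
  qed
  have 4: "beta_ratio t1 t2 t3 t4 t5 = ?C"
    if dom: "beta_dom t1 t2 t3 t4 t5" and B: "norm p < norm t5" for t1 t2 t3 t4 t5
  proof -
    note nz = beta_domD[OF dom]
    have "beta_ratio t4 t2 t1 t3 t5 = ?C"
    proof (rule beta_ratio_continuation)
      show "beta_dom t4 t2 t1 t3 t5" using dom by (metis beta_dom_swap)
      show "norm p / norm t5 < 1" using B nz by (subst less1) auto
      fix a assume a: "beta_dom a t2 t1 t3 t5" "norm p / norm t5 < norm a"
      have "beta_dom t1 t2 t3 a t5" using a(1) by (metis beta_dom_swap)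
      then have "beta_ratio t1 t2 t3 a t5 = ?C"
        using less[OF a(2)] nz by (intro 3) simp_all
      then show "beta_ratio a t2 t1 t3 t5 = ?C" by (metis beta_ratio_swap)
    qed
    then show ?thesis by (metis beta_ratio_swap)
  qed
  have "beta_ratio t5 t2 t1 t3 t4 = ?C"
  proof (rule beta_ratio_continuation)
    show "beta_dom t5 t2 t1 t3 t4" using dom by (metis beta_dom_swap)
    show "norm p < 1" by (rule p)
    fix a assume a: "beta_dom a t2 t1 t3 t4" "norm p < norm a"
    have "beta_dom t1 t2 t3 t4 a" using a(1) by (metis beta_dom_swap)
    then have "beta_ratio t1 t2 t3 t4 a = ?C" using a(2) by (rule 4)
    then show "beta_ratio a t2 t1 t3 t4 = ?C" by (metis beta_ratio_swap)
  qed
  then show ?thesis by (metis beta_ratio_swap)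
qed

end

section \<open>Joint continuity in q, and the elliptic beta integral including q = 0\<close>

lemma continuous_on_qpoch_joint:
  assumes "continuous_on S f" "continuous_on S g" "\<And>v. v \<in> S \<Longrightarrow> norm (f v) < 1"
  shows "continuous_on S (\<lambda>v. qpoch (f v) (g v))"
proof -
  have "continuous_on (ball 0 1 \<times> UNIV) (\<lambda>(q, x). qpoch q x)"
    unfolding qpoch_def by (intro continuous_on_geo_prod holomorphic_intros) auto
  from continuous_on_compose2[OF this continuous_on_Pair[OF assms(1,2)]] assms(3)
  show ?thesis by (auto simp: image_subset_iff)
qed

lemma continuous_on_dpoch_joint:
  assumes "norm p < 1" "continuous_on S f" "continuous_on S g" "\<And>v. v \<in> S \<Longrightarrow> norm (f v) < 1"
  shows "continuous_on S (\<lambda>v. dpoch (f v) p (g v))"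
proof -
  have "continuous_on (ball 0 1 \<times> UNIV) (\<lambda>(q, x). dpoch q p x)"
    unfolding dpoch_def by (intro continuous_on_geo_prod holomorphic_qpoch_UNIV assms) auto
  from continuous_on_compose2[OF this continuous_on_Pair[OF assms(2,3)]] assms(4)
  show ?thesis by (auto simp: image_subset_iff)
qed

lemma continuous_on_ell_gamma_joint:
  assumes p: "norm p < 1" and fg: "continuous_on S f" "continuous_on S g"
    and f: "\<And>v. v \<in> S \<Longrightarrow> norm (f v) < 1"
    and g: "\<And>v. v \<in> S \<Longrightarrow> g v \<noteq> 0" "\<And>v. v \<in> S \<Longrightarrow> norm (g v) < 1"
  shows "continuous_on S (\<lambda>v. ell_gamma (f v) p (g v))"
proof -
  have "continuous_on S (\<lambda>v. dpoch (f v) p (p * f v / g v) / dpoch (f v) p (g v))"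
    using f g dpoch_nonzero[OF _ p] by (intro continuous_intros continuous_on_dpoch_joint p fg) auto
  then show ?thesis
    by (rule continuous_on_eq) (simp add: ell_gamma_eq[OF f p])
qed

lemma continuous_on_recip_ell_gamma_joint:
  assumes p: "norm p < 1" and fg: "continuous_on S f" "continuous_on S g"
    and f: "\<And>v. v \<in> S \<Longrightarrow> norm (f v) < 1"
    and g: "\<And>v. v \<in> S \<Longrightarrow> norm (p * f v) < norm (g v)"
  shows "continuous_on S (\<lambda>v. 1 / ell_gamma (f v) p (g v))"
proof -
  have g0: "g v \<noteq> 0" "dpoch (f v) p (p * f v / g v) \<noteq> 0" if v: "v \<in> S" for v
  proof -
    interpret nomes "f v" p by standard (use f v p in auto)
    show "dpoch (f v) p (p * f v / g v) \<noteq> 0"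
      by (rule dpoch_nonzero[OF f[OF v] p norm_pq_divide[OF g[OF v]]])
    show "g v \<noteq> 0" using g[OF v] norm_ge_zero[of "p * f v"] by auto
  qed
  have "continuous_on S (\<lambda>v. dpoch (f v) p (g v) / dpoch (f v) p (p * f v / g v))"
    using f g0 by (intro continuous_intros continuous_on_dpoch_joint p fg) auto
  then show ?thesis
    by (rule continuous_on_eq) (simp add: ell_gamma_eq[OF f p])
qed

theorem (in nomes) elliptic_beta_integral:
  assumes dom: "beta_dom t1 t2 t3 t4 t5"
  shows "beta_integral t1 t2 t3 t4 t5 * (qpoch p p * qpoch q q) = 4 * pi * beta_value t1 t2 t3 t4 t5"
proof (cases "q = 0")
  case False
  then show ?thesis
    using beta_ratio_eq[OF False dom] beta_value_nonzero[OF dom] qpoch_nonzero[OF p p] qpoch_nonzero[OF q q]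
    by (simp add: beta_ratio_def field_simps)
next
  case True
  note t = beta_domD[OF dom]
  define A where "A = t1 * t2 * t3 * t4 * t5"
  \<comment> \<open>The values of q for which the given parameters stay admissible; an open
    neighbourhood of 0 because A \<noteq> 0.\<close>
  define U where "U = {s. norm s < 1 \<and> norm (p * s) < norm A}"
  have U: "open U" unfolding U_def by (intro open_Collect_conj open_Collect_less continuous_intros)
  have U0: "0 \<in> U" using t True by (simp add: U_def A_def)
  have nomes: "nomes s p" if "s \<in> U" for s using that p by unfold_locales (auto simp: U_def)
  have domU: "nomes.beta_dom s p t1 t2 t3 t4 t5" if "s \<in> U" for s
    using that t by (simp add: nomes.beta_dom_def[OF nomes] U_def A_def)
  define G where "G a v = ell_gamma (fst v) p (a * cis (snd v)) * ell_gamma (fst v) p (a / cis (snd v))"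
    for a and v :: "complex \<times> real"
  define G' where "G' v = (1 / ell_gamma (fst v) p (A * cis (snd v))) * (1 / ell_gamma (fst v) p (A / cis (snd v)))"
    for v :: "complex \<times> real"
  \<comment> \<open>The theta function whose base varies is written out in \<open>qpoch\<close>
    factors, for which joint continuity is available.\<close>
  define F where "F v = G t1 v * G' v * (G t2 v * G t3 v * G t4 v * G t5 v *
     (theta p ((cis (snd v))\<^sup>2) * (qpoch (fst v) (1 / (cis (snd v))\<^sup>2) * qpoch (fst v) (fst v / (1 / (cis (snd v))\<^sup>2)))))"
    for v :: "complex \<times> real"
  let ?T = "U \<times> {0..2 * pi}"
  have fst: "norm (fst v) < 1" "norm (p * fst v) < norm A" if "v \<in> ?T" for v using that by (auto simp: U_def)
  have cG: "continuous_on ?T (G a)" if "a \<noteq> 0" "norm a < 1" for a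
    unfolding G_def using that
    by (intro continuous_on_mult continuous_on_ell_gamma_joint p fst continuous_intros) (auto simp: norm_mult norm_divide)
  have "continuous_on ?T (\<lambda>v. A * cis (snd v))" "continuous_on ?T (\<lambda>v. A / cis (snd v))"
    by (intro continuous_intros; simp)+
  then have cG': "continuous_on ?T G'"
    unfolding G'_def using fst
    by (intro continuous_on_mult[OF continuous_on_recip_ell_gamma_joint continuous_on_recip_ell_gamma_joint] p continuous_on_fst continuous_on_id)
       (auto simp: norm_mult norm_divide)
  have cth: "continuous_on ?T (\<lambda>v. theta p ((cis (snd v))\<^sup>2))"
  proof -
    have "continuous_on (- {0}) (theta p)"
      by (intro holomorphic_on_imp_continuous_on holomorphic_theta[of p "\<lambda>x. x", simplified] p) auto
    then show ?thesis
      by (rule continuous_on_compose2) (auto intro!: continuous_intros)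
  qed
  have "continuous_on ?T F"
    unfolding F_def
    by (intro continuous_on_mult cG cG' cth t continuous_on_qpoch_joint fst continuous_intros) auto
  then have "continuous_on U (\<lambda>s. integral (cbox 0 (2 * pi)) (\<lambda>\<theta>. F (s, \<theta>)))"
    by (intro integral_continuous_on_param) simp
  then have cint: "continuous_on U (\<lambda>s. nomes.beta_integral s p t1 t2 t3 t4 t5)"
  proof (rule continuous_on_eq)
    fix s assume s: "s \<in> U"
    note defs = nomes.beta_integral_def[OF nomes[OF s]] nomes.beta_integrand_def[OF nomes[OF s]]
      nomes.gpm_def[OF nomes[OF s]] nomes.wgt_def[OF nomes[OF s]]
    show "integral (cbox 0 (2 * pi)) (\<lambda>\<theta>. F (s, \<theta>)) = nomes.beta_integral s p t1 t2 t3 t4 t5"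
      unfolding defs F_def G_def G'_def A_def theta_def[of s] by simp
  qed
  have cval: "continuous_on U (\<lambda>s. nomes.beta_value s p t1 t2 t3 t4 t5)"
  proof -
    note n = norm_mult_less_1 t(1-5)
    have g: "continuous_on U (\<lambda>s. ell_gamma s p x)" if "norm x < 1" "x \<noteq> 0" for x
      using that by (intro continuous_on_ell_gamma_joint p continuous_intros) (auto simp: U_def)
    have r: "continuous_on U (\<lambda>s. 1 / ell_gamma s p x)" if Ay: "A = y * x" "norm y < 1" for x y
    proof (rule continuous_on_recip_ell_gamma_joint)
      show "norm (p * s) < norm x" if "s \<in> U" for s
      proof (rule norm_factor_bound[OF _ Ay])
        show "norm (p * s) < norm A" using that by (simp add: U_def)
      qed
      show "norm s < 1" if "s \<in> U" for s using that by (simp add: U_def)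
    qed (intro p continuous_on_id continuous_on_const)+
    have "continuous_on U (\<lambda>s. ell_gamma s p (t1 * t2) * ell_gamma s p (t1 * t3) * ell_gamma s p (t1 * t4) * ell_gamma s p (t1 * t5) *
     (ell_gamma s p (t2 * t3) * ell_gamma s p (t2 * t4) * ell_gamma s p (t2 * t5) * ell_gamma s p (t3 * t4) * ell_gamma s p (t3 * t5) * ell_gamma s p (t4 * t5)) *
     ((1 / ell_gamma s p (t1 * t2 * t3 * t4)) * (1 / ell_gamma s p (t1 * t2 * t3 * t5)) * (1 / ell_gamma s p (t1 * t2 * t4 * t5)) * (1 / ell_gamma s p (t1 * t3 * t4 * t5)) *
      (1 / ell_gamma s p (t2 * t3 * t4 * t5))))"
    proof (intro continuous_on_mult g)
      show "continuous_on U (\<lambda>s. 1 / ell_gamma s p (t1 * t2 * t3 * t4))" by (rule r[of t5]) (simp_all add: t A_def)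
      show "continuous_on U (\<lambda>s. 1 / ell_gamma s p (t1 * t2 * t3 * t5))" by (rule r[of t4]) (simp_all add: t A_def)
      show "continuous_on U (\<lambda>s. 1 / ell_gamma s p (t1 * t2 * t4 * t5))" by (rule r[of t3]) (simp_all add: t A_def)
      show "continuous_on U (\<lambda>s. 1 / ell_gamma s p (t1 * t3 * t4 * t5))" by (rule r[of t2]) (simp_all add: t A_def)
      show "continuous_on U (\<lambda>s. 1 / ell_gamma s p (t2 * t3 * t4 * t5))" by (rule r[of t1]) (simp_all add: t A_def)
    qed (simp_all add: t n)
    then show ?thesis
      by (rule continuous_on_eq) (simp add: nomes.beta_value_def[OF nomes])
  qed
  \<comment> \<open>A difference instead of the ratio: its continuity follows from that of both
    sides, and it vanishes on a punctured neighbourhood of 0.\<close>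
  define H where "H s = nomes.beta_integral s p t1 t2 t3 t4 t5 * (qpoch p p * qpoch s s) -
     4 * pi * nomes.beta_value s p t1 t2 t3 t4 t5" for s
  have "continuous_on U H"
    unfolding H_def by (intro continuous_intros continuous_on_qpoch_joint cint cval) (auto simp: U_def)
  then have "(H \<longlongrightarrow> H 0) (at 0)"
    using U U0 by (simp add: continuous_on_eq_continuous_at isCont_def)
  moreover have "\<forall>\<^sub>F s in at 0. H s = 0"
  proof -
    have "\<forall>\<^sub>F s in at 0. s \<in> U" using U U0 by (simp add: eventually_at_in_open')
    moreover have "\<forall>\<^sub>F s in at 0. s \<noteq> (0 :: complex)" by (simp add: eventually_at_filter)
    ultimately show ?thesis
    proof eventually_elim
      case (elim s)
      interpret n: nomes s p by (rule nomes[OF elim(1)])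
      show ?case
        using n.beta_ratio_eq[OF elim(2) domU[OF elim(1)]] n.beta_value_nonzero[OF domU[OF elim(1)]]
          qpoch_nonzero[OF p p] qpoch_nonzero[OF n.q n.q]
        by (simp add: H_def n.beta_ratio_def field_simps)
    qed
  qed
  ultimately have "H 0 = 0"
    using tendsto_unique[OF trivial_limit_at, of H "H 0" 0 0] tendsto_eventually by blast
  then show ?thesis by (simp add: H_def True)
qed

section \<open>Integral operators with continuous kernel\<close>

abbreviation circle_measure :: "real measure" where
  "circle_measure \<equiv> lebesgue_on {0..2 * pi}"

interpretation circle_measure: finite_measure circle_measure
  using finite_measure_lebesgue_on[of "cbox 0 (2 * pi)"] by simp

interpretation circle_measure_pair: pair_sigma_finite circle_measure circle_measure ..

lemma circle_integrable_iff:
  "circle_integrable f \<longleftrightarrow> integrable circle_measure (\<lambda>\<theta>. f (cis \<theta>) * (\<i> * cis \<theta>))"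
  unfolding circle_integrable_def set_integrable_def
  by (subst integrable_restrict_space) auto

lemma circle_integral_eq:
  "circle_integral f = (\<integral>\<theta>. f (cis \<theta>) * (\<i> * cis \<theta>) \<partial>circle_measure)"
  unfolding circle_integral_def set_lebesgue_integral_def
  by (subst integral_restrict_space) auto

lemma integrable_circle_continuous_mult:
  fixes c f :: "real \<Rightarrow> complex"
  assumes c: "continuous_on {0..2 * pi} c" and f: "integrable circle_measure f"
  shows "integrable circle_measure (\<lambda>\<theta>. c \<theta> * f \<theta>)"
proof -
  have "bounded (c ` {0..2 * pi})"
    by (intro compact_imp_bounded compact_continuous_image c) auto
  then obtain B where B: "\<And>\<theta>. \<theta> \<in> {0..2 * pi} \<Longrightarrow> norm (c \<theta>) \<le> B"
    by (auto simp: bounded_iff simp del: atLeastAtMost_iff)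
  have "c \<in> borel_measurable circle_measure"
    by (rule continuous_imp_measurable_on_sets_lebesgue[OF c]) simp
  then have "(\<lambda>\<theta>. c \<theta> * f \<theta>) \<in> borel_measurable circle_measure"
    using borel_measurable_integrable[OF f] by (rule borel_measurable_times)
  moreover have "AE \<theta> in circle_measure. norm (c \<theta> * f \<theta>) \<le> norm (of_real B * f \<theta>)"
  proof (rule AE_I2)
    fix \<theta> assume "\<theta> \<in> space circle_measure"
    then have "norm (c \<theta>) \<le> \<bar>B\<bar>" using B[of \<theta>] by auto
    then show "norm (c \<theta> * f \<theta>) \<le> norm (of_real B * f \<theta>)"
      by (simp add: norm_mult mult_right_mono)
  qed
  ultimately show ?thesis
    by (rule Bochner_Integration.integrable_bound[OF integrable_mult_right[OF f]])
qed

text \<open>The continuous kernel is bounded on the square by some B, so the integrals of |K a| over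
  the rows are at most B times the integral of |a|. The measure is finite, which gives integrability
  on the product.\<close>

lemma kernel_fubini:
  fixes K :: "real \<Rightarrow> real \<Rightarrow> complex" and a :: "real \<Rightarrow> complex"
  assumes K: "continuous_on ({0..2 * pi} \<times> {0..2 * pi}) (\<lambda>(\<phi>, \<theta>). K \<phi> \<theta>)"
    and a: "integrable circle_measure a"
  shows "integrable circle_measure (\<lambda>\<phi>. \<integral>\<theta>. K \<phi> \<theta> * a \<theta> \<partial>circle_measure)"
    and "(\<integral>\<phi>. (\<integral>\<theta>. K \<phi> \<theta> * a \<theta> \<partial>circle_measure) \<partial>circle_measure) =
         (\<integral>\<theta>. (\<integral>\<phi>. K \<phi> \<theta> \<partial>circle_measure) * a \<theta> \<partial>circle_measure)"
proof -
  let ?I = "{0..2 * pi}" and ?M = circle_measure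
  have "bounded ((\<lambda>(\<phi>, \<theta>). K \<phi> \<theta>) ` (?I \<times> ?I))"
    by (intro compact_imp_bounded compact_continuous_image K compact_Times) auto
  then obtain B where B: "\<And>\<phi> \<theta>. \<phi> \<in> ?I \<Longrightarrow> \<theta> \<in> ?I \<Longrightarrow> norm (K \<phi> \<theta>) \<le> B"
    by (auto simp: bounded_iff simp del: atLeastAtMost_iff)
  have row: "continuous_on ?I (K \<phi>)" if "\<phi> \<in> ?I" for \<phi>
  proof -
    have "continuous_on ?I (\<lambda>\<theta>. (\<lambda>(\<phi>, \<theta>). K \<phi> \<theta>) (\<phi>, \<theta>))"
      by (rule continuous_on_compose2[OF K]) (use that in \<open>auto intro!: continuous_intros\<close>)
    then show ?thesis by simp
  qed
  \<comment> \<open>Joint measurability goes through the Borel sets: K is Borel on the square, and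
    the identity is measurable from the Lebesgue sets to the Borel sets in each coordinate.\<close>
  have id: "(\<lambda>x. x) \<in> borel_measurable ?M"
    by (rule continuous_imp_measurable_on_sets_lebesgue) auto
  have "(\<lambda>v. (fst v, snd v)) \<in> measurable (?M \<Otimes>\<^sub>M ?M) (borel \<Otimes>\<^sub>M borel)"
    by (intro measurable_Pair measurable_compose[OF measurable_fst id] measurable_compose[OF measurable_snd id])
  then have "(\<lambda>v. v) \<in> measurable (?M \<Otimes>\<^sub>M ?M) (restrict_space borel (?I \<times> ?I))"
    by (intro measurable_restrict_space2) (auto simp: space_pair_measure borel_prod)
  from measurable_compose[OF this borel_measurable_continuous_on_restrict[OF K]]
  have K_meas: "(\<lambda>(\<phi>, \<theta>). K \<phi> \<theta>) \<in> borel_measurable (?M \<Otimes>\<^sub>M ?M)" .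
  have meas: "(\<lambda>(\<phi>, \<theta>). K \<phi> \<theta> * a \<theta>) \<in> borel_measurable (?M \<Otimes>\<^sub>M ?M)"
    using borel_measurable_times[OF K_meas measurable_compose[OF measurable_snd borel_measurable_integrable[OF a]]]
    by (simp add: case_prod_unfold)
  have row_int: "integrable ?M (\<lambda>\<theta>. K \<phi> \<theta> * a \<theta>)" if "\<phi> \<in> ?I" for \<phi>
    by (rule integrable_circle_continuous_mult[OF row[OF that] a])
  have int: "integrable (?M \<Otimes>\<^sub>M ?M) (\<lambda>(\<phi>, \<theta>). K \<phi> \<theta> * a \<theta>)"
  proof (rule circle_measure_pair.Fubini_integrable[OF meas])
    show "AE \<phi> in ?M. integrable ?M (\<lambda>\<theta>. case (\<phi>, \<theta>) of (\<phi>, \<theta>) \<Rightarrow> K \<phi> \<theta> * a \<theta>)"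
      using row_int by (intro AE_I2) simp
    show "integrable ?M (\<lambda>\<phi>. \<integral>\<theta>. norm (case (\<phi>, \<theta>) of (\<phi>, \<theta>) \<Rightarrow> K \<phi> \<theta> * a \<theta>) \<partial>?M)"
    proof (rule circle_measure.integrable_const_bound)
      show "AE \<phi> in ?M. norm (\<integral>\<theta>. norm (case (\<phi>, \<theta>) of (\<phi>, \<theta>) \<Rightarrow> K \<phi> \<theta> * a \<theta>) \<partial>?M) \<le>
          (\<integral>\<theta>. B * norm (a \<theta>) \<partial>?M)"
      proof (rule AE_I2)
        fix \<phi> assume "\<phi> \<in> space ?M"
        then have \<phi>: "\<phi> \<in> ?I" by simp
        have "norm (\<integral>\<theta>. norm (K \<phi> \<theta> * a \<theta>) \<partial>?M) = (\<integral>\<theta>. norm (K \<phi> \<theta> * a \<theta>) \<partial>?M)"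
          by (simp add: integral_nonneg_AE)
        also have "\<dots> \<le> (\<integral>\<theta>. B * norm (a \<theta>) \<partial>?M)"
          using B[OF \<phi>] by (intro integral_mono integrable_norm row_int[OF \<phi>] integrable_mult_right a)
            (auto simp: norm_mult intro: mult_right_mono)
        finally show "norm (\<integral>\<theta>. norm (case (\<phi>, \<theta>) of (\<phi>, \<theta>) \<Rightarrow> K \<phi> \<theta> * a \<theta>) \<partial>?M) \<le>
          (\<integral>\<theta>. B * norm (a \<theta>) \<partial>?M)" by simp
      qed
      have "(\<lambda>\<phi>. \<integral>\<theta>. (\<lambda>v. norm (case v of (\<phi>, \<theta>) \<Rightarrow> K \<phi> \<theta> * a \<theta>)) (\<phi>, \<theta>) \<partial>?M) \<in> borel_measurable ?M"
        using measurable_compose[OF meas borel_measurable_norm]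
        by (intro circle_measure.borel_measurable_lebesgue_integral) (simp add: case_prod_unfold)
      then show "(\<lambda>\<phi>. \<integral>\<theta>. norm (case (\<phi>, \<theta>) of (\<phi>, \<theta>) \<Rightarrow> K \<phi> \<theta> * a \<theta>) \<partial>?M) \<in> borel_measurable ?M"
        by simp
    qed
  qed
  from circle_measure_pair.integrable_fst'[OF int]
  show "integrable ?M (\<lambda>\<phi>. \<integral>\<theta>. K \<phi> \<theta> * a \<theta> \<partial>?M)" by simp
  have "(\<integral>\<phi>. (\<integral>\<theta>. K \<phi> \<theta> * a \<theta> \<partial>?M) \<partial>?M) = (\<integral>\<theta>. (\<integral>\<phi>. K \<phi> \<theta> * a \<theta> \<partial>?M) \<partial>?M)"
    by (rule circle_measure_pair.Fubini_integral[OF int, symmetric])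
  then show "(\<integral>\<phi>. (\<integral>\<theta>. K \<phi> \<theta> * a \<theta> \<partial>?M) \<partial>?M) = (\<integral>\<theta>. (\<integral>\<phi>. K \<phi> \<theta> \<partial>?M) * a \<theta> \<partial>?M)"
    by simp
qed

section \<open>The Bailey lemma\<close>

context nomes
begin

lemma ell_gammas_pm: "ell_gammas q p (pm a z) = gpm a z"
  by (simp add: ell_gammas_def pm_def gpm_def divide_inverse)

lemma ell_gammas_pm2: "ell_gammas q p (pm2 a w z) = gpm (a * w) z * gpm (a / w) z"
  by (simp add: ell_gammas_def pm2_def gpm_def divide_inverse mult_ac)

lemma ell_gammas_append: "ell_gammas q p (xs @ ys) = ell_gammas q p xs * ell_gammas q p ys"
  by (simp add: ell_gammas_def)

lemma continuous_on_gpm_joint: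
  assumes "continuous_on S f" "continuous_on S g"
    and "\<And>v. v \<in> S \<Longrightarrow> f v \<noteq> 0 \<and> norm (f v) < 1 \<and> norm (g v) = 1"
  shows "continuous_on S (\<lambda>v. gpm (f v) (g v))"
  unfolding gpm_def using assms(3)
  by (intro continuous_on_mult continuous_on_\<Gamma> continuous_on_divide assms(1,2)) (force simp: norm_mult norm_divide)+

lemma continuous_on_pm2_joint:
  assumes "continuous_on S f" "continuous_on S g" "a \<noteq> 0" "norm a < 1"
    and "\<And>v. v \<in> S \<Longrightarrow> norm (f v) = 1 \<and> norm (g v) = 1"
  shows "continuous_on S (\<lambda>v. ell_gammas q p (pm2 a (f v) (g v)))"
proof -
  have "f v \<noteq> 0" if "v \<in> S" for v using assms(5)[OF that] by auto
  then show ?thesis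
    unfolding ell_gammas_pm2
    by (intro continuous_on_mult continuous_on_gpm_joint continuous_on_divide continuous_on_const assms(1,2))
       (use assms in \<open>auto simp: norm_mult norm_divide\<close>)
qed

lemma gpm_nonzero:
  "norm (p * q) < norm a \<Longrightarrow> norm a < 1 \<Longrightarrow> norm z = 1 \<Longrightarrow> gpm a z \<noteq> 0"
  by (simp add: gpm_def \<Gamma>_nonzero norm_mult norm_divide)

end

locale bailey_params = nomes +
  fixes t s u :: complex
  assumes t1: "norm t < 1" and s1: "norm s < 1" and u1: "norm u < 1"
    and tsu: "norm (p * q) < norm (t\<^sup>2 * s\<^sup>2 * u)"
begin

lemma params_nonzero: "t \<noteq> 0" "s \<noteq> 0" "u \<noteq> 0"
  using tsu norm_ge_zero[of "p * q"] by fastforce+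

lemma params_factor:
  assumes "t\<^sup>2 * s\<^sup>2 * u = y * x" "norm y \<le> 1"
  shows "norm (p * q) < norm x"
proof -
  have "norm (y * x) \<le> norm x" using assms(2) by (simp add: norm_mult mult_left_le_one_le)
  with tsu assms(1) show ?thesis by simp
qed

definition bailey_kernel :: "complex \<Rightarrow> complex \<Rightarrow> complex" where
  "bailey_kernel w x = ell_gammas q p (pm2 s w x @ pm u x) /
     ell_gammas q p (pm 1 (x\<^sup>2) @ pm (t\<^sup>2 * s\<^sup>2 * u) x)"

lemma bailey_kernel_eq:
  assumes "norm x = 1"
  shows "bailey_kernel w x = ell_gammas q p (pm2 s w x) * gpm u x * wgt x * (1 / gpm (t\<^sup>2 * s\<^sup>2 * u) x)"
  using \<Gamma>_square_recip[OF assms]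
  by (simp add: bailey_kernel_def ell_gammas_append ell_gammas_pm wgt_def divide_inverse mult_ac)

lemma continuous_on_bailey_kernel:
  assumes "norm w = 1"
  shows "continuous_on (sphere 0 1) (bailey_kernel w)"
proof -
  have "continuous_on (sphere 0 1) (\<lambda>x. ell_gammas q p (pm2 s w x) * gpm u x * wgt x * (1 / gpm (t\<^sup>2 * s\<^sup>2 * u) x))"
    using assms params_nonzero s1 u1
    by (intro continuous_on_mult continuous_on_pm2_joint continuous_on_gpm continuous_on_wgt
          continuous_on_recip_gpm tsu continuous_intros) auto
  then show ?thesis by (rule continuous_on_eq) (simp add: bailey_kernel_eq)
qed

definition bailey_prefactor :: "complex \<Rightarrow> complex" where
  "bailey_prefactor w = ell_gammas q p ([t\<^sup>2 * s\<^sup>2] @ pm (t\<^sup>2 * s * u) w) /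
     ell_gammas q p ([s\<^sup>2, t\<^sup>2] @ pm (s * u) w)"

text \<open>Among the ten pairs and five quadruples of the parameters s w, s / w, u, t z, t / z,
  those free of z are cancelled by \<open>bailey_prefactor\<close>. The four mixed pairs give the
  kernel with parameter s t, and the others the quotient by which \<alpha> is multiplied.\<close>

lemma bailey_kernel_integral:
  assumes w: "norm w = 1" and z: "norm z = 1"
  shows "bailey_prefactor w * (qpoch p p * qpoch q q / (4 * pi)) *
      integral {0..2 * pi} (\<lambda>\<phi>. bailey_kernel w (cis \<phi>) * ell_gammas q p (pm2 t (cis \<phi>) z)) =
     ell_gammas q p (pm2 (s * t) w z) * (gpm (t * u) z / gpm (t * s\<^sup>2 * u) z)"
proof -
  have wz0: "w \<noteq> 0" "z \<noteq> 0" using w z by auto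
  note nz0 = params_nonzero
  have A: "s * w * (s / w) * u * (t * z) * (t / z) = t\<^sup>2 * s\<^sup>2 * u"
    using wz0 by (simp add: power2_eq_square)
  have dom: "beta_dom (s * w) (s / w) u (t * z) (t / z)"
    unfolding beta_dom_def A using w z t1 s1 u1 tsu by (simp add: norm_mult norm_divide)
  have "beta_integrand (s * w) (s / w) u (t * z) (t / z) x = bailey_kernel w x * ell_gammas q p (pm2 t x z)"
    if x: "norm x = 1" for x
  proof -
    have "ell_gammas q p (pm2 t x z) = gpm (t * z) x * gpm (t / z) x"
      by (simp add: ell_gammas_def pm2_def gpm_def divide_inverse mult_ac)
    then show ?thesis
      unfolding beta_integrand_def A bailey_kernel_eq[OF x] ell_gammas_pm2 by simp
  qed
  then have int: "integral {0..2 * pi} (\<lambda>\<phi>. bailey_kernel w (cis \<phi>) * ell_gammas q p (pm2 t (cis \<phi>) z)) =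
      beta_integral (s * w) (s / w) u (t * z) (t / z)"
    by (simp add: beta_integral_def)
  define V where "V = beta_value (s * w) (s / w) u (t * z) (t / z)"
  have I: "qpoch p p * qpoch q q / (4 * pi) * beta_integral (s * w) (s / w) u (t * z) (t / z) = V"
    using elliptic_beta_integral[OF dom] unfolding V_def by (simp add: field_simps)
  have e: "s * w * (s / w) = s\<^sup>2" "s * w * u = s * u * w" "s * w * (t * z) = s * t * w * z"
    "s * w * (t / z) = s * t * w / z" "s / w * u = s * u / w" "s / w * (t * z) = s * t / w * z"
    "s / w * (t / z) = s * t / w / z" "u * (t * z) = t * u * z" "u * (t / z) = t * u / z"
    "t * z * (t / z) = t\<^sup>2" "s\<^sup>2 * u * (t * z) = t * s\<^sup>2 * u * z" "s\<^sup>2 * u * (t / z) = t * s\<^sup>2 * u / z"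
    "s\<^sup>2 * (t * z) * (t / z) = t\<^sup>2 * s\<^sup>2" "s * u * w * (t * z) * (t / z) = t\<^sup>2 * s * u * w"
    "s * u / w * (t * z) * (t / z) = t\<^sup>2 * s * u / w"
    using wz0 by (simp_all add: power2_eq_square field_simps)
  have V: "V = \<Gamma> (s\<^sup>2) * \<Gamma> (t\<^sup>2) * gpm (s * u) w * ell_gammas q p (pm2 (s * t) w z) * gpm (t * u) z /
     (gpm (t * s\<^sup>2 * u) z * \<Gamma> (t\<^sup>2 * s\<^sup>2) * gpm (t\<^sup>2 * s * u) w)"
    unfolding V_def beta_value_def e ell_gammas_pm2 gpm_def by (simp add: mult_ac)
  have "\<Gamma> (s\<^sup>2) \<noteq> 0" "\<Gamma> (t\<^sup>2) \<noteq> 0" "gpm (s * u) w \<noteq> 0" "\<Gamma> (t\<^sup>2 * s\<^sup>2) \<noteq> 0" "gpm (t\<^sup>2 * s * u) w \<noteq> 0"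
  proof -
    have le: "norm (x ^ n) \<le> 1" if "norm x < 1" for x :: complex and n
      using that by (simp add: norm_power power_le_one)
    have lt: "norm (x\<^sup>2) < 1" if "norm x < 1" for x :: complex
      using that by (simp add: norm_power power_less_one_iff)
    note n = norm_mult_less_1 lt t1 s1 u1 less_imp_le
    show "\<Gamma> (s\<^sup>2) \<noteq> 0" by (intro \<Gamma>_nonzero params_factor[of "t\<^sup>2 * u"] n) (simp_all add: mult_ac)
    show "\<Gamma> (t\<^sup>2) \<noteq> 0" by (intro \<Gamma>_nonzero params_factor[of "s\<^sup>2 * u"] n) (simp_all add: mult_ac)
    show "\<Gamma> (t\<^sup>2 * s\<^sup>2) \<noteq> 0" by (intro \<Gamma>_nonzero params_factor[of u] n) (simp_all add: mult_ac)
    show "gpm (s * u) w \<noteq> 0"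
      by (intro gpm_nonzero params_factor[of "t\<^sup>2 * s"] n w) (simp_all add: mult_ac power2_eq_square)
    show "gpm (t\<^sup>2 * s * u) w \<noteq> 0"
      by (intro gpm_nonzero params_factor[of s] n w) (simp_all add: mult_ac power2_eq_square)
  qed
  then have "bailey_prefactor w * V = ell_gammas q p (pm2 (s * t) w z) * (gpm (t * u) z / gpm (t * s\<^sup>2 * u) z)"
    unfolding V bailey_prefactor_def ell_gammas_append ell_gammas_pm
    by (simp add: ell_gammas_def field_simps)
  then show ?thesis unfolding int by (simp only: mult.assoc I[unfolded mult.assoc])
qed

lemma continuous_on_kernel_product:
  assumes "norm w = 1"
  shows "continuous_on ({0..2 * pi} \<times> {0..2 * pi})
    (\<lambda>(\<phi>, \<theta>). bailey_kernel w (cis \<phi>) * ell_gammas q p (pm2 t (cis \<phi>) (cis \<theta>)))"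
  unfolding case_prod_unfold
  by (intro continuous_on_mult continuous_on_pm2_joint params_nonzero t1
        continuous_on_compose2[OF continuous_on_bailey_kernel[OF assms]])
     (auto intro!: continuous_intros)

lemma bailey_kappa_eq: "bailey_kappa q p * \<i> = qpoch p p * qpoch q q / (4 * pi)"
  by (simp add: bailey_kappa_def euler_poch_eq)

lemma bailey_transform:
  assumes pair: "elliptic_bailey_pair q p t \<alpha> \<beta>"
    and \<alpha>': "\<And>w. w \<in> sphere 0 1 \<Longrightarrow> \<alpha>' w = gpm (t * u) w / gpm (t * s\<^sup>2 * u) w * \<alpha> w"
    and \<beta>': "\<And>w. w \<in> sphere 0 1 \<Longrightarrow> \<beta>' w = bailey_kappa q p * bailey_prefactor w *
             circle_integral (bailey_beta_integrand q p t s u \<beta> w)"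
    and w: "w \<in> sphere 0 1"
  shows "circle_integrable (bailey_beta_integrand q p t s u \<beta> w)"
    and "circle_integrable (\<lambda>z. ell_gammas q p (pm2 (s * t) w z) * \<alpha>' z / z)"
    and "\<beta>' w = bailey_kappa q p * circle_integral (\<lambda>z. ell_gammas q p (pm2 (s * t) w z) * \<alpha>' z / z)"
proof -
  let ?M = circle_measure
  define a where "a \<theta> = \<alpha> (cis \<theta>)" for \<theta>
  define c where "c = qpoch p p * qpoch q q / (4 * complex_of_real pi)"
  define E where "E r w z = ell_gammas q p (pm2 r w z)" for r w z
  have w1: "norm w = 1" using w by simp
  have \<kappa>: "bailey_kappa q p * (\<i> * x) = c * x" for x
    using bailey_kappa_eq by (simp add: c_def mult.assoc[symmetric])
  have contE: "continuous_on T (\<lambda>\<theta>. E r v (cis \<theta>))" if "r \<noteq> 0" "norm r < 1" "norm v = 1" for r v and T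
    unfolding E_def using that by (intro continuous_on_pm2_joint continuous_intros) auto
  \<comment> \<open>This is dz / z = \<i> d\<theta>; the factor \<i> is then absorbed into the
    constant c.\<close>
  have drop_cis: "x * y / cis \<theta> * (\<i> * cis \<theta>) = \<i> * (x * y)" for x y \<theta> by simp
  \<comment> \<open>Take w = 1 in the pair and divide by the kernel, which is continuous and without
    zeros on the circle.\<close>
  have a_int: "integrable ?M a"
  proof -
    have nz: "E t 1 (cis \<theta>) \<noteq> 0" for \<theta>
      unfolding E_def ell_gammas_pm2
      using gpm_nonzero[OF _ t1 norm_cis] params_factor[of "t * s\<^sup>2 * u" t] t1 s1 u1
      by (simp add: norm_mult norm_power power2_eq_square mult_le_one mult_ac)
    have "integrable ?M (\<lambda>\<theta>. \<i> * (E t 1 (cis \<theta>) * a \<theta>))"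
      using pair unfolding elliptic_bailey_pair_def circle_integrable_iff drop_cis E_def a_def by simp
    then have "integrable ?M (\<lambda>\<theta>. (1 / (\<i> * E t 1 (cis \<theta>))) * (\<i> * (E t 1 (cis \<theta>) * a \<theta>)))"
    proof (rule integrable_circle_continuous_mult[rotated])
      show "continuous_on {0..2 * pi} (\<lambda>\<theta>. 1 / (\<i> * E t 1 (cis \<theta>)))"
        using nz params_nonzero(1) t1 by (intro continuous_intros contE) auto
    qed
    then show ?thesis using nz by simp
  qed
  have \<beta>: "\<beta> (cis \<phi>) = c * (\<integral>\<theta>. E t (cis \<phi>) (cis \<theta>) * a \<theta> \<partial>?M)" for \<phi>
    using pair unfolding elliptic_bailey_pair_def circle_integral_eq drop_cis
    by (simp add: E_def a_def \<kappa>)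
  define K where "K \<phi> \<theta> = bailey_kernel w (cis \<phi>) * E t (cis \<phi>) (cis \<theta>)" for \<phi> \<theta>
  have K: "continuous_on ({0..2 * pi} \<times> {0..2 * pi}) (\<lambda>(\<phi>, \<theta>). K \<phi> \<theta>)"
    unfolding K_def E_def by (rule continuous_on_kernel_product[OF w1])
  have integrand: "bailey_beta_integrand q p t s u \<beta> w (cis \<phi>) * (\<i> * cis \<phi>) =
     \<i> * c * (\<integral>\<theta>. K \<phi> \<theta> * a \<theta> \<partial>?M)" for \<phi>
  proof -
    have "bailey_beta_integrand q p t s u \<beta> w (cis \<phi>) * (\<i> * cis \<phi>) = \<i> * (bailey_kernel w (cis \<phi>) * \<beta> (cis \<phi>))"
      unfolding bailey_beta_integrand_def bailey_kernel_def[symmetric] drop_cis ..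
    then show ?thesis by (simp add: \<beta> K_def mult.assoc)
  qed
  show "circle_integrable (bailey_beta_integrand q p t s u \<beta> w)"
    unfolding circle_integrable_iff integrand
    by (intro integrable_mult_right kernel_fubini(1)[OF K a_int])
  define g where "g \<theta> = E (s * t) w (cis \<theta>) * (gpm (t * u) (cis \<theta>) / gpm (t * s\<^sup>2 * u) (cis \<theta>))" for \<theta>
  \<comment> \<open>Two factors c occur, one from \<beta> and one from \<beta>'. One is consumed
    here by the beta integral, the other becomes the constant of the new pair.\<close>
  have inner: "bailey_prefactor w * c * (\<integral>\<phi>. K \<phi> \<theta> \<partial>?M) = g \<theta>" if \<theta>: "\<theta> \<in> {0..2 * pi}" for \<theta>
  proof -
    have "continuous_on {0..2 * pi} (\<lambda>\<phi>. (\<lambda>(\<phi>, \<theta>). K \<phi> \<theta>) (\<phi>, \<theta>))"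
      by (rule continuous_on_compose2[OF K]) (use \<theta> in \<open>auto intro!: continuous_intros\<close>)
    then have "continuous_on {0..2 * pi} (\<lambda>\<phi>. K \<phi> \<theta>)" by simp
    from integrable_circle_continuous_mult[OF this circle_measure.integrable_const[of 1]]
    have "(\<integral>\<phi>. K \<phi> \<theta> \<partial>?M) = integral {0..2 * pi} (\<lambda>\<phi>. K \<phi> \<theta>)"
      by (intro lebesgue_integral_eq_integral) simp_all
    then show ?thesis
      using bailey_kernel_integral[OF w1 norm_cis, of \<theta>] by (simp add: K_def E_def g_def c_def)
  qed
  have new: "ell_gammas q p (pm2 (s * t) w (cis \<theta>)) * \<alpha>' (cis \<theta>) / cis \<theta> * (\<i> * cis \<theta>) = \<i> * (g \<theta> * a \<theta>)" for \<theta>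
    unfolding drop_cis by (simp add: \<alpha>' g_def E_def a_def)
  have "norm (p * q) < norm (t * s\<^sup>2 * u)"
    using t1 by (intro params_factor[of t]) (simp_all add: power2_eq_square)
  from continuous_on_recip_gpm[OF this]
  have "continuous_on (sphere 0 1) (\<lambda>z. gpm (t * u) z * (1 / gpm (t * s\<^sup>2 * u) z))"
    using params_nonzero norm_mult_less_1[OF t1 u1] by (intro continuous_on_mult continuous_on_gpm) auto
  from continuous_on_cis_compose[OF this]
  have "continuous_on {0..2 * pi} g"
    unfolding g_def using params_nonzero norm_mult_less_1[OF s1 t1] w1
    by (intro continuous_on_mult contE) auto
  from integrable_circle_continuous_mult[OF this a_int]
  show "circle_integrable (\<lambda>z. ell_gammas q p (pm2 (s * t) w z) * \<alpha>' z / z)"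
    unfolding circle_integrable_iff new by (rule integrable_mult_right)
  have "\<beta>' w = bailey_prefactor w * (bailey_kappa q p * (\<i> * (c * (\<integral>\<phi>. (\<integral>\<theta>. K \<phi> \<theta> * a \<theta> \<partial>?M) \<partial>?M))))"
    unfolding \<beta>'[OF w] circle_integral_eq integrand by (simp add: mult_ac)
  also have "\<dots> = c * (bailey_prefactor w * c * (\<integral>\<theta>. (\<integral>\<phi>. K \<phi> \<theta> \<partial>?M) * a \<theta> \<partial>?M))"
    unfolding \<kappa> kernel_fubini(2)[OF K a_int] by (simp add: mult_ac)
  also have "bailey_prefactor w * c * (\<integral>\<theta>. (\<integral>\<phi>. K \<phi> \<theta> \<partial>?M) * a \<theta> \<partial>?M) =
     (\<integral>\<theta>. bailey_prefactor w * c * ((\<integral>\<phi>. K \<phi> \<theta> \<partial>?M) * a \<theta>) \<partial>?M)"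
    by simp
  also have "\<dots> = (\<integral>\<theta>. g \<theta> * a \<theta> \<partial>?M)"
    using inner by (intro Bochner_Integration.integral_cong refl) (simp add: mult.assoc[symmetric])
  also have "c * \<dots> = bailey_kappa q p * circle_integral (\<lambda>z. ell_gammas q p (pm2 (s * t) w z) * \<alpha>' z / z)"
    unfolding circle_integral_eq new by (simp add: \<kappa>)
  finally show "\<beta>' w = bailey_kappa q p * circle_integral (\<lambda>z. ell_gammas q p (pm2 (s * t) w z) * \<alpha>' z / z)" .
qed

end

text \<open>The first conjunct certifies that the integral defining \<beta>' exists; a
  non-integrable integrand would silently have the integral 0.\<close>

theorem theorem1:
  fixes q p t s u :: complex
    and \<alpha> \<beta> \<alpha>' \<beta>' :: "complex \<Rightarrow> complex"
  assumes "norm q < 1" and "norm p < 1"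
    and "norm t < 1" and "norm s < 1" and "norm u < 1"
    and "norm (p * q) < norm (t\<^sup>2 * s\<^sup>2 * u)"
    and "elliptic_bailey_pair q p t \<alpha> \<beta>"
    and "\<And>w. w \<in> sphere 0 1 \<Longrightarrow>
           \<alpha>' w = ell_gammas q p (pm (t * u) w) / ell_gammas q p (pm (t * s\<^sup>2 * u) w) * \<alpha> w"
    and "\<And>w. w \<in> sphere 0 1 \<Longrightarrow>
           \<beta>' w = bailey_kappa q p *
             (ell_gammas q p ([t\<^sup>2 * s\<^sup>2] @ pm (t\<^sup>2 * s * u) w) /
              ell_gammas q p ([s\<^sup>2, t\<^sup>2] @ pm (s * u) w)) *
             circle_integral (bailey_beta_integrand q p t s u \<beta> w)"
  shows "(\<forall>w\<in>sphere 0 1. circle_integrable (bailey_beta_integrand q p t s u \<beta> w)) \<and>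
         elliptic_bailey_pair q p (s * t) \<alpha>' \<beta>'"
proof -
  interpret bailey_params q p t s u
    by unfold_locales fact+
  note transform = bailey_transform[OF assms(7) assms(8)[unfolded ell_gammas_pm]
      assms(9)[folded bailey_prefactor_def]]
  show ?thesis
    unfolding elliptic_bailey_pair_def using transform by blast
qed

end
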